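(* Let $X$ be a compact complex manifold of dimension $n$ with $c_1(X)=0$ and let $P$ be a holomorphic principal $G$-bundle over $X$. (1) Suppose that $(X,P)$ admits a solution $(\Psi,\omega,h)$ of the twisted Hull-Strominger system $$F_h\wedge\omega^{n-1}=0,\quad d\Psi-\theta_\omega\wedge\Psi=0,\quad d\theta_\omega=0,\quad dd^c\omega-c(F_h\wedge F_h)=0,$$ with $[\theta_\omega]=0\in H^1(X,\mathbb R)$. If $\theta_\omega=d\phi$, then $\Omega=e^{-\phi}\Psi$ is a holomorphic volume form on $X$ and $(\omega,h)$ is a solution of the Hull-Strominger system on $(X,\Omega)$ and $P$: $$F_h\wedge\omega^{n-1}=0,\quad d^*\omega-d^c\log\|\Omega\|_\omega=0,\quad dd^c\omega-c(F_h\wedge F_h)=0.$$ (2) Conversely, if $\Omega$ is a holomorphic volume form on $X$ and $(\omega,h)$ is a solution of the Hull-Strominger system on $(X,P)$ (with respect to $\Omega$), then $(\|\Omega\|_\omega^{-1}\Omega,\omega,h)$ is a solution of the twisted Hull-Strominger system with $[\theta_\omega]=0$.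
   Context: Convention: $d^c=i(\bar\partial-\partial)$, so $dd^c=2i\partial\bar\partial$; on one-forms $J\alpha=-\alpha(J\cdot)$, so $d^cf=Jdf$. For a hermitian form $\omega$ (real $(1,1)$-form with $g=\omega(\cdot,J\cdot)$ a Riemannian metric), the Lee form $\theta_\omega=Jd^*\omega$ is the unique real one-form with $d\omega^{n-1}=\theta_\omega\wedge\omega^{n-1}$. For a smooth section $\Psi$ of $K_X$, $\|\Psi\|_\omega$ is defined by $\|\Psi\|^2_\omega\,\omega^n/n!=(-1)^{n(n-1)/2}i^n\Psi\wedge\overline\Psi$. An $\mathrm{SU}(n)$-structure is a pair $(\Psi,\omega)$ of a smooth section $\Psi$ of $K_X$ and a hermitian form $\omega$ with $\|\Psi\|_\omega=1$. $G$ is a complex reductive Lie group with Lie algebra $\mathfrak g$, $K\subset G$ is a maximal compact subgroup with Lie algebra $\mathfrak k$, and $c:\mathfrak g\otimes\mathfrak g\to\mathbb C$ is a fixed non-degenerate bi-invariant symmetric bilinear form with $c(\mathfrak k\otimes\mathfrak k)\subset\mathbb R$. For a reduction $h$ of $P$ to $K$, $F_h$ is the curvature of its Chern connection. In the twisted Hull-Strominger system the unknown is a triple $(\Psi,\omega,h)$ with $(\Psi,\omega)$ an $\mathrm{SU}(n)$-structure and $h$ a reduction of $P$ to $K$; in the Hull-Strominger system the unknown is a pair $(\omega,h)$ with $\omega$ a hermitian form and $h$ a reduction. A holomorphic volume form is a nowhere vanishing holomorphic section of $K_X$. *)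

theory Defs
  imports "HOL-Analysis.Analysis" "HOL-Algebra.Group"
begin

section \<open>Finite-dimensional complex vector spaces as model spaces\<close>

text \<open>The class admits the zero space, so that zero-dimensional Lie groups are not excluded.
  No compatibility of the norm with complex scalars is needed: in finite dimensions the norm only
  fixes the topology.\<close>

class complex_model_space = real_normed_vector +
  fixes cscale :: "complex \<Rightarrow> 'a \<Rightarrow> 'a" (infixr "*\<^sub>\<C>" 75)
  assumes cscale_add_right: "c *\<^sub>\<C> (v + w) = c *\<^sub>\<C> v + c *\<^sub>\<C> w"
    and cscale_add_left: "(c + d) *\<^sub>\<C> v = c *\<^sub>\<C> v + d *\<^sub>\<C> v"
    and cscale_cscale: "c *\<^sub>\<C> (d *\<^sub>\<C> v) = (c * d) *\<^sub>\<C> v"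
    and cscale_of_real: "complex_of_real r *\<^sub>\<C> v = r *\<^sub>R v"
    and finite_dimensional: "\<exists>B. finite B \<and> (\<forall>v. \<exists>a. v = (\<Sum>b\<in>B. a b *\<^sub>R b))"

lemma finite_dimensional_span:
  "\<exists>B::'a::complex_model_space set. finite B \<and> span B = UNIV"
proof -
  obtain B :: "'a set" where "finite B" "\<forall>v. \<exists>a. v = (\<Sum>b\<in>B. a b *\<^sub>R b)"
    using finite_dimensional by blast
  then show ?thesis by (intro exI[of _ B]) (auto simp: span_finite image_iff)
qed

lemma finite_dimensionalI:
  fixes B :: "'a::real_vector set"
  assumes "finite B" "span B = UNIV"
  shows "\<exists>B::'a set. finite B \<and> (\<forall>v. \<exists>a. v = (\<Sum>b\<in>B. a b *\<^sub>R b))"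
proof (intro exI[of _ B] conjI allI)
  fix v
  have "v \<in> span B" using assms by simp
  then show "\<exists>a. v = (\<Sum>b\<in>B. a b *\<^sub>R b)" using assms(1) by (auto simp: span_finite)
qed (fact assms)

instantiation complex :: complex_model_space
begin
definition cscale_complex :: "complex \<Rightarrow> complex \<Rightarrow> complex" where
  "cscale_complex c z = c * z"
instance
proof
  show "\<exists>B::complex set. finite B \<and> (\<forall>v. \<exists>a. v = (\<Sum>b\<in>B. a b *\<^sub>R b))"
    by (rule finite_dimensionalI[OF finite_Basis span_Basis])
qed (simp_all add: cscale_complex_def algebra_simps scaleR_conv_of_real)
end

instantiation vec :: (complex_model_space, finite) complex_model_space
begin
definition cscale_vec :: "complex \<Rightarrow> 'a ^ 'b \<Rightarrow> 'a ^ 'b" where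
  "cscale_vec c v = (\<chi> i. c *\<^sub>\<C> (v $ i))"
instance
proof
  obtain B :: "'a set" where B: "finite B" "span B = UNIV"
    using finite_dimensional_span by blast
  define C :: "('a ^ 'b) set" where "C = (\<Union>i. axis i ` B)"
  have lin: "linear (axis i :: 'a \<Rightarrow> 'a ^ 'b)" for i
    by (rule linearI) (simp_all add: vec_eq_iff axis_def)
  have ax: "axis i w \<in> span C" for i and w :: 'a
  proof -
    have "axis i w \<in> axis i ` span B" using B by simp
    also have "\<dots> = span (axis i ` B)" by (rule linear_span_image[OF lin, symmetric])
    also have "\<dots> \<subseteq> span C" by (rule span_mono) (auto simp: C_def)
    finally show ?thesis .
  qed
  have "v \<in> span C" for v
  proof -
    have "v = (\<Sum>i\<in>UNIV. axis i (v $ i))"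
      by (simp add: vec_eq_iff axis_def sum.delta)
    moreover have "(\<Sum>i\<in>UNIV. axis i (v $ i)) \<in> span C"
      by (intro span_sum ax)
    ultimately show ?thesis by simp
  qed
  then have "finite C" "span C = UNIV" using B by (auto simp: C_def)
  then show "\<exists>B::('a ^ 'b) set. finite B \<and> (\<forall>v. \<exists>a. v = (\<Sum>b\<in>B. a b *\<^sub>R b))"
    by (rule finite_dimensionalI)
qed (simp_all add: cscale_vec_def vec_eq_iff cscale_add_right cscale_add_left cscale_cscale
      cscale_of_real)
end

instantiation prod :: (complex_model_space, complex_model_space) complex_model_space
begin
definition cscale_prod :: "complex \<Rightarrow> 'a \<times> 'b \<Rightarrow> 'a \<times> 'b" where
  "cscale_prod c v = (c *\<^sub>\<C> fst v, c *\<^sub>\<C> snd v)"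
instance
proof
  obtain A :: "'a set" where A: "finite A" "span A = UNIV"
    using finite_dimensional_span by blast
  obtain B :: "'b set" where B: "finite B" "span B = UNIV"
    using finite_dimensional_span by blast
  define C where "C = (\<lambda>a. (a, 0::'b)) ` A \<union> (\<lambda>b. (0::'a, b)) ` B"
  have l1: "linear (\<lambda>a. (a::'a, 0::'b))" by (rule linearI) simp_all
  have l2: "linear (\<lambda>b. (0::'a, b::'b))" by (rule linearI) simp_all
  have 1: "(a, 0) \<in> span C" for a
  proof -
    have "(a, 0) \<in> (\<lambda>a. (a, 0::'b)) ` span A" using A by simp
    also have "\<dots> = span ((\<lambda>a. (a, 0::'b)) ` A)" by (rule linear_span_image[OF l1, symmetric])
    also have "\<dots> \<subseteq> span C" by (rule span_mono) (auto simp: C_def)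
    finally show ?thesis .
  qed
  have 2: "(0, b) \<in> span C" for b
  proof -
    have "(0, b) \<in> (\<lambda>b. (0::'a, b)) ` span B" using B by simp
    also have "\<dots> = span ((\<lambda>b. (0::'a, b)) ` B)" by (rule linear_span_image[OF l2, symmetric])
    also have "\<dots> \<subseteq> span C" by (rule span_mono) (auto simp: C_def)
    finally show ?thesis .
  qed
  have "v \<in> span C" for v
    using span_add[OF 1 2, of "fst v" "snd v"] by simp
  then have "finite C" "span C = UNIV" using A B by (auto simp: C_def)
  then show "\<exists>B::('a \<times> 'b) set. finite B \<and> (\<forall>v. \<exists>a. v = (\<Sum>b\<in>B. a b *\<^sub>R b))"
    by (rule finite_dimensionalI)
qed (simp_all add: cscale_prod_def cscale_add_right cscale_add_left cscale_cscale
      cscale_of_real prod_eq_iff)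
end

abbreviation J :: "'e::complex_model_space \<Rightarrow> 'e" where
  "J v \<equiv> \<i> *\<^sub>\<C> v"

definition complex_linear ::
  "('e::complex_model_space \<Rightarrow> 'f::complex_model_space) \<Rightarrow> bool" where
  "complex_linear L \<longleftrightarrow>
     (\<forall>u v. L (u + v) = L u + L v) \<and> (\<forall>z v. L (z *\<^sub>\<C> v) = z *\<^sub>\<C> L v)"


section \<open>Smooth and holomorphic maps between open sets of model spaces\<close>

text \<open>The sets \<open>S\<close> below are always open.\<close>

fun Ck_on :: "nat \<Rightarrow> 'e::real_normed_vector set \<Rightarrow> ('e \<Rightarrow> 'f::real_normed_vector) \<Rightarrow> bool" where
  "Ck_on 0 S f \<longleftrightarrow> continuous_on S f"
| "Ck_on (Suc k) S f \<longleftrightarrow> (\<forall>y\<in>S. f differentiable (at y)) \<and>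
     (\<forall>v. Ck_on k S (\<lambda>y. frechet_derivative f (at y) v))"

definition smooth_on ::
  "'e::real_normed_vector set \<Rightarrow> ('e \<Rightarrow> 'f::real_normed_vector) \<Rightarrow> bool" where
  "smooth_on S f \<longleftrightarrow> (\<forall>k. Ck_on k S f)"

definition holo_on ::
  "'e::complex_model_space set \<Rightarrow> ('e \<Rightarrow> 'f::complex_model_space) \<Rightarrow> bool" where
  "holo_on S f \<longleftrightarrow> (\<forall>y\<in>S. \<exists>L. (f has_derivative L) (at y) \<and> complex_linear L)"


section \<open>Complex manifolds\<close>

type_synonym ('x, 'e) chart = "'x set \<times> ('x \<Rightarrow> 'e)"

record ('x, 'e) cmanifold =
  man_top :: "'x topology"
  atlas :: "('x, 'e) chart set"

abbreviation points :: "('x, 'e) cmanifold \<Rightarrow> 'x set" where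
  "points M \<equiv> topspace (man_top M)"

definition chart_inv :: "('x, 'e) chart \<Rightarrow> 'e \<Rightarrow> 'x" where
  "chart_inv \<kappa> = the_inv_into (fst \<kappa>) (snd \<kappa>)"

definition coord_rep ::
  "('x, 'e) chart \<Rightarrow> ('y, 'f) chart \<Rightarrow> ('x \<Rightarrow> 'y) \<Rightarrow> 'e \<Rightarrow> 'f" where
  "coord_rep \<kappa> \<mu> f = (\<lambda>y. snd \<mu> (f (chart_inv \<kappa> y)))"

definition complex_manifold :: "('x, 'e::complex_model_space) cmanifold \<Rightarrow> bool" where
  "complex_manifold M \<longleftrightarrow>
     Hausdorff_space (man_top M) \<and> second_countable (man_top M) \<and>
     (\<Union>\<kappa>\<in>atlas M. fst \<kappa>) = points M \<and>
     (\<forall>\<kappa>\<in>atlas M. openin (man_top M) (fst \<kappa>) \<and> open (snd \<kappa> ` fst \<kappa>) \<and>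
        homeomorphic_map (subtopology (man_top M) (fst \<kappa>))
          (top_of_set (snd \<kappa> ` fst \<kappa>)) (snd \<kappa>)) \<and>
     (\<forall>\<kappa>\<in>atlas M. \<forall>\<mu>\<in>atlas M.
        holo_on (snd \<kappa> ` (fst \<kappa> \<inter> fst \<mu>)) (coord_rep \<kappa> \<mu> (\<lambda>x. x)))"

definition chart_at :: "('x, 'e) cmanifold \<Rightarrow> 'x \<Rightarrow> ('x, 'e) chart" where
  "chart_at M x = (SOME \<kappa>. \<kappa> \<in> atlas M \<and> x \<in> fst \<kappa>)"

definition prod_manifold ::
  "('x, 'e) cmanifold \<Rightarrow> ('y, 'f) cmanifold \<Rightarrow> ('x \<times> 'y, 'e \<times> 'f) cmanifold" where
  "prod_manifold M N = \<lparr>man_top = prod_topology (man_top M) (man_top N),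
     atlas = {(fst \<kappa> \<times> fst \<mu>, map_prod (snd \<kappa>) (snd \<mu>)) | \<kappa> \<mu>. \<kappa> \<in> atlas M \<and> \<mu> \<in> atlas N}\<rparr>"

definition smooth_map_on ::
  "('x, 'e::complex_model_space) cmanifold \<Rightarrow> 'x set \<Rightarrow>
   ('y, 'f::complex_model_space) cmanifold \<Rightarrow> ('x \<Rightarrow> 'y) \<Rightarrow> bool" where
  "smooth_map_on M U N f \<longleftrightarrow>
     continuous_map (subtopology (man_top M) U) (man_top N) f \<and>
     (\<forall>\<kappa>\<in>atlas M. \<forall>\<mu>\<in>atlas N.
        smooth_on (snd \<kappa> ` {x \<in> U \<inter> fst \<kappa>. f x \<in> fst \<mu>}) (coord_rep \<kappa> \<mu> f))"

definition holo_map_on ::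
  "('x, 'e::complex_model_space) cmanifold \<Rightarrow> 'x set \<Rightarrow>
   ('y, 'f::complex_model_space) cmanifold \<Rightarrow> ('x \<Rightarrow> 'y) \<Rightarrow> bool" where
  "holo_map_on M U N f \<longleftrightarrow>
     continuous_map (subtopology (man_top M) U) (man_top N) f \<and>
     (\<forall>\<kappa>\<in>atlas M. \<forall>\<mu>\<in>atlas N.
        holo_on (snd \<kappa> ` {x \<in> U \<inter> fst \<kappa>. f x \<in> fst \<mu>}) (coord_rep \<kappa> \<mu> f))"

definition smooth_curve ::
  "('x, 'e::complex_model_space) cmanifold \<Rightarrow> real set \<Rightarrow> (real \<Rightarrow> 'x) \<Rightarrow> bool" where
  "smooth_curve M S \<gamma> \<longleftrightarrow>
     continuous_map (top_of_set S) (man_top M) \<gamma> \<and>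
     (\<forall>\<kappa>\<in>atlas M. smooth_on {t \<in> S. \<gamma> t \<in> fst \<kappa>} (\<lambda>t. snd \<kappa> (\<gamma> t)))"

definition smooth_function :: "('x, 'e::complex_model_space) cmanifold \<Rightarrow> ('x \<Rightarrow> real) \<Rightarrow> bool" where
  "smooth_function M f \<longleftrightarrow>
     (\<forall>\<kappa>\<in>atlas M. smooth_on (snd \<kappa> ` fst \<kappa>) (\<lambda>y. f (chart_inv \<kappa> y)))"

text \<open>A tangent vector at \<open>x\<close> is given by its components in a chart around \<open>x\<close>;
  \<open>tangent_map \<kappa> \<mu> f x\<close> is the differential of \<open>f\<close> at \<open>x\<close> in the charts \<open>\<kappa>\<close>, \<open>\<mu>\<close>.\<close>

definition tangent_map ::
  "('x, 'e::complex_model_space) chart \<Rightarrow> ('y, 'f::complex_model_space) chart \<Rightarrow>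
   ('x \<Rightarrow> 'y) \<Rightarrow> 'x \<Rightarrow> 'e \<Rightarrow> 'f" where
  "tangent_map \<kappa> \<mu> f x = frechet_derivative (coord_rep \<kappa> \<mu> f) (at (snd \<kappa> x))"


section \<open>Differential forms\<close>

text \<open>\<open>\<alpha> \<kappa> x vs\<close> is the value of the form at the point \<open>x\<close> on the tangent vectors whose components
  in the chart \<open>\<kappa>\<close> are listed in \<open>vs\<close>. Only charts \<open>\<kappa>\<close> of the atlas, points in the domain of \<open>\<kappa>\<close>,
  and lists whose length is the degree are relevant. Scalar forms are complex valued; a real form
  is one whose values have vanishing imaginary part.\<close>

type_synonym ('x, 'e, 'b) form = "('x, 'e) chart \<Rightarrow> 'x \<Rightarrow> 'e list \<Rightarrow> 'b"

definition multilinear_alternating ::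
  "nat \<Rightarrow> ('e::real_normed_vector list \<Rightarrow> 'b::real_normed_vector) \<Rightarrow> bool" where
  "multilinear_alternating k f \<longleftrightarrow>
     (\<forall>vs i. length vs = k \<and> i < k \<longrightarrow> linear (\<lambda>v. f (vs[i := v]))) \<and>
     (\<forall>vs i j. length vs = k \<and> i < j \<and> j < k \<and> vs ! i = vs ! j \<longrightarrow> f vs = 0)"

definition is_form ::
  "('x, 'e::complex_model_space) cmanifold \<Rightarrow> nat \<Rightarrow> ('x, 'e, 'b::real_normed_vector) form \<Rightarrow> bool"
where
  "is_form M k \<alpha> \<longleftrightarrow>
     (\<forall>\<kappa>\<in>atlas M. \<forall>x\<in>fst \<kappa>. multilinear_alternating k (\<alpha> \<kappa> x)) \<and>
     (\<forall>\<kappa>\<in>atlas M. \<forall>vs. length vs = k \<longrightarrow>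
        smooth_on (snd \<kappa> ` fst \<kappa>) (\<lambda>y. \<alpha> \<kappa> (chart_inv \<kappa> y) vs)) \<and>
     (\<forall>\<kappa>\<in>atlas M. \<forall>\<mu>\<in>atlas M. \<forall>x\<in>fst \<kappa> \<inter> fst \<mu>. \<forall>vs. length vs = k \<longrightarrow>
        \<alpha> \<kappa> x vs = \<alpha> \<mu> x (map (tangent_map \<kappa> \<mu> (\<lambda>x. x) x) vs))"

definition form_eq ::
  "('x, 'e) cmanifold \<Rightarrow> nat \<Rightarrow> ('x, 'e, 'b) form \<Rightarrow> ('x, 'e, 'b) form \<Rightarrow> bool" where
  "form_eq M k \<alpha> \<beta> \<longleftrightarrow>
     (\<forall>\<kappa>\<in>atlas M. \<forall>x\<in>fst \<kappa>. \<forall>vs. length vs = k \<longrightarrow> \<alpha> \<kappa> x vs = \<beta> \<kappa> x vs)"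

definition form_zero :: "('x, 'e, 'b::zero) form" where
  "form_zero = (\<lambda>\<kappa> x vs. 0)"

definition form_minus ::
  "('x, 'e, 'b::minus) form \<Rightarrow> ('x, 'e, 'b) form \<Rightarrow> ('x, 'e, 'b) form" where
  "form_minus \<alpha> \<beta> = (\<lambda>\<kappa> x vs. \<alpha> \<kappa> x vs - \<beta> \<kappa> x vs)"

definition fun_form :: "('x \<Rightarrow> real) \<Rightarrow> ('x, 'e, complex) form" where
  "fun_form f = (\<lambda>\<kappa> x vs. of_real (f x))"

definition fun_times :: "('x \<Rightarrow> real) \<Rightarrow> ('x, 'e, complex) form \<Rightarrow> ('x, 'e, complex) form" where
  "fun_times f \<alpha> = (\<lambda>\<kappa> x vs. of_real (f x) * \<alpha> \<kappa> x vs)"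

definition form_cnj :: "('x, 'e, complex) form \<Rightarrow> ('x, 'e, complex) form" where
  "form_cnj \<alpha> = (\<lambda>\<kappa> x vs. cnj (\<alpha> \<kappa> x vs))"

definition J_form ::
  "('x, 'e::complex_model_space, complex) form \<Rightarrow> ('x, 'e, complex) form" where
  "J_form \<alpha> = (\<lambda>\<kappa> x vs. - \<alpha> \<kappa> x (map J vs))"

text \<open>The wedge product of a \<open>p\<close>-form with another form, with coefficients paired by \<open>b\<close>,
  as the signed sum over shuffles: \<open>I\<close> is the set of positions of the arguments of \<open>\<alpha>\<close>. In
  particular \<open>dx \<and> dy\<close> takes the value \<open>1\<close> on the coordinate vectors.\<close>

definition shuffle_sign :: "nat set \<Rightarrow> real" where
  "shuffle_sign I = (- 1) ^ card {(i, j). i \<in> I \<and> j \<notin> I \<and> j < i}"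

definition wedge_via ::
  "('a \<Rightarrow> 'b \<Rightarrow> 'c::real_normed_vector) \<Rightarrow> nat \<Rightarrow>
   ('x, 'e, 'a) form \<Rightarrow> ('x, 'e, 'b) form \<Rightarrow> ('x, 'e, 'c) form" where
  "wedge_via b p \<alpha> \<beta> = (\<lambda>\<kappa> x vs.
     \<Sum>I | I \<subseteq> {..<length vs} \<and> card I = p.
       shuffle_sign I *\<^sub>R b (\<alpha> \<kappa> x (nths vs I)) (\<beta> \<kappa> x (nths vs (- I))))"

definition wedge ::
  "nat \<Rightarrow> ('x, 'e, complex) form \<Rightarrow> ('x, 'e, complex) form \<Rightarrow> ('x, 'e, complex) form" where
  "wedge p \<alpha> \<beta> = wedge_via (*) p \<alpha> \<beta>"

fun wedge_power :: "('x, 'e, complex) form \<Rightarrow> nat \<Rightarrow> ('x, 'e, complex) form" where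
  "wedge_power \<omega> 0 = (\<lambda>\<kappa> x vs. 1)"
| "wedge_power \<omega> (Suc k) = wedge 2 \<omega> (wedge_power \<omega> k)"

text \<open>For \<open>\<alpha> = \<Sum> f\<^sub>I e\<^sub>I\<close> with constant \<open>e\<^sub>I\<close> in a chart, \<open>d\<alpha> = \<Sum> df\<^sub>I \<and> e\<^sub>I\<close>, and likewise for
  \<open>\<partial>\<close> and its conjugate, where \<open>\<partial>f(v) = (df(v) - i df(Jv))/2\<close>. In each case
  the value on \<open>v\<^sub>0, \<dots>, v\<^sub>k\<close> is the alternating sum of the derivatives along \<open>v\<^sub>i\<close> of the coefficient
  obtained by leaving out \<open>v\<^sub>i\<close>.\<close>

definition coeff_deriv ::
  "('x, 'e::complex_model_space, 'b::real_normed_vector) form \<Rightarrow>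
   ('x, 'e) chart \<Rightarrow> 'x \<Rightarrow> 'e list \<Rightarrow> 'e \<Rightarrow> 'b" where
  "coeff_deriv \<alpha> \<kappa> x ws =
     frechet_derivative (\<lambda>y. \<alpha> \<kappa> (chart_inv \<kappa> y) ws) (at (snd \<kappa> x))"

definition ext_d ::
  "('x, 'e::complex_model_space, 'b::real_normed_vector) form \<Rightarrow> ('x, 'e, 'b) form" where
  "ext_d \<alpha> = (\<lambda>\<kappa> x vs.
     \<Sum>i<length vs. (- 1) ^ i *\<^sub>R coeff_deriv \<alpha> \<kappa> x (nths vs (- {i})) (vs ! i))"

definition del ::
  "('x, 'e::complex_model_space, complex) form \<Rightarrow> ('x, 'e, complex) form" where
  "del \<alpha> = (\<lambda>\<kappa> x vs.
     \<Sum>i<length vs. (- 1) ^ i * (let D = coeff_deriv \<alpha> \<kappa> x (nths vs (- {i}))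
       in (D (vs ! i) - \<i> * D (J (vs ! i))) / 2))"

definition delbar ::
  "('x, 'e::complex_model_space, complex) form \<Rightarrow> ('x, 'e, complex) form" where
  "delbar \<alpha> = (\<lambda>\<kappa> x vs.
     \<Sum>i<length vs. (- 1) ^ i * (let D = coeff_deriv \<alpha> \<kappa> x (nths vs (- {i}))
       in (D (vs ! i) + \<i> * D (J (vs ! i))) / 2))"

definition dc ::
  "('x, 'e::complex_model_space, complex) form \<Rightarrow> ('x, 'e, complex) form" where
  "dc \<alpha> = (\<lambda>\<kappa> x vs. \<i> * (delbar \<alpha> \<kappa> x vs - del \<alpha> \<kappa> x vs))"

definition pullback ::
  "('y, 'f::complex_model_space) cmanifold \<Rightarrow> ('x \<Rightarrow> 'y) \<Rightarrow>
   ('y, 'f, 'b) form \<Rightarrow> ('x, 'e::complex_model_space, 'b) form" where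
  "pullback N f \<alpha> = (\<lambda>\<kappa> x vs.
     let \<mu> = chart_at N (f x) in \<alpha> \<mu> (f x) (map (tangent_map \<kappa> \<mu> f x) vs))"

text \<open>Vanishing of the class in \<open>H\<^sup>1(M, \<real>)\<close> of a closed real one-form.\<close>

definition derham_zero :: "('x, 'e::complex_model_space) cmanifold \<Rightarrow> ('x, 'e, complex) form \<Rightarrow> bool" where
  "derham_zero M \<theta> \<longleftrightarrow> (\<exists>f. smooth_function M f \<and> form_eq M 1 \<theta> (ext_d (fun_form f)))"


section \<open>Hermitian geometry\<close>

definition hermitian_form ::
  "('x, 'e::complex_model_space) cmanifold \<Rightarrow> ('x, 'e, complex) form \<Rightarrow> bool" where
  "hermitian_form X \<omega> \<longleftrightarrow> is_form X 2 \<omega> \<and>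
     (\<forall>\<kappa>\<in>atlas X. \<forall>x\<in>fst \<kappa>. \<forall>u v.
        \<omega> \<kappa> x [u, v] \<in> \<real> \<and> \<omega> \<kappa> x [J u, J v] = \<omega> \<kappa> x [u, v] \<and>
        (v \<noteq> 0 \<longrightarrow> Re (\<omega> \<kappa> x [v, J v]) > 0))"

text \<open>The Riemannian volume form of \<open>g = \<omega>(\<cdot>, J\<cdot>)\<close> in the orientation of the complex structure.\<close>

definition vol_form ::
  "('x, complex ^ 'n, complex) form \<Rightarrow> ('x, complex ^ 'n, complex) form" where
  "vol_form \<omega> = (\<lambda>\<kappa> x vs. wedge_power \<omega> CARD('n) \<kappa> x vs / fact CARD('n))"

definition orthonormal_frame ::
  "('x, complex ^ 'n, complex) form \<Rightarrow> ('x, complex ^ 'n) chart \<Rightarrow> 'x \<Rightarrow>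
   (complex ^ 'n) list \<Rightarrow> bool" where
  "orthonormal_frame \<omega> \<kappa> x E \<longleftrightarrow> length E = 2 * CARD('n) \<and>
     (\<forall>i<length E. \<forall>j<length E. \<omega> \<kappa> x [E ! i, J (E ! j)] = (if i = j then 1 else 0))"

text \<open>The Hodge star on \<open>k\<close>-forms,
  \<open>(*\<alpha>)(w\<^sub>1, \<dots>) = \<Sum> \<alpha>(e\<^sub>I) vol(e\<^sub>I, w\<^sub>1, \<dots>)\<close> over increasing multi-indices \<open>I\<close>
  of length \<open>k\<close>; it does not depend on the orthonormal frame. The formal adjoint of \<open>d\<close> is
  \<open>d\<^sup>* = - * d *\<close> because the real dimension is even.\<close>

definition hodge_star ::
  "('x, complex ^ 'n, complex) form \<Rightarrow> nat \<Rightarrow>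
   ('x, complex ^ 'n, complex) form \<Rightarrow> ('x, complex ^ 'n, complex) form" where
  "hodge_star \<omega> k \<alpha> = (\<lambda>\<kappa> x ws.
     let E = (SOME E. orthonormal_frame \<omega> \<kappa> x E) in
     \<Sum>I | I \<subseteq> {..<2 * CARD('n)} \<and> card I = k.
       \<alpha> \<kappa> x (nths E I) * vol_form \<omega> \<kappa> x (nths E I @ ws))"

definition codiff ::
  "('x, complex ^ 'n, complex) form \<Rightarrow> nat \<Rightarrow>
   ('x, complex ^ 'n, complex) form \<Rightarrow> ('x, complex ^ 'n, complex) form" where
  "codiff \<omega> k \<alpha> = (\<lambda>\<kappa> x vs.
     - hodge_star \<omega> (2 * CARD('n) - k + 1) (ext_d (hodge_star \<omega> k \<alpha>)) \<kappa> x vs)"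

definition lee_form ::
  "('x, complex ^ 'n, complex) form \<Rightarrow> ('x, complex ^ 'n, complex) form" where
  "lee_form \<omega> = J_form (codiff \<omega> 2 \<omega>)"

text \<open>Smooth sections of \<open>K\<^sub>X\<close> are the smooth \<open>(n,0)\<close>-forms. The components of such a section with
  respect to holomorphic coordinate frames are its values on constant vectors.\<close>

definition canonical_section ::
  "('x, complex ^ 'n) cmanifold \<Rightarrow> ('x, complex ^ 'n, complex) form \<Rightarrow> bool" where
  "canonical_section X \<Psi> \<longleftrightarrow> is_form X CARD('n) \<Psi> \<and>
     (\<forall>\<kappa>\<in>atlas X. \<forall>x\<in>fst \<kappa>. \<forall>vs i z. length vs = CARD('n) \<and> i < CARD('n) \<longrightarrow>
        \<Psi> \<kappa> x (vs[i := z *\<^sub>\<C> (vs ! i)]) = z * \<Psi> \<kappa> x vs)"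

definition holomorphic_volume_form ::
  "('x, complex ^ 'n) cmanifold \<Rightarrow> ('x, complex ^ 'n, complex) form \<Rightarrow> bool" where
  "holomorphic_volume_form X \<Omega> \<longleftrightarrow> canonical_section X \<Omega> \<and>
     (\<forall>\<kappa>\<in>atlas X. \<forall>vs. length vs = CARD('n) \<longrightarrow>
        holo_on (snd \<kappa> ` fst \<kappa>) (\<lambda>y. \<Omega> \<kappa> (chart_inv \<kappa> y) vs)) \<and>
     (\<forall>\<kappa>\<in>atlas X. \<forall>x\<in>fst \<kappa>. \<exists>vs. length vs = CARD('n) \<and> \<Omega> \<kappa> x vs \<noteq> 0)"

definition vol_norm ::
  "('x, complex ^ 'n) cmanifold \<Rightarrow> ('x, complex ^ 'n, complex) form \<Rightarrow>
   ('x, complex ^ 'n, complex) form \<Rightarrow> 'x \<Rightarrow> real" where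
  "vol_norm X \<omega> \<Psi> x = (THE r. 0 \<le> r \<and>
     (\<forall>\<kappa>\<in>atlas X. x \<in> fst \<kappa> \<longrightarrow> (\<forall>vs. length vs = 2 * CARD('n) \<longrightarrow>
        of_real (r\<^sup>2) * (wedge_power \<omega> CARD('n) \<kappa> x vs / fact CARD('n)) =
        (- 1) ^ (CARD('n) * (CARD('n) - 1) div 2) * \<i> ^ CARD('n) *
          wedge CARD('n) \<Psi> (form_cnj \<Psi>) \<kappa> x vs)))"

definition SU_structure ::
  "('x, complex ^ 'n) cmanifold \<Rightarrow> ('x, complex ^ 'n, complex) form \<Rightarrow>
   ('x, complex ^ 'n, complex) form \<Rightarrow> bool" where
  "SU_structure X \<Psi> \<omega> \<longleftrightarrow> canonical_section X \<Psi> \<and> hermitian_form X \<omega> \<and>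
     (\<forall>x\<in>points X. vol_norm X \<omega> \<Psi> x = 1)"


section \<open>The first Chern class\<close>

text \<open>Indices of a cover are pairs of an open set and a chart containing it. The class
  \<open>c\<^sub>1(X) = c\<^sub>1(det TX)\<close> in \<open>H\<^sup>2(X, \<int>)\<close> is represented in Cech cohomology by
  \<open>(log g\<^sub>b\<^sub>c - log g\<^sub>a\<^sub>c + log g\<^sub>a\<^sub>b) / (2 \<pi> i)\<close>, where \<open>g\<^sub>a\<^sub>b\<close> are the transition functions of
  \<open>det TX\<close>; it vanishes when, on some cover, this cocycle is the coboundary of a
  cochain \<open>m\<close> of locally constant integer functions.\<close>

definition det_cocycle ::
  "'x set \<times> ('x, complex ^ 'n) chart \<Rightarrow> 'x set \<times> ('x, complex ^ 'n) chart \<Rightarrow> 'x \<Rightarrow> complex" where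
  "det_cocycle a b x = det (matrix (tangent_map (snd b) (snd a) (\<lambda>x. x) x))"

definition first_chern_class_zero :: "('x, complex ^ 'n) cmanifold \<Rightarrow> bool" where
  "first_chern_class_zero X \<longleftrightarrow>
     (\<exists>C l. (\<forall>(V, \<kappa>)\<in>C. openin (man_top X) V \<and> \<kappa> \<in> atlas X \<and> V \<subseteq> fst \<kappa>) \<and>
        (\<Union>a\<in>C. fst a) = points X \<and>
        (\<forall>a\<in>C. \<forall>b\<in>C.
           continuous_map (subtopology (man_top X) (fst a \<inter> fst b)) euclidean (l a b) \<and>
           (\<forall>x\<in>fst a \<inter> fst b. exp (l a b x) = det_cocycle a b x)) \<and>
        (\<exists>m :: _ \<Rightarrow> _ \<Rightarrow> _ \<Rightarrow> int.
           (\<forall>a\<in>C. \<forall>b\<in>C.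
              continuous_map (subtopology (man_top X) (fst a \<inter> fst b)) euclidean (m a b)) \<and>
           (\<forall>a\<in>C. \<forall>b\<in>C. \<forall>c\<in>C. \<forall>x\<in>fst a \<inter> fst b \<inter> fst c.
              (l b c x - l a c x + l a b x) / (2 * of_real pi * \<i>) =
              of_int (m b c x - m a c x + m a b x))))"


section \<open>Complex reductive Lie groups\<close>

record ('g, 'v) lie_group = "'g monoid" +
  lie_man :: "('g, 'v) cmanifold"

definition complex_lie_group :: "('g, 'v::complex_model_space) lie_group \<Rightarrow> bool" where
  "complex_lie_group G \<longleftrightarrow> group G \<and> complex_manifold (lie_man G) \<and>
     points (lie_man G) = carrier G \<and>
     holo_map_on (prod_manifold (lie_man G) (lie_man G)) (carrier G \<times> carrier G) (lie_man G)
       (\<lambda>(a, b). a \<otimes>\<^bsub>G\<^esub> b) \<and>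
     holo_map_on (lie_man G) (carrier G) (lie_man G) (\<lambda>a. inv\<^bsub>G\<^esub> a)"

text \<open>The Lie algebra, i.e. the tangent space at the identity, is identified with the model space
  by means of a fixed chart.\<close>

abbreviation lie_chart :: "('g, 'v) lie_group \<Rightarrow> ('g, 'v) chart" where
  "lie_chart G \<equiv> chart_at (lie_man G) \<one>\<^bsub>G\<^esub>"

definition Ad :: "('g, 'v::complex_model_space) lie_group \<Rightarrow> 'g \<Rightarrow> 'v \<Rightarrow> 'v" where
  "Ad G g = tangent_map (lie_chart G) (lie_chart G) (\<lambda>a. g \<otimes>\<^bsub>G\<^esub> a \<otimes>\<^bsub>G\<^esub> inv\<^bsub>G\<^esub> g) \<one>\<^bsub>G\<^esub>"

text \<open>\<open>[\<xi>, \<eta>] = ad(\<xi>)\<eta>\<close>, with \<open>ad\<close> the differential of \<open>Ad\<close> at the identity.\<close>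

definition lie_bracket :: "('g, 'v::complex_model_space) lie_group \<Rightarrow> 'v \<Rightarrow> 'v \<Rightarrow> 'v" where
  "lie_bracket G \<xi> \<eta> =
     frechet_derivative (\<lambda>y. Ad G (chart_inv (lie_chart G) y) \<eta>)
       (at (snd (lie_chart G) \<one>\<^bsub>G\<^esub>)) \<xi>"

definition one_parameter_subgroup ::
  "('g, 'v::complex_model_space) lie_group \<Rightarrow> 'v \<Rightarrow> (real \<Rightarrow> 'g) \<Rightarrow> bool" where
  "one_parameter_subgroup G \<xi> \<gamma> \<longleftrightarrow> smooth_curve (lie_man G) UNIV \<gamma> \<and>
     (\<forall>s t. \<gamma> (s + t) = \<gamma> s \<otimes>\<^bsub>G\<^esub> \<gamma> t) \<and>
     ((\<lambda>t. snd (lie_chart G) (\<gamma> t)) has_vector_derivative \<xi>) (at 0)"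

definition lie_exp :: "('g, 'v::complex_model_space) lie_group \<Rightarrow> 'v \<Rightarrow> 'g" where
  "lie_exp G \<xi> = (THE \<gamma>. one_parameter_subgroup G \<xi> \<gamma>) 1"

definition compact_subgroup :: "'g set \<Rightarrow> ('g, 'v::complex_model_space) lie_group \<Rightarrow> bool" where
  "compact_subgroup K G \<longleftrightarrow> subgroup K G \<and> compactin (man_top (lie_man G)) K"

definition maximal_compact_subgroup ::
  "'g set \<Rightarrow> ('g, 'v::complex_model_space) lie_group \<Rightarrow> bool" where
  "maximal_compact_subgroup K G \<longleftrightarrow> compact_subgroup K G \<and>
     (\<forall>K'. compact_subgroup K' G \<and> K \<subseteq> K' \<longrightarrow> K' = K)"

definition lie_subalgebra :: "('g, 'v::complex_model_space) lie_group \<Rightarrow> 'g set \<Rightarrow> 'v set" where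
  "lie_subalgebra G K = {\<xi>. \<forall>t::real. lie_exp G (t *\<^sub>R \<xi>) \<in> K}"

text \<open>A complex Lie group is reductive if it is the complexification of a compact Lie group \<open>K\<close>,
  expressed by \<open>\<gg> = \<kk> \<oplus> i\<kk>\<close> and the polar decomposition \<open>G = K exp(i\<kk>)\<close>. In particular \<open>G\<close> has
  finitely many components but need not be connected.\<close>

definition complex_reductive_group :: "('g, 'v::complex_model_space) lie_group \<Rightarrow> bool" where
  "complex_reductive_group G \<longleftrightarrow> complex_lie_group G \<and>
     (\<exists>K. compact_subgroup K G \<and>
        (\<forall>\<zeta>. \<exists>!p. p \<in> lie_subalgebra G K \<times> lie_subalgebra G K \<and> \<zeta> = fst p + J (snd p)) \<and>
        homeomorphic_map
          (prod_topology (subtopology (man_top (lie_man G)) K) (top_of_set (lie_subalgebra G K)))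
          (man_top (lie_man G))
          (\<lambda>(k, \<xi>). k \<otimes>\<^bsub>G\<^esub> lie_exp G (J \<xi>)))"

definition invariant_pairing ::
  "('g, 'v::complex_model_space) lie_group \<Rightarrow> 'g set \<Rightarrow> ('v \<Rightarrow> 'v \<Rightarrow> complex) \<Rightarrow> bool" where
  "invariant_pairing G K c \<longleftrightarrow>
     (\<forall>\<xi>. complex_linear (c \<xi>)) \<and> (\<forall>\<xi> \<eta>. c \<xi> \<eta> = c \<eta> \<xi>) \<and>
     (\<forall>\<xi>. (\<forall>\<eta>. c \<xi> \<eta> = 0) \<longrightarrow> \<xi> = 0) \<and>
     (\<forall>g\<in>carrier G. \<forall>\<xi> \<eta>. c (Ad G g \<xi>) (Ad G g \<eta>) = c \<xi> \<eta>) \<and>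
     (\<forall>\<xi>\<in>lie_subalgebra G K. \<forall>\<eta>\<in>lie_subalgebra G K. c \<xi> \<eta> \<in> \<real>)"


section \<open>Principal bundles, reductions and Chern connections\<close>

record ('p, 'w, 'x, 'g) pbundle =
  total_space :: "('p, 'w) cmanifold"
  proj :: "'p \<Rightarrow> 'x"
  act :: "'p \<Rightarrow> 'g \<Rightarrow> 'p"

definition over :: "('p, 'w, 'x, 'g) pbundle \<Rightarrow> 'x set \<Rightarrow> 'p set" where
  "over P U = {p \<in> points (total_space P). proj P p \<in> U}"

definition holomorphic_principal_bundle ::
  "('x, 'e::complex_model_space) cmanifold \<Rightarrow> ('g, 'v::complex_model_space) lie_group \<Rightarrow>
   ('p, 'w::complex_model_space, 'x, 'g) pbundle \<Rightarrow> bool" where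
  "holomorphic_principal_bundle X G P \<longleftrightarrow>
     complex_manifold (total_space P) \<and>
     holo_map_on (total_space P) (points (total_space P)) X (proj P) \<and>
     holo_map_on (prod_manifold (total_space P) (lie_man G)) (points (total_space P) \<times> carrier G) (total_space P)
       (\<lambda>(p, g). act P p g) \<and>
     (\<forall>p\<in>points (total_space P). act P p \<one>\<^bsub>G\<^esub> = p \<and>
        (\<forall>a\<in>carrier G. proj P (act P p a) = proj P p \<and>
           (\<forall>b\<in>carrier G. act P (act P p a) b = act P p (a \<otimes>\<^bsub>G\<^esub> b)))) \<and>
     (\<forall>x\<in>points X. \<exists>U \<sigma>. openin (man_top X) U \<and> x \<in> U \<and>
        (\<forall>y\<in>U. proj P (\<sigma> y) = y) \<and>
        (let \<Phi> = (\<lambda>(y, g). act P (\<sigma> y) g) in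
           bij_betw \<Phi> (U \<times> carrier G) (over P U) \<and>
           holo_map_on (prod_manifold X (lie_man G)) (U \<times> carrier G) (total_space P) \<Phi> \<and>
           holo_map_on (total_space P) (over P U) (prod_manifold X (lie_man G))
             (the_inv_into (U \<times> carrier G) \<Phi>)))"

text \<open>A reduction of \<open>P\<close> to \<open>K\<close> is given as a smooth principal \<open>K\<close>-subbundle \<open>h\<close> of \<open>P\<close>.\<close>

definition reduction ::
  "('x, 'e::complex_model_space) cmanifold \<Rightarrow>
   ('p, 'w::complex_model_space, 'x, 'g) pbundle \<Rightarrow> 'g set \<Rightarrow> 'p set \<Rightarrow> bool" where
  "reduction X P K h \<longleftrightarrow> h \<subseteq> points (total_space P) \<and>
     (\<forall>x\<in>points X. \<exists>U \<sigma>. openin (man_top X) U \<and> x \<in> U \<and>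
        smooth_map_on X U (total_space P) \<sigma> \<and> (\<forall>y\<in>U. proj P (\<sigma> y) = y) \<and>
        h \<inter> over P U = {act P (\<sigma> y) k | y k. y \<in> U \<and> k \<in> K})"

definition tangent_to ::
  "('p, 'w::complex_model_space) cmanifold \<Rightarrow> 'p set \<Rightarrow> ('p, 'w) chart \<Rightarrow> 'p \<Rightarrow> 'w \<Rightarrow> bool" where
  "tangent_to M h \<kappa> p v \<longleftrightarrow>
     (\<exists>\<gamma>. smooth_curve M {-1<..<1} \<gamma> \<and> \<gamma> ` {-1<..<1} \<subseteq> h \<and> \<gamma> 0 = p \<and>
        ((\<lambda>t. snd \<kappa> (\<gamma> t)) has_vector_derivative v) (at 0))"

definition principal_connection ::
  "('g, 'v::complex_model_space) lie_group \<Rightarrow>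
   ('p, 'w::complex_model_space, 'x, 'g) pbundle \<Rightarrow> ('p, 'w, 'v) form \<Rightarrow> bool" where
  "principal_connection G P A \<longleftrightarrow> is_form (total_space P) 1 A \<and>
     (\<forall>\<kappa>\<in>atlas (total_space P). \<forall>p\<in>fst \<kappa>. \<forall>\<xi>.
        A \<kappa> p [tangent_map (lie_chart G) \<kappa> (act P p) \<one>\<^bsub>G\<^esub> \<xi>] = \<xi>) \<and>
     (\<forall>g\<in>carrier G. form_eq (total_space P) 1
        (pullback (total_space P) (\<lambda>p. act P p g) A)
        (\<lambda>\<kappa> p vs. Ad G (inv\<^bsub>G\<^esub> g) (A \<kappa> p vs)))"

text \<open>The Chern connection of \<open>h\<close> is the unique connection that is compatible with the holomorphic
  structure of \<open>P\<close>, i.e. of type \<open>(1,0)\<close>, and is induced by a connection on \<open>h\<close>, i.e. takes values in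
  \<open>\<kk>\<close> on vectors tangent to \<open>h\<close>.\<close>

definition is_chern_connection ::
  "('g, 'v::complex_model_space) lie_group \<Rightarrow> 'g set \<Rightarrow>
   ('p, 'w::complex_model_space, 'x, 'g) pbundle \<Rightarrow> 'p set \<Rightarrow> ('p, 'w, 'v) form \<Rightarrow> bool" where
  "is_chern_connection G K P h A \<longleftrightarrow> principal_connection G P A \<and>
     (\<forall>\<kappa>\<in>atlas (total_space P). \<forall>p\<in>fst \<kappa>. \<forall>v. A \<kappa> p [J v] = J (A \<kappa> p [v])) \<and>
     (\<forall>\<kappa>\<in>atlas (total_space P). \<forall>p\<in>fst \<kappa> \<inter> h. \<forall>v.
        tangent_to (total_space P) h \<kappa> p v \<longrightarrow> A \<kappa> p [v] \<in> lie_subalgebra G K)"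

definition chern_connection ::
  "('g, 'v::complex_model_space) lie_group \<Rightarrow> 'g set \<Rightarrow>
   ('p, 'w::complex_model_space, 'x, 'g) pbundle \<Rightarrow> 'p set \<Rightarrow> ('p, 'w, 'v) form" where
  "chern_connection G K P h = (SOME A. is_chern_connection G K P h A)"

definition curvature ::
  "('g, 'v::complex_model_space) lie_group \<Rightarrow>
   ('p, 'w::complex_model_space, 'v) form \<Rightarrow> ('p, 'w, 'v) form" where
  "curvature G A = (\<lambda>\<kappa> p vs. ext_d A \<kappa> p vs
     + (1 / 2) *\<^sub>R wedge_via (lie_bracket G) 1 A A \<kappa> p vs)"

text \<open>Forms on \<open>X\<close> with values in \<open>ad P\<close> are identified with tensorial \<open>\<gg>\<close>-valued forms on \<open>P\<close>,
  and forms on \<open>X\<close> with basic forms on \<open>P\<close> via pullback along the projection; both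
  identifications are injective and compatible with wedge products and \<open>c\<close>.\<close>

definition chern_curvature ::
  "('g, 'v::complex_model_space) lie_group \<Rightarrow> 'g set \<Rightarrow>
   ('p, 'w::complex_model_space, 'x, 'g) pbundle \<Rightarrow> 'p set \<Rightarrow> ('p, 'w, 'v) form" where
  "chern_curvature G K P h = curvature G (chern_connection G K P h)"


section \<open>The Hull-Strominger systems\<close>

definition hermite_einstein ::
  "('x, complex ^ 'n) cmanifold \<Rightarrow> ('g, 'v::complex_model_space) lie_group \<Rightarrow> 'g set \<Rightarrow>
   ('p, 'w::complex_model_space, 'x, 'g) pbundle \<Rightarrow>
   ('x, complex ^ 'n, complex) form \<Rightarrow> 'p set \<Rightarrow> bool" where
  "hermite_einstein X G K P \<omega> h \<longleftrightarrow>
     form_eq (total_space P) (2 * CARD('n))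
       (wedge_via (\<lambda>\<xi> z. z *\<^sub>\<C> \<xi>) 2 (chern_curvature G K P h)
         (pullback X (proj P) (wedge_power \<omega> (CARD('n) - 1))))
       form_zero"

definition bianchi_identity ::
  "('x, complex ^ 'n) cmanifold \<Rightarrow> ('g, 'v::complex_model_space) lie_group \<Rightarrow> 'g set \<Rightarrow>
   ('v \<Rightarrow> 'v \<Rightarrow> complex) \<Rightarrow> ('p, 'w::complex_model_space, 'x, 'g) pbundle \<Rightarrow>
   ('x, complex ^ 'n, complex) form \<Rightarrow> 'p set \<Rightarrow> bool" where
  "bianchi_identity X G K c P \<omega> h \<longleftrightarrow>
     form_eq (total_space P) 4
       (form_minus (pullback X (proj P) (ext_d (dc \<omega>)))
         (wedge_via c 2 (chern_curvature G K P h) (chern_curvature G K P h)))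
       form_zero"

definition twisted_hull_strominger ::
  "('x, complex ^ 'n) cmanifold \<Rightarrow> ('g, 'v::complex_model_space) lie_group \<Rightarrow> 'g set \<Rightarrow>
   ('v \<Rightarrow> 'v \<Rightarrow> complex) \<Rightarrow> ('p, 'w::complex_model_space, 'x, 'g) pbundle \<Rightarrow>
   ('x, complex ^ 'n, complex) form \<Rightarrow> ('x, complex ^ 'n, complex) form \<Rightarrow> 'p set \<Rightarrow> bool" where
  "twisted_hull_strominger X G K c P \<Psi> \<omega> h \<longleftrightarrow>
     SU_structure X \<Psi> \<omega> \<and> reduction X P K h \<and>
     hermite_einstein X G K P \<omega> h \<and>
     form_eq X (CARD('n) + 1) (form_minus (ext_d \<Psi>) (wedge 1 (lee_form \<omega>) \<Psi>)) form_zero \<and>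
     form_eq X 2 (ext_d (lee_form \<omega>)) form_zero \<and>
     bianchi_identity X G K c P \<omega> h"

definition hull_strominger ::
  "('x, complex ^ 'n) cmanifold \<Rightarrow> ('x, complex ^ 'n, complex) form \<Rightarrow>
   ('g, 'v::complex_model_space) lie_group \<Rightarrow> 'g set \<Rightarrow>
   ('v \<Rightarrow> 'v \<Rightarrow> complex) \<Rightarrow> ('p, 'w::complex_model_space, 'x, 'g) pbundle \<Rightarrow>
   ('x, complex ^ 'n, complex) form \<Rightarrow> 'p set \<Rightarrow> bool" where
  "hull_strominger X \<Omega> G K c P \<omega> h \<longleftrightarrow>
     hermitian_form X \<omega> \<and> reduction X P K h \<and>
     hermite_einstein X G K P \<omega> h \<and>
     form_eq X 1
       (form_minus (codiff \<omega> 2 \<omega>) (dc (fun_form (\<lambda>x. ln (vol_norm X \<omega> \<Omega> x))))) form_zero \<and>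
     bianchi_identity X G K c P \<omega> h"

end

theory Submission
  imports Defs
begin

text \<open>
  Both systems share the equation \<open>F\<^sub>h \<and> \<omega>\<^sup>n\<^sup>-\<^sup>1 = 0\<close> and the Bianchi identity, so everything happens
  on the base, between the equations for \<open>d\<Psi>\<close> and \<open>d\<theta>\<close> on one side and \<open>d\<^sup>*\<omega> = d\<^sup>c log \<parallel>\<Omega>\<parallel>\<close> on the
  other. The two sections differ by a positive function, \<open>\<Omega> = e\<^sup>-\<^sup>\<phi>\<Psi>\<close> with \<open>\<phi> = - log \<parallel>\<Omega>\<parallel>\<close>.

  Since \<open>\<theta> = Jd\<^sup>*\<omega>\<close>, \<open>d\<^sup>cf = Jdf\<close> and \<open>J\<^sup>2 = -1\<close> on one-forms, \<open>d\<^sup>*\<omega> = d\<^sup>c log \<parallel>\<Omega>\<parallel>\<close> says exactly that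
  \<open>\<theta> = d\<phi>\<close> (\<open>lee_form_J\<close>, \<open>dc_fun_form\<close>). Given this, the identity
  \<open>d(e\<^sup>f \<alpha>) = e\<^sup>f (df \<and> \<alpha> + d\<alpha>)\<close> (\<open>ext_d_exp_times\<close>) shows that \<open>d\<Psi> = \<theta> \<and> \<Psi>\<close> is equivalent to
  \<open>d\<Omega> = 0\<close>. For sections of the canonical bundle closed means holomorphic
  (\<open>closed_imp_holomorphic\<close>, \<open>holomorphic_imp_closed\<close>). Finally \<open>d\<theta> = dd\<phi> = 0\<close> by the symmetry of
  second derivatives (\<open>second_derivative_symmetric\<close>).

  What remains is that \<open>\<parallel>\<cdot>\<parallel>\<close> behaves like a norm: it is well defined, scales with \<open>\<bar>f\<bar>\<close> when the
  section is multiplied by \<open>f\<close>, is positive where the section does not vanish, and has a smooth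
  logarithm if the section vanishes nowhere (\<open>vol_norm_density\<close>, \<open>vol_norm_fun_times\<close>, \<open>vol_norm_pos_iff\<close>,
  \<open>smooth_ln_vol_norm\<close>). This rests on the one-dimensionality of the space of top forms
  (\<open>top_forms_proportional\<close>) and on evaluating both sides of the defining equation on
  \<open>e\<^sub>1, Je\<^sub>1, \<dots>, e\<^sub>n, Je\<^sub>n\<close> for a unitary basis: there \<open>\<omega>\<^sup>n/n! = 1\<close> (\<open>form_power_unitary\<close>) and the
  density of \<open>\<Psi>\<close> is \<open>2\<^sup>n \<bar>\<Psi>(e\<^sub>1, \<dots>, e\<^sub>n)\<bar>\<^sup>2\<close> (\<open>volume_density_real_frame\<close>). Wedge products are
  evaluated through the recursion \<open>shuffle_product_Cons\<close> on the first argument.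
\<close>

section \<open>Calculus of smooth maps\<close>

lemma Ck_on_imp_continuous_on: "Ck_on k S f \<Longrightarrow> continuous_on S f"
proof (cases k)
  case (Suc m)
  moreover assume "Ck_on k S f"
  ultimately have "\<forall>y\<in>S. isCont f y" by (auto intro: differentiable_imp_continuous_within)
  then show ?thesis by (rule continuous_at_imp_continuous_on)
qed simp

lemma frechet_derivative_cong_open:
  assumes "open S" "y \<in> S" "\<And>z. z \<in> S \<Longrightarrow> f z = g z"
  shows "frechet_derivative f (at y) = frechet_derivative g (at y)"
proof -
  have "(f has_derivative D) (at y) \<longleftrightarrow> (g has_derivative D) (at y)" for D
    using assms by (metis has_derivative_transform_within_open)
  then show ?thesis by (simp add: frechet_derivative_def)
qed

lemma Ck_on_cong:
  assumes "open S" "Ck_on k S f" "\<And>y. y \<in> S \<Longrightarrow> f y = g y"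
  shows "Ck_on k S g"
  using assms(2,3)
proof (induction k arbitrary: f g)
  case 0
  then show ?case by (simp cong: continuous_on_cong)
next
  case (Suc k)
  have "g differentiable at y" if "y \<in> S" for y
    using Suc.prems that assms(1) unfolding differentiable_def Ck_on.simps
    by (metis has_derivative_transform_within_open)
  moreover have "Ck_on k S (\<lambda>y. frechet_derivative g (at y) v)" for v
  proof (rule Suc.IH)
    show "Ck_on k S (\<lambda>y. frechet_derivative f (at y) v)" using Suc.prems by simp
    show "frechet_derivative f (at y) v = frechet_derivative g (at y) v" if "y \<in> S" for y
      using frechet_derivative_cong_open[OF assms(1) that Suc.prems(2)] by simp
  qed
  ultimately show ?case by simp
qed

lemma smooth_on_cong:
  "open S \<Longrightarrow> smooth_on S f \<Longrightarrow> (\<And>y. y \<in> S \<Longrightarrow> f y = g y) \<Longrightarrow> smooth_on S g"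
  unfolding smooth_on_def using Ck_on_cong by blast

text \<open>Closure properties follow by induction on \<open>k\<close>: the usual rule gives the derivative on all of the
  open set \<open>S\<close>, and this rule allows it to replace the chosen Frechet derivative in the recursion.\<close>

lemma Ck_on_SucI:
  assumes "open S" "\<And>y. y \<in> S \<Longrightarrow> (f has_derivative D y) (at y)"
    and "\<And>v. Ck_on k S (\<lambda>y. D y v)"
  shows "Ck_on (Suc k) S f"
proof -
  have "Ck_on k S (\<lambda>y. frechet_derivative f (at y) v)" for v
  proof (rule Ck_on_cong[OF assms(1) assms(3)[of v]])
    fix y assume "y \<in> S"
    from frechet_derivative_at[OF assms(2)[OF this]]
    show "D y v = frechet_derivative f (at y) v" by simp
  qed
  then show ?thesis using assms(2) by (auto simp: differentiable_def)
qed

lemma Ck_on_Suc_has_derivative: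
  "Ck_on (Suc k) S f \<Longrightarrow> y \<in> S \<Longrightarrow> (f has_derivative frechet_derivative f (at y)) (at y)"
  by (simp add: frechet_derivative_works)

lemma Ck_on_Suc_imp: "Ck_on (Suc k) S f \<Longrightarrow> Ck_on k S f"
proof (induction k arbitrary: f)
  case 0
  from Ck_on_imp_continuous_on[OF this] show ?case by simp
qed simp

lemma Ck_on_const: "Ck_on k S (\<lambda>y. c)"
  by (induction k arbitrary: c) auto

lemma Ck_on_linear:
  assumes "open S" "bounded_linear L" "Ck_on k S f"
  shows "Ck_on k S (\<lambda>y. L (f y))"
  using assms(3)
proof (induction k arbitrary: f)
  case 0
  then show ?case using assms(2) by (auto intro: bounded_linear.continuous_on)
next
  case (Suc k)
  show ?case
  proof (rule Ck_on_SucI[OF assms(1)])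
    show "((\<lambda>y. L (f y)) has_derivative (\<lambda>v. L (frechet_derivative f (at y) v))) (at y)"
      if "y \<in> S" for y
      using bounded_linear.has_derivative[OF assms(2)] Ck_on_Suc_has_derivative[OF Suc.prems that]
      by blast
    show "Ck_on k S (\<lambda>y. L (frechet_derivative f (at y) v))" for v
      using Suc.IH Suc.prems by simp
  qed
qed

lemma Ck_on_add:
  assumes "open S" "Ck_on k S f" "Ck_on k S g"
  shows "Ck_on k S (\<lambda>y. f y + g y)"
  using assms(2,3)
proof (induction k arbitrary: f g)
  case 0
  then show ?case by (auto intro: continuous_on_add)
next
  case (Suc k)
  show ?case
  proof (rule Ck_on_SucI[OF assms(1)])
    show "((\<lambda>y. f y + g y) has_derivative
        (\<lambda>v. frechet_derivative f (at y) v + frechet_derivative g (at y) v)) (at y)"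
      if "y \<in> S" for y
      using Suc.prems[THEN Ck_on_Suc_has_derivative, OF that] by (rule has_derivative_add)
    show "Ck_on k S (\<lambda>y. frechet_derivative f (at y) v + frechet_derivative g (at y) v)" for v
      using Suc.IH Suc.prems by simp
  qed
qed

lemma Ck_on_bilinear:
  assumes "open S" "bounded_bilinear B" "Ck_on k S f" "Ck_on k S g"
  shows "Ck_on k S (\<lambda>y. B (f y) (g y))"
  using assms(3,4)
proof (induction k arbitrary: f g)
  case 0
  then show ?case using assms(2) by (auto intro: bounded_bilinear.continuous_on)
next
  case (Suc k)
  show ?case
  proof (rule Ck_on_SucI[OF assms(1)])
    show "((\<lambda>y. B (f y) (g y)) has_derivative
        (\<lambda>v. B (f y) (frechet_derivative g (at y) v) + B (frechet_derivative f (at y) v) (g y)))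
        (at y)" if "y \<in> S" for y
      using bounded_bilinear.FDERIV[OF assms(2)]
        Suc.prems[THEN Ck_on_Suc_has_derivative, OF that] by blast
    show "Ck_on k S (\<lambda>y. B (f y) (frechet_derivative g (at y) v)
        + B (frechet_derivative f (at y) v) (g y))" for v
      using Suc.prems by (intro Ck_on_add[OF assms(1)] Suc.IH) (auto intro: Ck_on_Suc_imp)
  qed
qed

lemma Ck_on_exp:
  fixes f :: "'a::real_normed_vector \<Rightarrow> real"
  assumes "open S" "Ck_on k S f"
  shows "Ck_on k S (\<lambda>y. exp (f y))"
  using assms(2)
proof (induction k)
  case 0
  then show ?case by (auto intro: continuous_on_exp)
next
  case (Suc k)
  show ?case
  proof (rule Ck_on_SucI[OF assms(1)])
    show "((\<lambda>y. exp (f y)) has_derivative (\<lambda>v. exp (f y) * frechet_derivative f (at y) v)) (at y)"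
      if "y \<in> S" for y
      using has_derivative_exp[OF Ck_on_Suc_has_derivative[OF Suc.prems that]]
      by (simp add: mult.commute)
    show "Ck_on k S (\<lambda>y. exp (f y) * frechet_derivative f (at y) v)" for v
      using Suc.prems Suc.IH[OF Ck_on_Suc_imp[OF Suc.prems]]
      by (intro Ck_on_bilinear[OF assms(1) bounded_bilinear_mult]) auto
  qed
qed

lemma Ck_on_inverse:
  fixes f :: "'a::real_normed_vector \<Rightarrow> real"
  assumes "open S" "Ck_on k S f" "\<And>y. y \<in> S \<Longrightarrow> f y \<noteq> 0"
  shows "Ck_on k S (\<lambda>y. inverse (f y))"
  using assms(2)
proof (induction k)
  case 0
  then show ?case using assms(3) by (auto intro: continuous_on_inverse)
next
  case (Suc k)
  show ?case
  proof (rule Ck_on_SucI[OF assms(1)])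
    show "((\<lambda>y. inverse (f y)) has_derivative
        (\<lambda>v. - (inverse (f y) * frechet_derivative f (at y) v * inverse (f y)))) (at y)"
      if "y \<in> S" for y
      using Deriv.has_derivative_inverse[OF assms(3)[OF that] Ck_on_Suc_has_derivative[OF Suc.prems that]] .
    show "Ck_on k S (\<lambda>y. - (inverse (f y) * frechet_derivative f (at y) v * inverse (f y)))" for v
      using Suc.prems Suc.IH[OF Ck_on_Suc_imp[OF Suc.prems]]
      by (intro Ck_on_linear[OF assms(1) bounded_linear_minus[OF bounded_linear_ident]]
          Ck_on_bilinear[OF assms(1) bounded_bilinear_mult]) auto
  qed
qed

lemma Ck_on_ln:
  fixes f :: "'a::real_normed_vector \<Rightarrow> real"
  assumes "open S" "Ck_on k S f" "\<And>y. y \<in> S \<Longrightarrow> 0 < f y"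
  shows "Ck_on k S (\<lambda>y. ln (f y))"
  using assms(2)
proof (induction k)
  case 0
  then show ?case using assms(3) by (force intro: continuous_on_ln)
next
  case (Suc k)
  show ?case
  proof (rule Ck_on_SucI[OF assms(1)])
    show "((\<lambda>y. ln (f y)) has_derivative
        (\<lambda>v. frechet_derivative f (at y) v * inverse (f y))) (at y)"
      if "y \<in> S" for y
      using has_derivative_ln[OF assms(3)[OF that] Ck_on_Suc_has_derivative[OF Suc.prems that]] .
    show "Ck_on k S (\<lambda>y. frechet_derivative f (at y) v * inverse (f y))" for v
      using Suc.prems assms(3)
      by (intro Ck_on_bilinear[OF assms(1) bounded_bilinear_mult]
          Ck_on_inverse[OF assms(1)]) (force intro: Ck_on_Suc_imp)+
  qed
qed

lemma smooth_on_const: "smooth_on S (\<lambda>y. c)"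
  by (simp add: smooth_on_def Ck_on_const)

lemma smooth_on_linear:
  "open S \<Longrightarrow> bounded_linear L \<Longrightarrow> smooth_on S f \<Longrightarrow> smooth_on S (\<lambda>y. L (f y))"
  by (simp add: smooth_on_def Ck_on_linear)

lemma smooth_on_mult:
  fixes f g :: "'a::real_normed_vector \<Rightarrow> 'b::real_normed_algebra"
  shows "open S \<Longrightarrow> smooth_on S f \<Longrightarrow> smooth_on S g \<Longrightarrow> smooth_on S (\<lambda>y. f y * g y)"
  by (simp add: smooth_on_def Ck_on_bilinear[OF _ bounded_bilinear_mult])

lemma smooth_on_sum:
  assumes "open S" "\<And>i. i \<in> I \<Longrightarrow> smooth_on S (f i)"
  shows "smooth_on S (\<lambda>y. \<Sum>i\<in>I. f i y)"
  using assms(2)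
proof (induction I rule: infinite_finite_induct)
  case (insert i I)
  then show ?case by (simp add: smooth_on_def Ck_on_add[OF assms(1)])
qed (simp_all add: smooth_on_const)

lemma smooth_on_exp:
  fixes f :: "'a::real_normed_vector \<Rightarrow> real"
  shows "open S \<Longrightarrow> smooth_on S f \<Longrightarrow> smooth_on S (\<lambda>y. exp (f y))"
  by (simp add: smooth_on_def Ck_on_exp)

lemma smooth_on_inverse:
  fixes f :: "'a::real_normed_vector \<Rightarrow> real"
  shows "open S \<Longrightarrow> smooth_on S f \<Longrightarrow> (\<And>y. y \<in> S \<Longrightarrow> f y \<noteq> 0) \<Longrightarrow>
    smooth_on S (\<lambda>y. inverse (f y))"
  by (simp add: smooth_on_def Ck_on_inverse)

lemma smooth_on_ln:
  fixes f :: "'a::real_normed_vector \<Rightarrow> real"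
  shows "open S \<Longrightarrow> smooth_on S f \<Longrightarrow> (\<And>y. y \<in> S \<Longrightarrow> 0 < f y) \<Longrightarrow> smooth_on S (\<lambda>y. ln (f y))"
  by (simp add: smooth_on_def Ck_on_ln)

lemma smooth_on_has_derivative:
  "smooth_on S f \<Longrightarrow> y \<in> S \<Longrightarrow> (f has_derivative frechet_derivative f (at y)) (at y)"
  unfolding smooth_on_def using Ck_on_Suc_has_derivative by blast

lemma mvt_line:
  fixes f :: "'a::real_normed_vector \<Rightarrow> real"
  assumes "\<And>s. 0 \<le> s \<Longrightarrow> s \<le> t \<Longrightarrow> (f has_derivative D (a + s *\<^sub>R u)) (at (a + s *\<^sub>R u))"
    and "0 < t"
  shows "\<exists>s. 0 < s \<and> s < t \<and> f (a + t *\<^sub>R u) - f a = t * D (a + s *\<^sub>R u) u"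
proof -
  have "((\<lambda>s. f (a + s *\<^sub>R u)) has_derivative (\<lambda>r. D (a + s *\<^sub>R u) (r *\<^sub>R u))) (at s within {0..t})"
    if "0 \<le> s" "s \<le> t" for s
    by (rule has_derivative_compose[of "\<lambda>s. a + s *\<^sub>R u", OF _ assms(1)[OF that]])
      (auto intro!: derivative_eq_intros)
  from mvt_simple[OF assms(2) this]
  obtain s where s: "s \<in> {0<..<t}"
    "f (a + t *\<^sub>R u) - f (a + 0 *\<^sub>R u) = D (a + s *\<^sub>R u) ((t - 0) *\<^sub>R u)"
    by auto
  moreover have "linear (D (a + s *\<^sub>R u))"
    using assms(1)[of s] s(1) by (auto dest: has_derivative_linear)
  ultimately show ?thesis by (auto simp: linear_cmul)
qed

text \<open>The second difference of \<open>f\<close> over the parallelogram with sides \<open>t u\<close> and \<open>t v\<close> is, by the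
  mean value theorem applied in either order, \<open>t\<^sup>2\<close> times a mixed second derivative at an
  intermediate point. Letting \<open>t \<rightarrow> 0\<close> gives the symmetry of second derivatives.\<close>

lemma second_difference:
  fixes f :: "'a::real_normed_vector \<Rightarrow> real"
  assumes S: "ball x e \<subseteq> S" and C: "Ck_on (Suc (Suc k)) S f"
    and t: "0 < t" "t * (norm u + norm v) < e"
  shows "\<exists>z. dist x z \<le> t * (norm u + norm v) \<and>
    f (x + t *\<^sub>R u + t *\<^sub>R v) - f (x + t *\<^sub>R u) - (f (x + t *\<^sub>R v) - f x) =
      t\<^sup>2 * frechet_derivative (\<lambda>y. frechet_derivative f (at y) u) (at z) v"
proof -
  let ?D = "\<lambda>y. frechet_derivative f (at y)"
  have near: "dist x (x + s *\<^sub>R u + r *\<^sub>R v) \<le> t * (norm u + norm v)"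
    if "0 \<le> s" "s \<le> t" "0 \<le> r" "r \<le> t" for s r
  proof -
    have "norm (s *\<^sub>R u + r *\<^sub>R v) \<le> s * norm u + r * norm v"
      using that norm_triangle_ineq[of "s *\<^sub>R u" "r *\<^sub>R v"] by simp
    also have "\<dots> \<le> t * norm u + t * norm v"
      using that by (intro add_mono mult_right_mono) auto
    finally show ?thesis by (simp add: dist_norm algebra_simps norm_minus_commute)
  qed
  have inS: "x + s *\<^sub>R u + r *\<^sub>R v \<in> S" if "0 \<le> s" "s \<le> t" "0 \<le> r" "r \<le> t" for s r
    using near[OF that] t(2) S by (auto simp: subset_iff)
  have Df: "(f has_derivative ?D y) (at y)" if "y \<in> S" for y
    using Ck_on_Suc_has_derivative[OF C that] .
  define g where "g = (\<lambda>y. f (y + t *\<^sub>R v) - f y)"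
  have "(g has_derivative (\<lambda>w. ?D (y + t *\<^sub>R v) w - ?D y w)) (at y)"
    if "y + t *\<^sub>R v \<in> S" "y \<in> S" for y
    unfolding g_def
    by (rule has_derivative_diff[OF has_derivative_compose[of "\<lambda>y. y + t *\<^sub>R v" "\<lambda>w. w", OF _ Df] Df])
      (use that in \<open>auto intro!: derivative_eq_intros\<close>)
  then have "\<exists>s. 0 < s \<and> s < t \<and> g (x + t *\<^sub>R u) - g x
      = t * (?D (x + s *\<^sub>R u + t *\<^sub>R v) u - ?D (x + s *\<^sub>R u) u)"
    using inS[of _ t] inS[of _ 0] t(1)
    by (intro mvt_line[of t g "\<lambda>y w. ?D (y + t *\<^sub>R v) w - ?D y w" x u]) auto
  then obtain s where s: "0 < s" "s < t" "g (x + t *\<^sub>R u) - g x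
      = t * (?D (x + s *\<^sub>R u + t *\<^sub>R v) u - ?D (x + s *\<^sub>R u) u)" by blast
  let ?D2 = "\<lambda>y. frechet_derivative (\<lambda>y. ?D y u) (at y)"
  have "Ck_on (Suc k) S (\<lambda>y. ?D y u)" using C Ck_on.simps(2)[of "Suc k" S f] by blast
  then have D2: "((\<lambda>y. ?D y u) has_derivative ?D2 y) (at y)" if "y \<in> S" for y
    using Ck_on_Suc_has_derivative that by blast
  have "\<exists>r. 0 < r \<and> r < t \<and> ?D (x + s *\<^sub>R u + t *\<^sub>R v) u - ?D (x + s *\<^sub>R u) u
      = t * ?D2 (x + s *\<^sub>R u + r *\<^sub>R v) v"
    using s inS[of s] by (intro mvt_line D2) auto
  then obtain r where r: "0 < r" "r < t" "?D (x + s *\<^sub>R u + t *\<^sub>R v) u - ?D (x + s *\<^sub>R u) u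
      = t * ?D2 (x + s *\<^sub>R u + r *\<^sub>R v) v" by blast
  show ?thesis
    using near[of s r] s r
    by (intro exI[of _ "x + s *\<^sub>R u + r *\<^sub>R v"])
      (simp add: g_def power2_eq_square algebra_simps)
qed

lemma second_derivative_symmetric:
  fixes f :: "'a::real_normed_vector \<Rightarrow> real"
  assumes "open S" "smooth_on S f" "x \<in> S"
  shows "frechet_derivative (\<lambda>y. frechet_derivative f (at y) u) (at x) v =
         frechet_derivative (\<lambda>y. frechet_derivative f (at y) v) (at x) u"
proof -
  let ?H = "\<lambda>u v z. frechet_derivative (\<lambda>y. frechet_derivative f (at y) u) (at z) v"
  obtain e where e: "e > 0" "ball x e \<subseteq> S" using assms openE by blast
  have C: "Ck_on (Suc (Suc 0)) S f" using assms(2) unfolding smooth_on_def by blast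
  have cont: "isCont (?H u v) x" for u v
    using C assms(1,3) by (simp add: continuous_on_eq_continuous_at)
  define N where "N = norm u + norm v"
  \<comment> \<open>Side lengths tending to zero for which the parallelogram stays inside the ball.\<close>
  define t where "t = (\<lambda>n. e / (N + 1) * inverse (real (Suc n)))"
  have N: "N \<ge> 0" by (simp add: N_def)
  have t: "0 < t n" "t n * N < e" for n
  proof -
    show pos: "0 < t n" using e N by (simp add: t_def)
    have "t n * N < t n * (N + 1)" using pos by simp
    also have "\<dots> = e * inverse (real (Suc n))" using N by (simp add: t_def)
    also have "\<dots> \<le> e" using e by (simp add: field_simps)
    finally show "t n * N < e" .
  qed
  have t0: "t \<longlonglongrightarrow> 0"
    unfolding t_def by (rule tendsto_mult_right_zero[OF LIMSEQ_inverse_real_of_nat])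
  have "\<exists>z. dist x z \<le> t n * N \<and>
      f (x + t n *\<^sub>R u + t n *\<^sub>R v) - f (x + t n *\<^sub>R u) - (f (x + t n *\<^sub>R v) - f x) =
      (t n)\<^sup>2 * ?H u v z" for n
    using second_difference[OF e(2) C t(1), of n u v] t(2)[of n] by (simp add: N_def)
  then obtain z where z: "\<And>n. dist x (z n) \<le> t n * N"
    "\<And>n. f (x + t n *\<^sub>R u + t n *\<^sub>R v) - f (x + t n *\<^sub>R u) - (f (x + t n *\<^sub>R v) - f x) =
      (t n)\<^sup>2 * ?H u v (z n)" by metis
  have "\<exists>z. dist x z \<le> t n * N \<and>
      f (x + t n *\<^sub>R v + t n *\<^sub>R u) - f (x + t n *\<^sub>R v) - (f (x + t n *\<^sub>R u) - f x) =
      (t n)\<^sup>2 * ?H v u z" for n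
    using second_difference[OF e(2) C t(1), of n v u] t(2)[of n] by (simp add: N_def add.commute)
  then obtain w where w: "\<And>n. dist x (w n) \<le> t n * N"
    "\<And>n. f (x + t n *\<^sub>R v + t n *\<^sub>R u) - f (x + t n *\<^sub>R v) - (f (x + t n *\<^sub>R u) - f x) =
      (t n)\<^sup>2 * ?H v u (w n)" by metis
  have eq: "?H u v (z n) = ?H v u (w n)" for n
  proof -
    have "(t n)\<^sup>2 * ?H u v (z n) = (t n)\<^sup>2 * ?H v u (w n)"
      unfolding z(2)[symmetric] w(2)[symmetric] by (simp add: algebra_simps)
    then show ?thesis using t(1)[of n] by simp
  qed
  have lim: "a \<longlonglongrightarrow> x" if "\<And>n. dist x (a n) \<le> t n * N" for a
  proof -
    have "\<forall>n. norm (dist (a n) x) \<le> t n * N"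
      using that by (metis abs_of_nonneg dist_commute real_norm_def zero_le_dist)
    from Lim_null_comparison[OF always_eventually[OF this] tendsto_mult_left_zero[OF t0]]
    have "(\<lambda>n. dist (a n) x) \<longlonglongrightarrow> 0" .
    then show ?thesis by (subst tendsto_dist_iff)
  qed
  have "(\<lambda>n. ?H u v (z n)) \<longlonglongrightarrow> ?H u v x" "(\<lambda>n. ?H v u (w n)) \<longlonglongrightarrow> ?H v u x"
    by (intro isCont_tendsto_compose[OF cont lim] z(1) w(1))+
  then show ?thesis unfolding eq by (rule LIMSEQ_unique)
qed

section \<open>Alternating multilinear functions on lists of vectors\<close>

lemma multilinear_alternating_linear:
  assumes "multilinear_alternating k f" "length xs + length ys + 1 = k"
  shows "linear (\<lambda>v. f (xs @ v # ys))"
proof -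
  have "linear (\<lambda>v. f ((xs @ 0 # ys)[length xs := v]))"
    using assms unfolding multilinear_alternating_def by (metis add.commute add.left_commute
        length_Cons length_append less_add_Suc1 plus_1_eq_Suc)
  then show ?thesis by simp
qed

lemma multilinear_alternating_repeated:
  assumes "multilinear_alternating k f" "length xs + length ys + length zs + 2 = k"
  shows "f (xs @ v # ys @ v # zs) = 0"
proof -
  let ?vs = "xs @ v # ys @ v # zs"
  have "?vs ! length xs = v" "?vs ! (length xs + 1 + length ys) = v"
    by (simp_all add: nth_append)
  moreover have "length ?vs = k" "length xs < length xs + 1 + length ys"
    "length xs + 1 + length ys < k" using assms(2) by simp_all
  ultimately show ?thesis
    using assms(1) unfolding multilinear_alternating_def by metis
qed

lemma multilinear_alternating_adjacent:
  assumes "multilinear_alternating k f" "length xs + length zs + 2 = k"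
  shows "f (xs @ v # v # zs) = 0"
  using multilinear_alternating_repeated[of k f xs "[]" zs v] assms by simp

lemma adjacent_swap:
  assumes lin: "\<And>xs ys. length xs + length ys + 1 = k \<Longrightarrow> linear (\<lambda>v. f (xs @ v # ys))"
    and adj: "\<And>xs v ys. length xs + length ys + 2 = k \<Longrightarrow> f (xs @ v # v # ys) = 0"
    and len: "length xs + length ys + 2 = k"
  shows "f (xs @ u # v # ys) = - f (xs @ v # u # ys)"
proof -
  have 1: "f (xs @ (u + v) # w # ys) = f (xs @ u # w # ys) + f (xs @ v # w # ys)" for w
    using linear_add[OF lin[of xs "w # ys"]] len by simp
  have 2: "f (xs @ w # (u + v) # ys) = f (xs @ w # u # ys) + f (xs @ w # v # ys)" for w
    using linear_add[OF lin[of "xs @ [w]" ys]] len by simp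
  have "f (xs @ (u + v) # (u + v) # ys)
      = f (xs @ u # u # ys) + f (xs @ v # u # ys) + (f (xs @ u # v # ys) + f (xs @ v # v # ys))"
    by (simp only: 1 2)
  then show ?thesis using adj[OF len] by (simp add: eq_neg_iff_add_eq_0 add.commute)
qed

lemma adjacent_move:
  assumes lin: "\<And>xs ys. length xs + length ys + 1 = k \<Longrightarrow> linear (\<lambda>v. f (xs @ v # ys))"
    and adj: "\<And>xs v ys. length xs + length ys + 2 = k \<Longrightarrow> f (xs @ v # v # ys) = 0"
    and len: "length xs + length ys + length zs + 1 = k"
  shows "f (xs @ a # ys @ zs) = (- 1) ^ length ys *\<^sub>R f (xs @ ys @ a # zs)"
  using len
proof (induction ys arbitrary: xs)
  case (Cons y ys)
  have "f (xs @ a # y # ys @ zs) = - f (xs @ y # a # ys @ zs)"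
    using Cons.prems by (intro adjacent_swap[OF lin adj]) auto
  also have "f (xs @ y # a # ys @ zs) = (- 1) ^ length ys *\<^sub>R f (xs @ y # ys @ a # zs)"
    using Cons.IH[of "xs @ [y]"] Cons.prems by simp
  finally show ?case by simp
qed simp

text \<open>Equal arguments can be moved next to each other by transpositions of neighbours, so only
  neighbouring repetitions have to be checked. This is what makes the recursive descriptions of the
  wedge product and of the exterior derivative below easy to use.\<close>

lemma multilinear_alternatingI:
  fixes f :: "'a::real_normed_vector list \<Rightarrow> 'b::real_normed_vector"
  assumes lin: "\<And>xs ys. length xs + length ys + 1 = k \<Longrightarrow> linear (\<lambda>v. f (xs @ v # ys))"
    and adj: "\<And>xs v ys. length xs + length ys + 2 = k \<Longrightarrow> f (xs @ v # v # ys) = 0"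
  shows "multilinear_alternating k f"
  unfolding multilinear_alternating_def
proof (intro conjI allI impI)
  fix vs :: "'a list" and i assume *: "length vs = k \<and> i < k"
  then have "linear (\<lambda>v. f (take i vs @ v # drop (Suc i) vs))" by (intro lin) auto
  moreover have "vs[i := v] = take i vs @ v # drop (Suc i) vs" for v
    using * by (intro upd_conv_take_nth_drop) simp
  ultimately show "linear (\<lambda>v. f (vs[i := v]))" by (simp only:)
next
  fix vs :: "'a list" and i j assume *: "length vs = k \<and> i < j \<and> j < k \<and> vs ! i = vs ! j"
  define y where "y = vs ! j"
  define xs ys zs where "xs = take i vs" and "ys = drop (Suc i) (take j vs)"
    and "zs = drop (Suc j) vs"
  have "vs = take j vs @ y # zs" using * id_take_nth_drop by (metis zs_def y_def)
  moreover have "take j vs = xs @ y # ys"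
    using * id_take_nth_drop[of i "take j vs"] by (simp add: xs_def ys_def y_def min_def)
  ultimately have vs: "vs = xs @ y # ys @ y # zs" by (metis append_Cons append_assoc)
  have len: "length xs + length ys + length zs + 2 = k"
    using arg_cong[OF vs, of length] * by simp
  have "f (xs @ y # ys @ y # zs)
      = (- 1) ^ length ys *\<^sub>R f (xs @ ys @ y # y # zs)"
    using len by (intro adjacent_move[OF lin adj]) auto
  also have "f (xs @ ys @ y # y # zs) = 0"
    using adj[of "xs @ ys" zs] len by simp
  finally show "f vs = 0" by (simp flip: vs)
qed

lemma multilinear_alternating_Cons:
  assumes "multilinear_alternating (Suc k) f"
  shows "multilinear_alternating k (\<lambda>vs. f (v # vs))"
proof (rule multilinear_alternatingI)
  show "linear (\<lambda>u. f (v # xs @ u # ys))" if "length xs + length ys + 1 = k" for xs ys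
    using multilinear_alternating_linear[OF assms, of "v # xs" ys] that by simp
  show "f (v # xs @ u # u # ys) = 0" if "length xs + length ys + 2 = k" for xs u ys
    using multilinear_alternating_adjacent[OF assms, of "v # xs" ys] that by simp
qed

text \<open>A permutation of the arguments only changes the sign; the list \<open>ps\<close> of arguments that stay in
  place makes the induction work.\<close>

lemma multilinear_alternating_perm_zero:
  assumes "multilinear_alternating k f"
  shows "mset xs = mset ys \<Longrightarrow> length ps + length xs = k \<Longrightarrow> f (ps @ xs) = 0 \<longleftrightarrow> f (ps @ ys) = 0"
proof (induction xs arbitrary: ps ys)
  case (Cons a xs)
  then have "a \<in> set ys" using list.set_intros(1) mset_eq_setD by metis
  then obtain us ws where ys: "ys = us @ a # ws" by (meson split_list)
  have xs: "mset xs = mset (us @ ws)" using Cons.prems(1) by (simp add: ys)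
  then have len: "length xs = length us + length ws" by (metis length_append size_mset)
  have "f (ps @ a # us @ ws) = (- 1) ^ length us *\<^sub>R f (ps @ us @ a # ws)"
    using Cons.prems(2) len
    by (intro adjacent_move[OF multilinear_alternating_linear[OF assms]
          multilinear_alternating_adjacent[OF assms]]) auto
  then have "f (ps @ a # us @ ws) = 0 \<longleftrightarrow> f (ps @ ys) = 0" by (simp add: ys)
  moreover have "f ((ps @ [a]) @ xs) = 0 \<longleftrightarrow> f ((ps @ [a]) @ us @ ws) = 0"
    using Cons.prems(2) by (intro Cons.IH xs) auto
  ultimately show ?case by simp
qed simp

text \<open>A function that in each slot is determined to vanish by its values on \<open>B\<close> vanishes once it
  does so on all lists of elements of \<open>B\<close>. The slots may be real or complex linear.\<close>

lemma multilinear_vanishing: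
  assumes slot: "\<And>xs ys. length xs + length ys + 1 = k \<Longrightarrow> \<forall>b\<in>B. f (xs @ b # ys) = 0 \<Longrightarrow>
      \<forall>v. f (xs @ v # ys) = 0"
    and B: "\<And>vs. length vs = k \<Longrightarrow> set vs \<subseteq> B \<Longrightarrow> f vs = 0"
    and "length vs = k"
  shows "f vs = 0"
proof -
  have "f (xs @ ys) = 0" if "length xs + length ys = k" "set ys \<subseteq> B" for xs ys
    using that
  proof (induction xs arbitrary: ys rule: rev_induct)
    case (snoc x xs)
    then have "\<forall>b\<in>B. f (xs @ b # ys) = 0" by simp
    then show ?case using slot[of xs ys] snoc.prems by simp
  qed (simp add: B)
  from this[of vs "[]"] show ?thesis using assms by simp
qed

lemma top_form_eq_0:
  fixes f :: "'a::euclidean_space list \<Rightarrow> 'b::real_normed_vector"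
  assumes f: "multilinear_alternating DIM('a) f"
    and bs: "set bs = Basis" "distinct bs" "f bs = 0" and vs: "length vs = DIM('a)"
  shows "f vs = 0"
proof (rule multilinear_vanishing[of "DIM('a)" Basis])
  have len: "length bs = DIM('a)" using bs distinct_card by metis
  fix vs :: "'a list" assume vs: "length vs = DIM('a)" "set vs \<subseteq> Basis"
  show "f vs = 0"
  proof (cases "distinct vs")
    case True
    then have "set vs = set bs"
      using vs bs by (metis card_subset_eq distinct_card finite_Basis)
    then have "mset vs = mset bs" using True bs(2) set_eq_iff_mset_eq_distinct by blast
    then show ?thesis using multilinear_alternating_perm_zero[OF f, of vs bs "[]"] vs bs by simp
  next
    case False
    then obtain xs ys zs y where "vs = xs @ [y] @ ys @ [y] @ zs" using not_distinct_decomp by blast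
    then show ?thesis using multilinear_alternating_repeated[OF f, of xs ys zs y] vs by simp
  qed
next
  fix xs ys :: "'a list"
  assume *: "length xs + length ys + 1 = DIM('a)" "\<forall>b\<in>Basis. f (xs @ b # ys) = 0"
  have lin: "linear (\<lambda>v. f (xs @ v # ys))"
    using multilinear_alternating_linear[OF f *(1)] .
  have "(\<lambda>v. f (xs @ v # ys)) = (\<lambda>v. 0)"
    using * by (intro linear_eq_stdbasis lin) (auto simp: linear_zero module_hom_zero)
  then show "\<forall>v. f (xs @ v # ys) = 0" by meson
qed fact

text \<open>The space of alternating forms of top degree is one-dimensional: the combination of \<open>f\<close> and
  \<open>g\<close> that vanishes on a fixed basis vanishes identically.\<close>

lemma top_forms_proportional:
  fixes f g :: "'a::euclidean_space list \<Rightarrow> complex"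
  assumes f: "multilinear_alternating DIM('a) f" and g: "multilinear_alternating DIM('a) g"
    and len: "length vs = DIM('a)" "length ws = DIM('a)"
  shows "f vs * g ws = f ws * g vs"
proof -
  obtain bs :: "'a list" where bs: "set bs = Basis" "distinct bs"
    using finite_distinct_list[OF finite_Basis] by blast
  then have lbs: "length bs = DIM('a)" by (metis distinct_card)
  have h: "multilinear_alternating DIM('a) (\<lambda>us. f us * g bs - g us * f bs)"
  proof (rule multilinear_alternatingI)
    fix xs ys :: "'a list" assume "length xs + length ys + 1 = DIM('a)"
    from multilinear_alternating_linear[OF f this] multilinear_alternating_linear[OF g this]
    show "linear (\<lambda>v. f (xs @ v # ys) * g bs - g (xs @ v # ys) * f bs)"
      by (auto simp: linear_iff algebra_simps)
  next
    fix xs ys :: "'a list" and v assume "length xs + length ys + 2 = DIM('a)"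
    from multilinear_alternating_adjacent[OF f this] multilinear_alternating_adjacent[OF g this]
    show "f (xs @ v # v # ys) * g bs - g (xs @ v # v # ys) * f bs = 0" by simp
  qed
  have eq: "f us * g bs = g us * f bs" if "length us = DIM('a)" for us
    using top_form_eq_0[OF h bs _ that] by simp
  show ?thesis
  proof (cases "g bs = 0")
    case True
    then show ?thesis using top_form_eq_0[OF g bs] len by simp
  next
    case False
    have "(f vs * g ws) * g bs = (f vs * g bs) * g ws" by (simp add: ac_simps)
    also have "\<dots> = (f ws * g bs) * g vs"
      unfolding eq[OF len(1)] eq[OF len(2)] by (simp add: ac_simps)
    also have "\<dots> = (f ws * g vs) * g bs" by (simp add: ac_simps)
    finally show ?thesis using False by simp
  qed
qed

lemma complex_axis_expansion:
  fixes v :: "complex ^ 'n"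
  shows "v = (\<Sum>i\<in>UNIV. (v $ i) *\<^sub>\<C> axis i 1)"
  by (simp add: vec_eq_iff cscale_vec_def cscale_complex_def axis_def if_distrib cong: if_cong)

text \<open>More than \<open>n\<close> vectors of the basis of \<open>\<complex>\<^sup>n\<close> contain a repetition.\<close>

lemma complex_multilinear_eq_0:
  fixes f :: "(complex ^ 'n) list \<Rightarrow> complex"
  assumes f: "multilinear_alternating k f" and k: "CARD('n) < k"
    and homogeneous: "\<And>xs ys z v. length xs + length ys + 1 = k \<Longrightarrow>
      f (xs @ (z *\<^sub>\<C> v) # ys) = z * f (xs @ v # ys)"
    and vs: "length vs = k"
  shows "f vs = 0"
proof (rule multilinear_vanishing[of k "range (\<lambda>i. axis i 1)"])
  fix vs :: "(complex ^ 'n) list" assume vs: "length vs = k" "set vs \<subseteq> range (\<lambda>i. axis i 1)"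
  have "\<not> distinct vs"
  proof
    assume "distinct vs"
    then have "k = card (set vs)" using vs distinct_card by metis
    also have "\<dots> \<le> card (range (\<lambda>i::'n. axis i (1::complex)))" using vs by (intro card_mono) auto
    also have "\<dots> \<le> CARD('n)" by (rule card_image_le) simp
    finally show False using k by simp
  qed
  then obtain xs ys zs y where "vs = xs @ [y] @ ys @ [y] @ zs" using not_distinct_decomp by blast
  then show "f vs = 0" using multilinear_alternating_repeated[OF f, of xs ys zs y] vs by simp
next
  fix xs ys :: "(complex ^ 'n) list"
  assume *: "length xs + length ys + 1 = k" "\<forall>b\<in>range (\<lambda>i. axis i 1). f (xs @ b # ys) = 0"
  show "\<forall>v. f (xs @ v # ys) = 0"
  proof
    fix v
    have "f (xs @ v # ys) = f (xs @ (\<Sum>i\<in>UNIV. (v $ i) *\<^sub>\<C> axis i 1) # ys)"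
      by (subst (1) complex_axis_expansion[of v]) simp
    also have "\<dots> = (\<Sum>i\<in>UNIV. f (xs @ ((v $ i) *\<^sub>\<C> axis i 1) # ys))"
      by (rule linear_sum[OF multilinear_alternating_linear[OF f *(1)]])
    also have "\<dots> = 0" using * by (simp add: homogeneous)
    finally show "f (xs @ v # ys) = 0" .
  qed
qed fact


section \<open>Alternating sums\<close>

text \<open>Both the exterior derivative, with \<open>F v ws\<close> the derivative along \<open>v\<close> of the coefficient
  \<open>ws\<close>, and the wedge product of a one-form with a form have this shape.\<close>

definition alt_sum :: "('a \<Rightarrow> 'a list \<Rightarrow> 'b::real_vector) \<Rightarrow> 'a list \<Rightarrow> 'b" where
  "alt_sum F vs = (\<Sum>i<length vs. (- 1) ^ i *\<^sub>R F (vs ! i) (nths vs (- {i})))"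

lemma alt_sum_Nil [simp]: "alt_sum F [] = 0"
  by (simp add: alt_sum_def)

lemma alt_sum_Cons: "alt_sum F (v # vs) = F v vs - alt_sum (\<lambda>u ws. F u (v # ws)) vs"
proof -
  have "{j. Suc j \<noteq> 0} = UNIV" "{j. Suc j \<noteq> Suc i} = - {i}" for i by auto
  then have "nths (v # vs) (- {0}) = vs" "nths (v # vs) (- {Suc i}) = v # nths vs (- {i})" for i
    by (simp_all add: nths_Cons nths_all)
  then show ?thesis
    unfolding alt_sum_def
    by (simp add: sum.lessThan_Suc_shift sum_negf del: sum.lessThan_Suc)
qed

lemma length_nths_delete: "i < length vs \<Longrightarrow> length (nths vs (- {i})) = length vs - 1"
proof -
  assume "i < length vs"
  moreover have "{j. j < length vs \<and> j \<in> - {i}} = {..<length vs} - {i}" by auto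
  ultimately show ?thesis by (simp add: length_nths)
qed

lemma alt_sum_cong:
  assumes "\<And>u ws. length ws + 1 = length vs \<Longrightarrow> F u ws = G u ws"
  shows "alt_sum F vs = alt_sum G vs"
  unfolding alt_sum_def by (intro sum.cong refl) (auto simp: assms length_nths_delete)

lemma alt_sum_add: "alt_sum (\<lambda>u ws. F u ws + G u ws) vs = alt_sum F vs + alt_sum G vs"
  by (simp add: alt_sum_def scaleR_right_distrib sum.distrib)

lemma alt_sum_mult:
  fixes F :: "'a \<Rightarrow> 'a list \<Rightarrow> complex"
  shows "alt_sum (\<lambda>u ws. a * F u ws) vs = a * alt_sum F vs"
  by (simp add: alt_sum_def sum_distrib_left)

lemma linear_alt_sum:
  assumes "\<And>u ws. length ws + 1 = length vs \<Longrightarrow> linear (\<lambda>v. F v u ws)"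
  shows "linear (\<lambda>v. alt_sum (F v) vs)"
  unfolding alt_sum_def
proof (intro linear_compose_sum ballI)
  fix i assume "i \<in> {..<length vs}"
  then have "linear (\<lambda>v. F v (vs ! i) (nths vs (- {i})))"
    by (intro assms) (auto simp: length_nths_delete)
  then show "linear (\<lambda>v. (- 1) ^ i *\<^sub>R F v (vs ! i) (nths vs (- {i})))"
    by (rule linear_compose_scale_right)
qed

lemma alt_sum_slot_linear:
  assumes "\<And>u. multilinear_alternating k (F u)" "\<And>ws. length ws = k \<Longrightarrow> linear (\<lambda>u. F u ws)"
    and "length xs + length ys = k"
  shows "linear (\<lambda>v. alt_sum F (xs @ v # ys))"
  using assms
proof (induction xs arbitrary: F k)
  case Nil
  have "linear (\<lambda>v. F u (v # ws))" if "length ws + 1 = length ys" for u ws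
    using multilinear_alternating_linear[OF Nil.prems(1), of "[]" ws] Nil.prems(3) that by simp
  then show ?case
    using Nil.prems by (auto simp: alt_sum_Cons intro!: linear_compose_sub linear_alt_sum)
next
  case (Cons x xs)
  then obtain m where k: "k = Suc m" by (cases k) auto
  have "linear (\<lambda>v. F x (xs @ v # ys))"
    using multilinear_alternating_linear[OF Cons.prems(1), of xs ys] Cons.prems(3) by simp
  moreover have "linear (\<lambda>v. alt_sum (\<lambda>u ws. F u (x # ws)) (xs @ v # ys))"
    using Cons.prems by (intro Cons.IH[of m]) (auto simp: k intro: multilinear_alternating_Cons)
  ultimately show ?case by (auto simp: alt_sum_Cons intro!: linear_compose_sub)
qed

lemma alt_sum_adjacent:
  assumes "\<And>u xs v ys. length xs + length ys + 2 = k \<Longrightarrow> F u (xs @ v # v # ys) = 0"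
    and "length xs + length ys + 1 = k"
  shows "alt_sum F (xs @ v # v # ys) = 0"
  using assms
proof (induction xs arbitrary: F k)
  case Nil
  have "alt_sum (\<lambda>u ws. F u (v # v # ws)) ys = alt_sum (\<lambda>u ws. 0) ys"
    using Nil.prems(1)[of "[]"] Nil.prems(2) by (intro alt_sum_cong) auto
  then show ?case by (simp add: alt_sum_Cons) (simp add: alt_sum_def)
next
  case (Cons x xs)
  then obtain m where k: "k = Suc m" by (cases k) auto
  have "alt_sum (\<lambda>u ws. F u (x # ws)) (xs @ v # v # ys) = 0"
  proof (rule Cons.IH[of m])
    show "F u (x # xs' @ v # v # ys') = 0" if "length xs' + length ys' + 2 = m" for u xs' v ys'
      using Cons.prems(1)[of "x # xs'" ys'] that k by simp
  qed (use Cons.prems k in simp)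
  then show ?case using Cons.prems(1)[of xs ys x v] Cons.prems(2) by (simp add: alt_sum_Cons)
qed

lemma multilinear_alternating_alt_sum:
  assumes F: "\<And>u. multilinear_alternating k (F u)"
    and lin: "\<And>ws. length ws = k \<Longrightarrow> linear (\<lambda>u. F u ws)"
  shows "multilinear_alternating (Suc k) (alt_sum F)"
proof (rule multilinear_alternatingI)
  show "linear (\<lambda>v. alt_sum F (xs @ v # ys))" if "length xs + length ys + 1 = Suc k" for xs ys
    using that by (intro alt_sum_slot_linear[of k F] F lin) auto
  show "alt_sum F (xs @ v # v # ys) = 0" if "length xs + length ys + 2 = Suc k" for xs v ys
    using that by (intro alt_sum_adjacent[of k F]) (auto intro: multilinear_alternating_adjacent[OF F])
qed

lemma alt_sum_homogeneous:
  fixes F :: "'a::complex_model_space \<Rightarrow> 'a list \<Rightarrow> complex"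
  assumes "\<And>u z xs v ys. length xs + length ys + 1 = k \<Longrightarrow>
      F u (xs @ (z *\<^sub>\<C> v) # ys) = z * F u (xs @ v # ys)"
    and "\<And>ws z u. length ws = k \<Longrightarrow> F (z *\<^sub>\<C> u) ws = z * F u ws"
    and "length xs + length ys = k"
  shows "alt_sum F (xs @ (z *\<^sub>\<C> v) # ys) = z * alt_sum F (xs @ v # ys)"
  using assms
proof (induction xs arbitrary: F k)
  case Nil
  have "alt_sum (\<lambda>u ws. F u ((z *\<^sub>\<C> v) # ws)) ys = alt_sum (\<lambda>u ws. z * F u (v # ws)) ys"
    using Nil.prems(1)[of "[]"] Nil.prems(3) by (intro alt_sum_cong) auto
  then show ?case using Nil.prems by (simp add: alt_sum_Cons alt_sum_mult algebra_simps)
next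
  case (Cons x xs)
  then obtain m where k: "k = Suc m" by (cases k) auto
  have "alt_sum (\<lambda>u ws. F u (x # ws)) (xs @ (z *\<^sub>\<C> v) # ys)
      = z * alt_sum (\<lambda>u ws. F u (x # ws)) (xs @ v # ys)"
  proof (rule Cons.IH[of m])
    show "F u (x # xs' @ (z *\<^sub>\<C> v) # ys') = z * F u (x # xs' @ v # ys')"
      if "length xs' + length ys' + 1 = m" for u z xs' v ys'
      using Cons.prems(1)[of "x # xs'" ys'] that k by simp
  qed (use Cons.prems k in simp_all)
  then show ?case
    using Cons.prems(1)[of xs ys x z v] Cons.prems(3) by (simp add: alt_sum_Cons algebra_simps)
qed

section \<open>The wedge product at a point\<close>

text \<open>The value of a wedge product at a point, as an operation on arbitrary functions of lists: the
  recursion on the first argument leads to factors such as \<open>\<lambda>ws. f (v # ws)\<close>.\<close>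

definition shuffle_product ::
  "nat \<Rightarrow> ('a list \<Rightarrow> complex) \<Rightarrow> ('a list \<Rightarrow> complex) \<Rightarrow> 'a list \<Rightarrow> complex" where
  "shuffle_product p f g vs = (\<Sum>I | I \<subseteq> {..<length vs} \<and> card I = p.
     shuffle_sign I *\<^sub>R (f (nths vs I) * g (nths vs (- I))))"

lemma wedge_eq_shuffle_product:
  "wedge p \<alpha> \<beta> \<kappa> x vs = shuffle_product p (\<alpha> \<kappa> x) (\<beta> \<kappa> x) vs"
  by (simp add: wedge_def wedge_via_def shuffle_product_def)

lemma length_nths_subset:
  assumes "I \<subseteq> {..<length vs}"
  shows "length (nths vs I) = card I" "length (nths vs (- I)) = length vs - card I"
proof -
  have "{i. i < length vs \<and> i \<in> I} = I" using assms by auto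
  then show "length (nths vs I) = card I" by (simp add: length_nths)
  have "{i. i < length vs \<and> i \<in> - I} = {..<length vs} - I" by auto
  moreover have "finite I" using assms finite_subset by blast
  ultimately show "length (nths vs (- I)) = length vs - card I"
    using assms by (simp add: length_nths card_Diff_subset)
qed

lemma shuffle_product_cong:
  assumes "\<And>ws. length ws = p \<Longrightarrow> set ws \<subseteq> set vs \<Longrightarrow> f ws = f' ws"
    and "\<And>ws. length ws = length vs - p \<Longrightarrow> set ws \<subseteq> set vs \<Longrightarrow> g ws = g' ws"
  shows "shuffle_product p f g vs = shuffle_product p f' g' vs"
  unfolding shuffle_product_def
  by (intro sum.cong refl) (auto simp: assms length_nths_subset set_nths_subset)

lemma shuffle_product_eq_0:
  assumes "\<And>ws. length ws = p \<Longrightarrow> set ws \<subseteq> set vs \<Longrightarrow> f ws = 0"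
  shows "shuffle_product p f g vs = 0"
  unfolding shuffle_product_def
  by (intro sum.neutral) (auto simp: assms length_nths_subset set_nths_subset)

lemma shuffle_product_short:
  assumes "length vs < p"
  shows "shuffle_product p f g vs = 0"
proof -
  have "card I < p" if "I \<subseteq> {..<length vs}" for I
    using card_mono[OF _ that] assms by simp
  then have "{I. I \<subseteq> {..<length vs} \<and> card I = p} = {}" by blast
  then show ?thesis by (simp only: shuffle_product_def sum.empty)
qed

lemma shuffle_product_0: "shuffle_product 0 f g vs = f [] * g vs"
proof -
  have "{I. I \<subseteq> {..<length vs} \<and> card I = 0} = {{}}"
    by (auto dest: finite_subset)
  moreover have "shuffle_sign {} = 1" by (simp add: shuffle_sign_def)
  ultimately show ?thesis by (simp add: shuffle_product_def nths_all)
qed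

lemma shuffle_product_scale:
  "shuffle_product p (\<lambda>ws. a * f ws) g vs = a * shuffle_product p f g vs"
  "shuffle_product p f (\<lambda>ws. a * g ws) vs = a * shuffle_product p f g vs"
  by (simp_all add: shuffle_product_def sum_distrib_left algebra_simps)

lemma finite_inversions:
  fixes N :: "nat set"
  assumes "finite N"
  shows "finite {(i, j). i \<in> N \<and> j \<notin> N \<and> j < i}"
proof (rule finite_subset)
  show "{(i, j). i \<in> N \<and> j \<notin> N \<and> j < i} \<subseteq> (SIGMA i:N. {..<i})" by auto
qed (use assms in simp)

lemma shuffle_sign_insert_0: "shuffle_sign (insert 0 (Suc ` N)) = shuffle_sign N"
proof -
  let ?I = "insert 0 (Suc ` N)"
  have "{(i, j). i \<in> ?I \<and> j \<notin> ?I \<and> j < i}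
      = map_prod Suc Suc ` {(i, j). i \<in> N \<and> j \<notin> N \<and> j < i}" (is "?A = ?B")
  proof
    show "?A \<subseteq> ?B"
    proof (rule subrelI)
      fix i j assume "(i, j) \<in> ?A"
      then have *: "i \<in> ?I" "j \<notin> ?I" "j < i" by auto
      then obtain a b where "i = Suc a" "j = Suc b" by (cases i; cases j) auto
      with * show "(i, j) \<in> ?B" by (auto intro!: image_eqI[of _ _ "(a, b)"])
    qed
  qed auto
  moreover have "inj (map_prod Suc Suc)" by (simp add: prod.inj_map)
  ultimately show ?thesis
    by (simp add: shuffle_sign_def card_image inj_on_subset[OF _ subset_UNIV])
qed

lemma shuffle_sign_Suc:
  assumes "finite N"
  shows "shuffle_sign (Suc ` N) = (- 1) ^ card N * shuffle_sign N"
proof -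
  let ?I = "Suc ` N" and ?S = "{(i, j). i \<in> N \<and> j \<notin> N \<and> j < i}"
  have "{(i, j). i \<in> ?I \<and> j \<notin> ?I \<and> j < i}
      = (\<lambda>i. (Suc i, 0)) ` N \<union> map_prod Suc Suc ` ?S" (is "?A = ?B")
  proof
    show "?A \<subseteq> ?B"
    proof (rule subrelI)
      fix i j assume "(i, j) \<in> ?A"
      then have *: "i \<in> ?I" "j \<notin> ?I" "j < i" by auto
      then obtain a where a: "i = Suc a" "a \<in> N" by auto
      show "(i, j) \<in> ?B"
      proof (cases j)
        case 0
        then show ?thesis using a by auto
      next
        case (Suc b)
        then have "(a, b) \<in> ?S" using * a by auto
        then have "map_prod Suc Suc (a, b) \<in> map_prod Suc Suc ` ?S" by (rule imageI)
        then show ?thesis using a Suc by simp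
      qed
    qed
  qed auto
  moreover have "card ((\<lambda>i. (Suc i, 0::nat)) ` N \<union> map_prod Suc Suc ` ?S) = card N + card ?S"
  proof (subst card_Un_disjoint)
    show "card ((\<lambda>i. (Suc i, 0::nat)) ` N) + card (map_prod Suc Suc ` ?S) = card N + card ?S"
      by (intro arg_cong2[where f = "(+)"] card_image) (auto intro!: inj_onI)
  qed (use assms finite_inversions[OF assms] in auto)
  ultimately show ?thesis by (simp add: shuffle_sign_def power_add)
qed

text \<open>The first argument goes either into the left or into the right factor; in the second case it
  passes the \<open>p\<close> arguments of the left factor.\<close>

lemma shuffle_product_Cons:
  "shuffle_product (Suc p) f g (v # vs) =
     shuffle_product p (\<lambda>ws. f (v # ws)) g vs
     + (- 1) ^ Suc p * shuffle_product (Suc p) f (\<lambda>ws. g (v # ws)) vs"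
proof -
  let ?m = "length vs"
  let ?C = "\<lambda>p. {N. N \<subseteq> {..<?m} \<and> card N = p}"
  let ?t = "\<lambda>I. shuffle_sign I *\<^sub>R (f (nths (v # vs) I) * g (nths (v # vs) (- I)))"
  let ?A = "(\<lambda>N. insert 0 (Suc ` N)) ` ?C p" and ?B = "image Suc ` ?C (Suc p)"
  have fin: "finite N" if "N \<subseteq> {..<?m}" for N using that finite_subset by blast
  have split: "{I. I \<subseteq> {..<Suc ?m} \<and> card I = Suc p} = ?A \<union> ?B"
  proof
    show "{I. I \<subseteq> {..<Suc ?m} \<and> card I = Suc p} \<subseteq> ?A \<union> ?B"
    proof
      fix I assume "I \<in> {I. I \<subseteq> {..<Suc ?m} \<and> card I = Suc p}"
      then have I: "I \<subseteq> {..<Suc ?m}" "card I = Suc p" by auto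
      define N where "N = {j. Suc j \<in> I}"
      have N: "N \<subseteq> {..<?m}" using I by (auto simp: N_def)
      show "I \<in> ?A \<union> ?B"
      proof (cases "0 \<in> I")
        case True
        have eq: "I = insert 0 (Suc ` N)"
        proof
          show "I \<subseteq> insert 0 (Suc ` N)"
          proof
            fix i assume "i \<in> I" then show "i \<in> insert 0 (Suc ` N)"
              by (cases i) (auto simp: N_def)
          qed
        qed (use True in \<open>auto simp: N_def\<close>)
        then have "card N = p" using I(2) fin[OF N] by (simp add: card_image card_insert_if)
        then show ?thesis using eq N by blast
      next
        case False
        have eq: "I = Suc ` N"
        proof
          show "I \<subseteq> Suc ` N"
          proof
            fix i assume "i \<in> I" then show "i \<in> Suc ` N"
              using False by (cases i) (auto simp: N_def)
          qed
        qed (auto simp: N_def)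
        then have "card N = Suc p" using I(2) by (simp add: card_image)
        then show ?thesis using eq N by blast
      qed
    qed
    show "?A \<union> ?B \<subseteq> {I. I \<subseteq> {..<Suc ?m} \<and> card I = Suc p}"
    proof
      fix I assume "I \<in> ?A \<union> ?B"
      then consider N where "N \<in> ?C p" "I = insert 0 (Suc ` N)" | N where "N \<in> ?C (Suc p)" "I = Suc ` N"
        by blast
      then show "I \<in> {I. I \<subseteq> {..<Suc ?m} \<and> card I = Suc p}"
        by cases (auto simp: fin card_image card_insert_if)
    qed
  qed
  have inj1: "inj_on (\<lambda>N. insert 0 (Suc ` N)) X" and inj2: "inj_on (image Suc) X" for X
  proof -
    have "{j. Suc j \<in> insert 0 (Suc ` N)} = N" "{j. Suc j \<in> Suc ` N} = N" for N by auto
    then show "inj_on (\<lambda>N. insert 0 (Suc ` N)) X" "inj_on (image Suc) X"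
      by (auto intro: inj_on_inverseI[where g = "\<lambda>I. {j. Suc j \<in> I}"])
  qed
  have "shuffle_product (Suc p) f g (v # vs) = sum ?t (?A \<union> ?B)"
    unfolding shuffle_product_def length_Cons split by (rule refl)
  also have "\<dots> = sum ?t ?A + sum ?t ?B"
    by (rule sum.union_disjoint) auto
  also have "sum ?t ?A = (\<Sum>N\<in>?C p. ?t (insert 0 (Suc ` N)))"
    by (simp add: sum.reindex[OF inj1])
  also have "\<dots> = shuffle_product p (\<lambda>ws. f (v # ws)) g vs"
    unfolding shuffle_product_def
  proof (intro sum.cong refl)
    fix N
    have "{j. Suc j \<in> insert 0 (Suc ` N)} = N" "{j. Suc j \<in> - insert 0 (Suc ` N)} = - N" by auto
    then show "?t (insert 0 (Suc ` N)) = shuffle_sign N *\<^sub>R (f (v # nths vs N) * g (nths vs (- N)))"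
      by (simp add: nths_Cons shuffle_sign_insert_0)
  qed
  also have "sum ?t ?B = (\<Sum>N\<in>?C (Suc p). ?t (Suc ` N))"
    by (simp add: sum.reindex[OF inj2])
  also have "\<dots> = (- 1) ^ Suc p * shuffle_product (Suc p) f (\<lambda>ws. g (v # ws)) vs"
    unfolding shuffle_product_def sum_distrib_left
  proof (intro sum.cong refl)
    fix N assume "N \<in> ?C (Suc p)"
    then have N: "finite N" "card N = Suc p" using fin by auto
    have "{j. Suc j \<in> Suc ` N} = N" "{j. Suc j \<in> - Suc ` N} = - N" by auto
    then have "?t (Suc ` N) = shuffle_sign (Suc ` N) *\<^sub>R (f (nths vs N) * g (v # nths vs (- N)))"
      by (simp add: nths_Cons)
    then show "?t (Suc ` N) = (- 1) ^ Suc p * (shuffle_sign N *\<^sub>R (f (nths vs N) * g (v # nths vs (- N))))"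
      using N by (simp add: shuffle_sign_Suc scaleR_conv_of_real)
  qed
  finally show ?thesis .
qed

lemma shuffle_product_1:
  "shuffle_product (Suc 0) f g vs = alt_sum (\<lambda>u ws. f [u] * g ws) vs"
proof (induction vs arbitrary: g)
  case Nil
  then show ?case by (simp add: shuffle_product_short)
next
  case (Cons v vs)
  then show ?case by (simp add: shuffle_product_Cons shuffle_product_0 alt_sum_Cons)
qed

lemma linear_shuffle_product_left:
  assumes "\<And>ws. length ws = p \<Longrightarrow> linear (\<lambda>v. F v ws)"
  shows "linear (\<lambda>v. shuffle_product p (F v) g vs)"
proof -
  have "linear (\<lambda>v. shuffle_sign I *\<^sub>R (F v (nths vs I) * g (nths vs (- I))))"
    if "I \<subseteq> {..<length vs}" "card I = p" for I
  proof -
    have "linear (\<lambda>v. F v (nths vs I))" by (rule assms) (use that in \<open>simp add: length_nths_subset\<close>)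
    then show ?thesis by (simp add: linear_iff algebra_simps)
  qed
  then show ?thesis unfolding shuffle_product_def by (intro linear_compose_sum) auto
qed

lemma linear_shuffle_product_right:
  assumes "\<And>ws. length ws = length vs - p \<Longrightarrow> linear (\<lambda>v. F v ws)"
  shows "linear (\<lambda>v. shuffle_product p f (F v) vs)"
proof -
  have "linear (\<lambda>v. shuffle_sign I *\<^sub>R (f (nths vs I) * F v (nths vs (- I))))"
    if "I \<subseteq> {..<length vs}" "card I = p" for I
  proof -
    have "linear (\<lambda>v. F v (nths vs (- I)))" by (rule assms) (use that in \<open>simp add: length_nths_subset\<close>)
    then show ?thesis by (simp add: linear_iff algebra_simps)
  qed
  then show ?thesis unfolding shuffle_product_def by (intro linear_compose_sum) auto
qed

lemma shuffle_product_slot_linear: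
  assumes "multilinear_alternating p f" "multilinear_alternating q g"
    and "length xs + length ys + 1 = p + q"
  shows "linear (\<lambda>v. shuffle_product p f g (xs @ v # ys))"
  using assms
proof (induction xs arbitrary: p q f g)
  case Nil
  show ?case
  proof (cases p)
    case 0
    then have "linear (\<lambda>v. g ([] @ v # ys))"
      using Nil.prems by (intro multilinear_alternating_linear) auto
    then show ?thesis by (simp add: 0 shuffle_product_0 linear_iff algebra_simps)
  next
    case (Suc p')
    have "linear (\<lambda>v. f (v # ws))" if "length ws = p'" for ws
      using multilinear_alternating_linear[OF Nil.prems(1), of "[]" ws] that Suc by simp
    then have 1: "linear (\<lambda>v. shuffle_product p' (\<lambda>ws. f (v # ws)) g ys)"
      by (rule linear_shuffle_product_left)
    have 2: "linear (\<lambda>v. shuffle_product (Suc p') f (\<lambda>ws. g (v # ws)) ys)"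
    proof (cases q)
      case 0
      then show ?thesis using Nil.prems Suc by (simp add: shuffle_product_short linear_zero)
    next
      case q: (Suc q')
      have "linear (\<lambda>v. g (v # ws))" if "length ws = length ys - Suc p'" for ws
        using multilinear_alternating_linear[OF Nil.prems(2), of "[]" ws] that Suc q Nil.prems(3)
        by simp
      then show ?thesis by (intro linear_shuffle_product_right)
    qed
    from 1 2 show ?thesis by (simp add: Suc shuffle_product_Cons linear_iff algebra_simps)
  qed
next
  case (Cons x xs)
  show ?case
  proof (cases p)
    case 0
    then have "linear (\<lambda>v. g ((x # xs) @ v # ys))"
      using Cons.prems by (intro multilinear_alternating_linear) auto
    then show ?thesis by (simp add: 0 shuffle_product_0 linear_iff algebra_simps)
  next
    case (Suc p')
    have 1: "linear (\<lambda>v. shuffle_product p' (\<lambda>ws. f (x # ws)) g (xs @ v # ys))"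
      using Cons.prems Suc by (intro Cons.IH[of p' _ q] multilinear_alternating_Cons) auto
    have 2: "linear (\<lambda>v. shuffle_product (Suc p') f (\<lambda>ws. g (x # ws)) (xs @ v # ys))"
    proof (cases q)
      case 0
      then show ?thesis using Cons.prems Suc by (simp add: shuffle_product_short linear_zero)
    next
      case q: (Suc q')
      then show ?thesis
        using Cons.prems Suc by (intro Cons.IH[of _ _ q'] multilinear_alternating_Cons) auto
    qed
    from 1 2 show ?thesis by (simp add: Suc shuffle_product_Cons linear_iff algebra_simps)
  qed
qed

lemma shuffle_product_adjacent_head:
  assumes "\<And>ws. length ws + 2 = p \<Longrightarrow> f (v # v # ws) = 0"
    and "\<And>ws. length ws + 2 = q \<Longrightarrow> g (v # v # ws) = 0"
    and "length ys + 2 = p + q"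
  shows "shuffle_product p f g (v # v # ys) = 0"
proof (cases p)
  case 0
  then show ?thesis using assms by (simp add: shuffle_product_0)
next
  case p: (Suc p')
  have 2: "shuffle_product (Suc p') f (\<lambda>ws. g (v # v # ws)) ys = 0"
  proof (cases "length ys < Suc p'")
    case False
    then have "g (v # v # ws) = 0" if "length ws = length ys - Suc p'" for ws
      using that assms(3) p by (intro assms(2)) simp
    then have "shuffle_product (Suc p') f (\<lambda>ws. g (v # v # ws)) ys
        = shuffle_product (Suc p') f (\<lambda>ws. 0) ys" by (intro shuffle_product_cong) auto
    then show ?thesis by (simp add: shuffle_product_def)
  qed (rule shuffle_product_short)
  show ?thesis
  proof (cases p')
    case 0
    then show ?thesis using 2 by (simp add: p shuffle_product_Cons shuffle_product_0)
  next
    case (Suc m)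
    have 1: "shuffle_product m (\<lambda>ws. f (v # v # ws)) g ys = 0"
      using assms(1) p Suc by (intro shuffle_product_eq_0) auto
    show ?thesis using 1 2 by (simp add: p Suc shuffle_product_Cons)
  qed
qed

lemma shuffle_product_adjacent:
  assumes "multilinear_alternating p f" "multilinear_alternating q g"
    and "length xs + length ys + 2 = p + q"
  shows "shuffle_product p f g (xs @ v # v # ys) = 0"
  using assms
proof (induction xs arbitrary: p q f g)
  case Nil
  have "shuffle_product p f g (v # v # ys) = 0"
    using multilinear_alternating_adjacent[OF Nil.prems(1), of "[]"]
      multilinear_alternating_adjacent[OF Nil.prems(2), of "[]"] Nil.prems(3)
    by (intro shuffle_product_adjacent_head[where q = q]) simp_all
  then show ?case by simp
next
  case (Cons x xs)
  show ?case
  proof (cases p)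
    case 0
    then have "g ((x # xs) @ v # v # ys) = 0"
      using Cons.prems by (intro multilinear_alternating_adjacent) auto
    then show ?thesis by (simp add: 0 shuffle_product_0)
  next
    case (Suc p')
    have 1: "shuffle_product p' (\<lambda>ws. f (x # ws)) g (xs @ v # v # ys) = 0"
      using Cons.prems Suc by (intro Cons.IH[of p' _ q] multilinear_alternating_Cons) auto
    have 2: "shuffle_product (Suc p') f (\<lambda>ws. g (x # ws)) (xs @ v # v # ys) = 0"
    proof (cases q)
      case 0
      then show ?thesis using Cons.prems Suc by (simp add: shuffle_product_short)
    next
      case q: (Suc q')
      then show ?thesis
        using Cons.prems Suc by (intro Cons.IH[of _ _ q'] multilinear_alternating_Cons) auto
    qed
    from 1 2 show ?thesis by (simp add: Suc shuffle_product_Cons)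
  qed
qed

lemma multilinear_alternating_shuffle_product:
  assumes "multilinear_alternating p f" "multilinear_alternating q g"
  shows "multilinear_alternating (p + q) (shuffle_product p f g)"
  by (intro multilinear_alternatingI shuffle_product_slot_linear[OF assms]
      shuffle_product_adjacent[OF assms])

section \<open>Hermitian linear algebra\<close>

lemma J_J [simp]: "J (J v) = - (v :: 'e::complex_model_space)"
  using cscale_of_real[of "-1" v] by (simp add: cscale_cscale)

lemma linear_J: "linear (J :: 'e::complex_model_space \<Rightarrow> 'e)"
proof (rule linearI)
  fix r and v :: 'e
  show "J (r *\<^sub>R v) = r *\<^sub>R J v"
    by (simp flip: cscale_of_real add: cscale_cscale mult.commute)
qed (rule cscale_add_right)

lemma J_minus [simp]: "J (- v) = - J (v :: 'e::complex_model_space)"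
  by (rule linear_neg[OF linear_J])

text \<open>Complex linearity can be checked on real multiples and on \<open>J\<close>.\<close>

lemma cscale_Complex: "z *\<^sub>\<C> (v :: 'e::complex_model_space) = Re z *\<^sub>R v + Im z *\<^sub>R J v"
  by (subst complex_eq) (simp add: cscale_add_left cscale_cscale flip: cscale_of_real mult.commute)

definition hermitian_at :: "('e::complex_model_space list \<Rightarrow> complex) \<Rightarrow> bool" where
  "hermitian_at w \<longleftrightarrow> multilinear_alternating 2 w \<and>
     (\<forall>u v. w [u, v] \<in> \<real> \<and> w [J u, J v] = w [u, v] \<and> (v \<noteq> 0 \<longrightarrow> Re (w [v, J v]) > 0))"

fun form_power :: "('a list \<Rightarrow> complex) \<Rightarrow> nat \<Rightarrow> 'a list \<Rightarrow> complex" where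
  "form_power w 0 = (\<lambda>vs. 1)"
| "form_power w (Suc k) = shuffle_product 2 w (form_power w k)"

lemma wedge_power_eq_form_power: "wedge_power \<omega> k \<kappa> x = form_power (\<omega> \<kappa> x) k"
  by (induction k) (auto simp: wedge_eq_shuffle_product)

fun real_frame :: "'e::complex_model_space list \<Rightarrow> 'e list" where
  "real_frame [] = []"
| "real_frame (e # es) = e # J e # real_frame es"

text \<open>A unitary basis \<open>e\<^sub>1, \<dots>, e\<^sub>n\<close>, in terms of the two-form: each \<open>e\<^sub>i\<close> and \<open>Je\<^sub>i\<close> is orthogonal
  to the later vectors and their images under \<open>J\<close>, with respect to \<open>w\<close> and hence also to the metric
  \<open>w(\<cdot>, J\<cdot>)\<close>.\<close>

fun unitary :: "('e::complex_model_space list \<Rightarrow> complex) \<Rightarrow> 'e list \<Rightarrow> bool" where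
  "unitary w [] = True"
| "unitary w (e # es) \<longleftrightarrow> w [e, J e] = 1 \<and>
     (\<forall>b\<in>set (real_frame es). w [e, b] = 0 \<and> w [J e, b] = 0) \<and> unitary w es"

lemma length_real_frame [simp]: "length (real_frame es) = 2 * length es"
  by (induction es) auto

lemma J_real_frame:
  "b \<in> set (real_frame es) \<Longrightarrow> J b \<in> set (real_frame es) \<or> - J b \<in> set (real_frame es)"
  by (induction es) auto

text \<open>Expanding in the two vectors \<open>e\<close> and \<open>Je\<close>: either both go into the first factor \<open>w\<close>, or both
  into the remaining power, since \<open>w\<close> pairs neither of them with any other argument. Iterating over
  the pairs of a unitary basis gives \<open>\<omega>\<^sup>n/n! = 1\<close>.\<close>

lemma form_power_orthogonal_pair:
  assumes "w [e, J e] = 1" "\<And>u. u \<in> set us \<Longrightarrow> w [e, u] = 0 \<and> w [J e, u] = 0"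
    and "length us = 2 * m"
  shows "form_power w (Suc m) (e # J e # us) = of_nat (Suc m) * form_power w m us"
  using assms(2,3)
proof (induction m arbitrary: us)
  case 0
  then show ?case
    by (simp add: numeral_2_eq_2 shuffle_product_Cons shuffle_product_0 shuffle_product_short assms(1))
next
  case (Suc m)
  let ?g = "form_power w (Suc m)"
  have z: "shuffle_product (Suc 0) (\<lambda>ws. w (v # ws)) h us = 0" if "v = e \<or> v = J e" for v h
  proof (rule shuffle_product_eq_0)
    fix ws assume ws: "length ws = Suc 0" "set ws \<subseteq> set us"
    then obtain u where "ws = [u]" by (auto simp: length_Suc_conv)
    then show "w (v # ws) = 0" using ws Suc.prems(1)[of u] that by auto
  qed
  have "form_power w (Suc (Suc m)) (e # J e # us)
      = ?g us + shuffle_product 2 w (\<lambda>ws. ?g (e # J e # ws)) us"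
    using z by (simp del: form_power.simps add: form_power.simps(2)[of w "Suc m"] numeral_2_eq_2
        shuffle_product_Cons shuffle_product_0 assms(1))
  also have "shuffle_product 2 w (\<lambda>ws. ?g (e # J e # ws)) us
      = shuffle_product 2 w (\<lambda>ws. of_nat (Suc m) * form_power w m ws) us"
    using Suc.prems by (intro shuffle_product_cong refl Suc.IH) auto
  also have "\<dots> = of_nat (Suc m) * ?g us" by (simp add: shuffle_product_scale)
  finally show ?case by (simp add: algebra_simps)
qed

lemma form_power_unitary:
  "unitary w es \<Longrightarrow> form_power w (length es) (real_frame es) = fact (length es)"
proof (induction es)
  case (Cons e es)
  then show ?case
    using form_power_orthogonal_pair[of w e "real_frame es" "length es"]
    by (simp del: form_power.simps)
qed simp

definition type_n0 :: "nat \<Rightarrow> ('e::complex_model_space list \<Rightarrow> complex) \<Rightarrow> bool" where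
  "type_n0 k f \<longleftrightarrow> multilinear_alternating k f \<and>
     (\<forall>xs z v ys. length xs + length ys + 1 = k \<longrightarrow> f (xs @ (z *\<^sub>\<C> v) # ys) = z * f (xs @ v # ys))"

lemma type_n0_Cons:
  assumes "type_n0 (Suc k) f"
  shows "type_n0 k (\<lambda>vs. f (v # vs))"
  unfolding type_n0_def
proof (intro conjI allI impI)
  show "multilinear_alternating k (\<lambda>vs. f (v # vs))"
    using assms by (auto simp: type_n0_def intro: multilinear_alternating_Cons)
  fix xs ys :: "'a list" and z u assume "length xs + length ys + 1 = k"
  then have "length (v # xs) + length ys + 1 = Suc k" by simp
  then have "f ((v # xs) @ (z *\<^sub>\<C> u) # ys) = z * f ((v # xs) @ u # ys)"
    using assms unfolding type_n0_def by blast
  then show "f (v # xs @ (z *\<^sub>\<C> u) # ys) = z * f (v # xs @ u # ys)" by simp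
qed

text \<open>When the wedge product of \<open>f\<close> and its conjugate is evaluated on \<open>e\<^sub>1, Je\<^sub>1, e\<^sub>2, Je\<^sub>2, \<dots>\<close>, each
  factor receives exactly one vector of each pair, because \<open>f\<close> is complex linear and alternating.
  The two choices contribute equally, and each pair a factor \<open>\<plusminus>2i\<close>.\<close>

lemma shuffle_product_cnj_real_frame:
  assumes "type_n0 (length es) f"
  shows "shuffle_product (length es) f (\<lambda>vs. cnj (f vs)) (real_frame es)
    = (\<Prod>k<length es. (- 1) ^ Suc k * (2 * \<i>)) * (f es * cnj (f es))"
  using assms
proof (induction es arbitrary: f)
  case Nil
  then show ?case by (simp add: shuffle_product_0)
next
  case (Cons e es)
  let ?k = "length es" and ?us = "real_frame es" and ?h = "\<lambda>vs. cnj (f vs)"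
  have f: "type_n0 (Suc ?k) f" using Cons.prems by simp
  have J: "f (J e # ws) = \<i> * f (e # ws)" if "length ws = ?k" for ws
  proof -
    have "length [] + length ws + 1 = Suc ?k" using that by simp
    then have "f ([] @ J e # ws) = \<i> * f ([] @ e # ws)" using f unfolding type_n0_def by blast
    then show ?thesis by simp
  qed
  have 0: "f (e # J e # ws) = 0" if "length ws + 1 = ?k" for ws
  proof -
    have "length [e] + length ws + 1 = Suc ?k" using that by simp
    then have "f ([e] @ J e # ws) = \<i> * f ([e] @ e # ws)" using f unfolding type_n0_def by blast
    moreover have "f ([] @ e # e # ws) = 0"
      using f that unfolding type_n0_def by (intro multilinear_alternating_adjacent) auto
    ultimately show ?thesis by simp
  qed
  have 1: "shuffle_product ?k (\<lambda>ws. f (e # ws)) ?h (J e # ?us)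
      = (- 1) ^ ?k * shuffle_product ?k (\<lambda>ws. f (e # ws)) (\<lambda>ws. ?h (J e # ws)) ?us"
  proof (cases ?k)
    case 0
    then show ?thesis by (simp add: shuffle_product_0)
  next
    case (Suc m)
    then have "shuffle_product m (\<lambda>ws. f (e # J e # ws)) ?h ?us = 0"
      using 0 by (intro shuffle_product_eq_0) simp
    then show ?thesis by (simp add: Suc shuffle_product_Cons)
  qed
  have "shuffle_product (Suc ?k) f (\<lambda>ws. ?h (e # J e # ws)) ?us = 0"
  proof (cases ?k)
    case 0
    then show ?thesis by (simp add: shuffle_product_short)
  next
    case (Suc m)
    then have "shuffle_product (Suc ?k) f (\<lambda>ws. ?h (e # J e # ws)) ?us
        = shuffle_product (Suc ?k) f (\<lambda>ws. 0) ?us"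
      using 0 by (intro shuffle_product_cong refl) simp
    then show ?thesis by (simp add: shuffle_product_def)
  qed
  then have 2: "shuffle_product (Suc ?k) f (\<lambda>ws. ?h (e # ws)) (J e # ?us)
      = shuffle_product ?k (\<lambda>ws. f (J e # ws)) (\<lambda>ws. ?h (e # ws)) ?us"
    by (simp add: shuffle_product_Cons)
  let ?s = "shuffle_product ?k (\<lambda>ws. f (e # ws)) (\<lambda>ws. ?h (e # ws)) ?us"
  have 3: "shuffle_product ?k (\<lambda>ws. f (e # ws)) (\<lambda>ws. ?h (J e # ws)) ?us = - \<i> * ?s"
    unfolding shuffle_product_scale(2)[symmetric]
    by (intro shuffle_product_cong refl) (simp add: J)
  have 4: "shuffle_product ?k (\<lambda>ws. f (J e # ws)) (\<lambda>ws. ?h (e # ws)) ?us = \<i> * ?s"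
    unfolding shuffle_product_scale(1)[symmetric]
    by (intro shuffle_product_cong refl) (simp add: J)
  have "shuffle_product (Suc ?k) f ?h (e # J e # ?us) = (- 1) ^ Suc ?k * (2 * \<i>) * ?s"
    unfolding shuffle_product_Cons[of ?k f ?h e] 1 2 3 4 by simp
  then show ?case using Cons.IH[OF type_n0_Cons[OF f], of e] by (simp add: algebra_simps)
qed

text \<open>The phase in the definition of the norm cancels the factors \<open>\<plusminus>2i\<close> up to their moduli.\<close>

lemma volume_phase:
  "(- 1) ^ (n * (n - 1) div 2) * \<i> ^ n * (\<Prod>k<n. (- 1) ^ Suc k * (2 * \<i>)) = 2 ^ n"
proof (induction n)
  case (Suc n)
  have "Suc n * (Suc n - 1) div 2 = n * (n - 1) div 2 + n"
  proof (cases n)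
    case (Suc m)
    have "Suc n * n = n * (n - 1) + n * 2" by (simp add: Suc algebra_simps)
    then show ?thesis by simp
  qed simp
  moreover have "(- 1 :: complex) ^ n * (- 1) ^ n = 1" by (simp flip: power_mult_distrib)
  ultimately show ?case using Suc
    by (simp add: power_add algebra_simps)
qed simp

text \<open>The density that defines the norm is thus nonnegative on real frames, so that it can be the square
  of a norm.\<close>

lemma volume_density_real_frame:
  assumes "type_n0 n f" "length es = n"
  shows "(- 1) ^ (n * (n - 1) div 2) * \<i> ^ n * shuffle_product n f (\<lambda>vs. cnj (f vs)) (real_frame es)
    = of_real (2 ^ n * (cmod (f es))\<^sup>2)"
proof -
  have "(- 1) ^ (n * (n - 1) div 2) * \<i> ^ n * shuffle_product n f (\<lambda>vs. cnj (f vs)) (real_frame es)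
      = (- 1) ^ (n * (n - 1) div 2) * \<i> ^ n * (\<Prod>k<n. (- 1) ^ Suc k * (2 * \<i>)) * (f es * cnj (f es))"
    using shuffle_product_cnj_real_frame[of es f] assms by (simp only: mult.assoc)
  also have "\<dots> = 2 ^ n * (f es * cnj (f es))" unfolding volume_phase ..
  finally show ?thesis by (simp flip: complex_norm_square)
qed

context
  fixes w :: "(complex ^ 'n) list \<Rightarrow> complex"
  assumes w: "hermitian_at w"
begin

lemma hermitian_right_linear: "linear (\<lambda>v. w [u, v])"
  using w multilinear_alternating_linear[of 2 w "[u]" "[]"] by (simp add: hermitian_at_def)

lemma hermitian_skew: "w [v, u] = - w [u, v]"
proof -
  have "multilinear_alternating 2 w" using w by (simp add: hermitian_at_def)
  then have "w ([] @ v # u # []) = - w ([] @ u # v # [])"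
    by (intro adjacent_swap[of 2 w] multilinear_alternating_linear[of 2 w]
        multilinear_alternating_adjacent[of 2 w]) simp_all
  then show ?thesis by simp
qed

lemma hermitian_self [simp]: "w [v, v] = 0"
  using hermitian_skew[of v v] by simp

lemma hermitian_J: "w [J u, J v] = w [u, v]"
  using w by (simp add: hermitian_at_def)

lemma hermitian_real: "of_real (Re (w [u, v])) = w [u, v]"
  using w by (simp add: hermitian_at_def)

lemma hermitian_right_simps:
  "w [u, a + b] = w [u, a] + w [u, b]" "w [u, a - b] = w [u, a] - w [u, b]"
  "w [u, - a] = - w [u, a]" "w [u, r *\<^sub>R a] = of_real r * w [u, a]"
  using linear_add[OF hermitian_right_linear] linear_diff[OF hermitian_right_linear]
    linear_neg[OF hermitian_right_linear] linear_cmul[OF hermitian_right_linear]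
  by (simp_all add: scaleR_conv_of_real[where 'a = complex])

lemma hermitian_left_simps:
  "w [- a, u] = - w [a, u]" "w [r *\<^sub>R a, u] = of_real r * w [a, u]"
  using hermitian_skew[of _ u] by (simp_all add: hermitian_right_simps)

text \<open>Orthogonality to \<open>e\<close> and \<open>Je\<close> with respect to \<open>w\<close> determines the coefficients of \<open>Je\<close> and of
  \<open>e\<close>, respectively, and correcting along this pair leaves the pairings with the others unchanged.\<close>

lemma orthogonal_projection:
  assumes "unitary w es"
  shows "\<exists>p\<in>span (set (real_frame es)). \<forall>b\<in>set (real_frame es). w [b, u - p] = 0"
  using assms
proof (induction es)
  case (Cons e es)
  then obtain p where p: "p \<in> span (set (real_frame es))"
    "\<forall>b\<in>set (real_frame es). w [b, u - p] = 0" by auto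
  define q where "q = p + Re (w [e, u - p]) *\<^sub>R J e - Re (w [J e, u - p]) *\<^sub>R e"
  have "span (set (real_frame es)) \<subseteq> span (set (real_frame (e # es)))" by (intro span_mono) auto
  then have "q \<in> span (set (real_frame (e # es)))"
    using p(1) unfolding q_def by (intro span_add span_diff span_scale) (auto intro: span_base)
  moreover have "w [b, u - q] = 0" if b: "b \<in> set (real_frame (e # es))" for b
  proof -
    have u: "w [b, u - q] = w [b, u - p] - w [e, u - p] * w [b, J e] + w [J e, u - p] * w [b, e]" for b
      by (simp add: q_def hermitian_right_simps hermitian_real algebra_simps)
    consider "b = e" | "b = J e" | "b \<in> set (real_frame es)" using b by auto
    then show ?thesis
    proof cases
      case 3
      then have "w [b, e] = 0" "w [b, J e] = 0" using Cons.prems hermitian_skew[of b] by auto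
      then show ?thesis using p(2) 3 u by simp
    qed (use Cons.prems hermitian_skew[of "J e" e] in \<open>simp_all add: u\<close>)
  qed
  ultimately show ?case by blast
qed (auto intro: bexI[of _ 0])

text \<open>Gram--Schmidt: fewer than \<open>n\<close> pairs do not span, and the part of a further vector that is
  orthogonal to them can be normalized. It is orthogonal to the whole frame because that is stable
  under \<open>J\<close> up to signs.\<close>

lemma unitary_extend:
  assumes es: "unitary w es" and len: "length es < CARD('n)"
  shows "\<exists>e. unitary w (e # es)"
proof -
  let ?E = "set (real_frame es)"
  have "dim (span ?E) \<le> card ?E" by (simp add: dim_le_card')
  also have "\<dots> \<le> 2 * length es" using card_length[of "real_frame es"] by simp
  also have "\<dots> < DIM(complex ^ 'n)" using len by simp
  finally have "span ?E \<noteq> (UNIV :: (complex ^ 'n) set)" using dim_UNIV by (metis nat_neq_iff)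
  then obtain u where u: "u \<notin> span ?E" by blast
  obtain p where p: "p \<in> span ?E" "\<forall>b\<in>?E. w [b, u - p] = 0"
    using orthogonal_projection[OF es] by blast
  define v where "v = u - p"
  have "v \<noteq> 0" using u p(1) by (auto simp: v_def)
  then have pos: "Re (w [v, J v]) > 0" using w by (simp add: hermitian_at_def)
  define r where "r = inverse (sqrt (Re (w [v, J v])))"
  define e where "e = r *\<^sub>R v"
  have Je: "J e = r *\<^sub>R J v" by (simp add: e_def linear_cmul[OF linear_J])
  have "r * r * Re (w [v, J v]) = 1" using pos
    by (simp add: r_def power_inverse flip: power2_eq_square)
  moreover have "w [e, J e] = of_real (r * r * Re (w [v, J v]))"
    unfolding Je unfolding e_def by (simp add: hermitian_left_simps hermitian_right_simps hermitian_real)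
  ultimately have "w [e, J e] = 1" by simp
  moreover have "w [e, b] = 0 \<and> w [J e, b] = 0" if b: "b \<in> ?E" for b
  proof -
    have 0: "w [v, c] = 0" if "c \<in> ?E" for c
      using p(2) that hermitian_skew[of v c] by (simp add: v_def)
    have "w [v, J b] = 0"
      using J_real_frame[OF b] 0[of "J b"] 0[of "- J b"] by (auto simp: hermitian_right_simps)
    moreover have "w [J v, b] = w [J (J v), J b]" by (simp only: hermitian_J)
    ultimately have "w [J v, b] = 0" by (simp add: hermitian_left_simps)
    then show ?thesis unfolding Je unfolding e_def using 0[OF b] by (simp add: hermitian_left_simps)
  qed
  ultimately show ?thesis using es by auto
qed

lemma unitary_basis_exists: "\<exists>es. length es = CARD('n) \<and> unitary w es"
proof -
  have "\<exists>es. length es = k \<and> unitary w es" if "k \<le> CARD('n)" for k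
    using that
  proof (induction k)
    case (Suc k)
    then obtain es where "length es = k" "unitary w es" by auto
    with Suc.prems unitary_extend[of es] show ?case by (metis Suc_le_lessD length_Cons)
  qed simp
  then show ?thesis by blast
qed

lemma unitary_orthonormal:
  assumes "unitary w es"
  shows "\<forall>i<length (real_frame es). \<forall>j<length (real_frame es).
    w [real_frame es ! i, J (real_frame es ! j)] = (if i = j then 1 else 0)"
  using assms
proof (induction es)
  case (Cons e es)
  let ?E = "real_frame es"
  have e: "w [e, J e] = 1" "w [J e, e] = - 1" using Cons.prems hermitian_skew[of "J e" e] by auto
  have b: "w [e, b] = 0" "w [J e, b] = 0" "w [b, J e] = 0" "w [b, e] = 0" "w [e, J b] = 0"
    if "b \<in> set ?E" for b
  proof -
    show *: "w [e, b] = 0" "w [J e, b] = 0" using Cons.prems that by auto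
    then show "w [b, J e] = 0" "w [b, e] = 0" using hermitian_skew[of b] by simp_all
    have "w [e, J b] = w [J e, J (J b)]" by (simp only: hermitian_J)
    then show "w [e, J b] = 0" using * by (simp add: hermitian_right_simps)
  qed
  have E: "?E ! i \<in> set ?E" if "i < 2 * length es" for i using that by simp
  show ?case
    using Cons
    by (auto simp: nth_Cons e b E hermitian_right_simps hermitian_J less_Suc_eq_0_disj split: nat.split)
qed simp

end

section \<open>Forms in charts\<close>

lemma complex_manifold_chart:
  assumes "complex_manifold M" "\<kappa> \<in> atlas M"
  shows "open (snd \<kappa> ` fst \<kappa>)" "fst \<kappa> \<subseteq> points M" "inj_on (snd \<kappa>) (fst \<kappa>)"
proof -
  have o: "openin (man_top M) (fst \<kappa>)" and "open (snd \<kappa> ` fst \<kappa>)"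
    and h: "homeomorphic_map (subtopology (man_top M) (fst \<kappa>)) (top_of_set (snd \<kappa> ` fst \<kappa>)) (snd \<kappa>)"
    using assms unfolding complex_manifold_def by blast+
  then show "open (snd \<kappa> ` fst \<kappa>)" by blast
  show sub: "fst \<kappa> \<subseteq> points M" using o by (rule openin_subset)
  then show "inj_on (snd \<kappa>) (fst \<kappa>)"
    using homeomorphic_imp_injective_map[OF h] by (simp add: Int_absorb1)
qed

lemma complex_manifold_covered:
  assumes "complex_manifold M" "x \<in> points M"
  obtains \<kappa> where "\<kappa> \<in> atlas M" "x \<in> fst \<kappa>"
  using assms unfolding complex_manifold_def by blast

definition fun_deriv :: "('x \<Rightarrow> real) \<Rightarrow> ('x, 'e::complex_model_space) chart \<Rightarrow> 'x \<Rightarrow> 'e \<Rightarrow> real" where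
  "fun_deriv f \<kappa> x = frechet_derivative (\<lambda>y. f (chart_inv \<kappa> y)) (at (snd \<kappa> x))"

lemma ext_d_alt_sum: "ext_d \<alpha> \<kappa> x = alt_sum (\<lambda>u ws. coeff_deriv \<alpha> \<kappa> x ws u)"
  by (simp add: ext_d_def alt_sum_def fun_eq_iff)

lemma wedge_one_alt_sum: "wedge 1 \<theta> \<alpha> \<kappa> x vs = alt_sum (\<lambda>u ws. \<theta> \<kappa> x [u] * \<alpha> \<kappa> x ws) vs"
  by (simp add: wedge_eq_shuffle_product shuffle_product_1)

lemma ext_d_one_form_arg: "ext_d \<alpha> \<kappa> x [v] = coeff_deriv \<alpha> \<kappa> x [] v"
  by (simp add: ext_d_alt_sum alt_sum_Cons)

lemma is_formD:
  assumes "is_form M k \<alpha>" "\<kappa> \<in> atlas M"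
  shows "x \<in> fst \<kappa> \<Longrightarrow> multilinear_alternating k (\<alpha> \<kappa> x)"
    and "length vs = k \<Longrightarrow> smooth_on (snd \<kappa> ` fst \<kappa>) (\<lambda>y. \<alpha> \<kappa> (chart_inv \<kappa> y) vs)"
    and "\<mu> \<in> atlas M \<Longrightarrow> x \<in> fst \<kappa> \<Longrightarrow> x \<in> fst \<mu> \<Longrightarrow> length vs = k \<Longrightarrow>
      \<alpha> \<kappa> x vs = \<alpha> \<mu> x (map (tangent_map \<kappa> \<mu> (\<lambda>x. x) x) vs)"
  using assms unfolding is_form_def by blast+

lemma smooth_functionD:
  "smooth_function M f \<Longrightarrow> \<kappa> \<in> atlas M \<Longrightarrow> smooth_on (snd \<kappa> ` fst \<kappa>) (\<lambda>y. f (chart_inv \<kappa> y))"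
  by (simp add: smooth_function_def)

context
  fixes M :: "('x, 'e::complex_model_space) cmanifold" and \<kappa>
  assumes M: "complex_manifold M" and \<kappa>: "\<kappa> \<in> atlas M"
begin

lemma chart_inv_chart: "x \<in> fst \<kappa> \<Longrightarrow> chart_inv \<kappa> (snd \<kappa> x) = x"
  unfolding chart_inv_def by (rule the_inv_into_f_f[OF complex_manifold_chart(3)[OF M \<kappa>]])

lemma chart_inv_mem: "y \<in> snd \<kappa> ` fst \<kappa> \<Longrightarrow> chart_inv \<kappa> y \<in> fst \<kappa>"
  using chart_inv_chart by auto

lemma coeff_deriv_cong:
  assumes "x \<in> fst \<kappa>" "\<And>x. x \<in> fst \<kappa> \<Longrightarrow> \<alpha> \<kappa> x ws = \<beta> \<kappa> x ws"
  shows "coeff_deriv \<alpha> \<kappa> x ws = coeff_deriv \<beta> \<kappa> x ws"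
  unfolding coeff_deriv_def
  by (rule frechet_derivative_cong_open[OF complex_manifold_chart(1)[OF M \<kappa>]])
    (use assms chart_inv_mem in auto)

lemma ext_d_cong:
  assumes "x \<in> fst \<kappa>" "length vs = Suc k"
    and "\<And>x ws. x \<in> fst \<kappa> \<Longrightarrow> length ws = k \<Longrightarrow> \<alpha> \<kappa> x ws = \<beta> \<kappa> x ws"
  shows "ext_d \<alpha> \<kappa> x vs = ext_d \<beta> \<kappa> x vs"
  unfolding ext_d_alt_sum using coeff_deriv_cong[OF assms(1), of \<alpha> _ \<beta>] assms(2,3)
  by (intro alt_sum_cong) auto

lemma fun_deriv_cong:
  assumes "x \<in> fst \<kappa>" "\<And>x. x \<in> fst \<kappa> \<Longrightarrow> f x = g x"
  shows "fun_deriv f \<kappa> x = fun_deriv g \<kappa> x"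
  unfolding fun_deriv_def
  by (rule frechet_derivative_cong_open[OF complex_manifold_chart(1)[OF M \<kappa>]])
    (use assms chart_inv_mem in auto)

lemma has_derivative_coeff:
  assumes "is_form M k \<alpha>" "x \<in> fst \<kappa>" "length ws = k"
  shows "((\<lambda>y. \<alpha> \<kappa> (chart_inv \<kappa> y) ws) has_derivative coeff_deriv \<alpha> \<kappa> x ws) (at (snd \<kappa> x))"
  unfolding coeff_deriv_def
  using smooth_on_has_derivative[OF is_formD(2)[OF assms(1) \<kappa> assms(3)]] assms(2) by blast

lemma coeff_derivI:
  assumes "x \<in> fst \<kappa>" "(f has_derivative D) (at (snd \<kappa> x))"
    and "\<And>y. y \<in> snd \<kappa> ` fst \<kappa> \<Longrightarrow> \<alpha> \<kappa> (chart_inv \<kappa> y) ws = f y"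
  shows "coeff_deriv \<alpha> \<kappa> x ws = D"
proof -
  have "coeff_deriv \<alpha> \<kappa> x ws = frechet_derivative f (at (snd \<kappa> x))"
    unfolding coeff_deriv_def
    by (rule frechet_derivative_cong_open[OF complex_manifold_chart(1)[OF M \<kappa>]])
      (use assms in auto)
  then show ?thesis using frechet_derivative_at[OF assms(2)] by simp
qed

lemma has_derivative_fun_deriv:
  assumes "smooth_function M f" "x \<in> fst \<kappa>"
  shows "((\<lambda>y. f (chart_inv \<kappa> y)) has_derivative fun_deriv f \<kappa> x) (at (snd \<kappa> x))"
  unfolding fun_deriv_def
  using smooth_on_has_derivative[OF smooth_functionD[OF assms(1) \<kappa>]] assms(2) by blast

lemma linear_fun_deriv:
  assumes "smooth_function M f" "x \<in> fst \<kappa>"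
  shows "linear (fun_deriv f \<kappa> x)"
  using has_derivative_fun_deriv[OF assms] by (rule has_derivative_linear)

lemma fun_deriv_minus:
  assumes "smooth_function M f" "x \<in> fst \<kappa>"
  shows "fun_deriv (\<lambda>x. - f x) \<kappa> x v = - fun_deriv f \<kappa> x v"
  using frechet_derivative_at[OF has_derivative_minus[OF has_derivative_fun_deriv[OF assms]]]
  unfolding fun_deriv_def[of "\<lambda>x. - f x"] by metis

lemma fun_deriv_exp:
  assumes "smooth_function M f" "x \<in> fst \<kappa>"
  shows "fun_deriv (\<lambda>x. exp (f x)) \<kappa> x v = exp (f x) * fun_deriv f \<kappa> x v"
  using frechet_derivative_at[OF has_derivative_exp[OF has_derivative_fun_deriv[OF assms]]]
    chart_inv_chart[OF assms(2)]
  unfolding fun_deriv_def[of "\<lambda>x. exp (f x)"] by (metis mult.commute)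

lemma coeff_deriv_fun_form:
  assumes "smooth_function M f" "x \<in> fst \<kappa>"
  shows "coeff_deriv (fun_form f) \<kappa> x ws v = of_real (fun_deriv f \<kappa> x v)"
proof -
  have "coeff_deriv (fun_form f) \<kappa> x ws = (\<lambda>v. of_real (fun_deriv f \<kappa> x v))"
    by (rule coeff_derivI[OF assms(2) has_derivative_of_real[OF has_derivative_fun_deriv[OF assms]]])
      (simp add: fun_form_def)
  then show ?thesis by simp
qed

lemma ext_d_fun_form:
  assumes "smooth_function M f" "x \<in> fst \<kappa>"
  shows "ext_d (fun_form f) \<kappa> x [v] = of_real (fun_deriv f \<kappa> x v)"
  by (simp add: ext_d_one_form_arg coeff_deriv_fun_form[OF assms])

lemma dc_fun_form:
  assumes "smooth_function M f" "x \<in> fst \<kappa>"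
  shows "dc (fun_form f) \<kappa> x [v] = - of_real (fun_deriv f \<kappa> x (J v))"
  by (simp add: dc_def del_def delbar_def Let_def coeff_deriv_fun_form[OF assms] field_simps
      lessThan_Suc)

lemma ext_d_ext_d_fun_form:
  assumes f: "smooth_function M f" and x: "x \<in> fst \<kappa>"
  shows "ext_d (ext_d (fun_form f)) \<kappa> x [u, v] = 0"
proof -
  let ?S = "snd \<kappa> ` fst \<kappa>" and ?f = "\<lambda>y. f (chart_inv \<kappa> y)"
  have S: "open ?S" using complex_manifold_chart(1)[OF M \<kappa>] .
  have sm: "smooth_on ?S ?f" using f \<kappa> by (rule smooth_functionD)
  let ?H = "\<lambda>w. frechet_derivative (\<lambda>y. frechet_derivative ?f (at y) w) (at (snd \<kappa> x))"
  have "coeff_deriv (ext_d (fun_form f)) \<kappa> x [w] = (\<lambda>v. of_real (?H w v))" for w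
  proof (rule coeff_derivI[OF x])
    have "Ck_on (Suc (Suc 0)) ?S ?f" using sm unfolding smooth_on_def by blast
    then have "(\<lambda>y. frechet_derivative ?f (at y) w) differentiable (at (snd \<kappa> x))"
      using x by simp
    then show "((\<lambda>y. complex_of_real (frechet_derivative ?f (at y) w)) has_derivative
        (\<lambda>v. of_real (?H w v))) (at (snd \<kappa> x))"
      by (intro has_derivative_of_real) (simp add: frechet_derivative_works)
    fix y assume y: "y \<in> ?S"
    then have "snd \<kappa> (chart_inv \<kappa> y) = y" using chart_inv_chart by auto
    then show "ext_d (fun_form f) \<kappa> (chart_inv \<kappa> y) [w] = of_real (frechet_derivative ?f (at y) w)"
      using ext_d_fun_form[OF f chart_inv_mem[OF y]] by (simp add: fun_deriv_def)
  qed
  moreover have "?H v u = ?H u v"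
    using second_derivative_symmetric[OF S sm] x by blast
  ultimately show ?thesis by (simp add: ext_d_alt_sum alt_sum_Cons)
qed

lemma multilinear_alternating_coeff_deriv:
  assumes \<alpha>: "is_form M k \<alpha>" and x: "x \<in> fst \<kappa>"
  shows "multilinear_alternating k (\<lambda>ws. coeff_deriv \<alpha> \<kappa> x ws u)"
proof (rule multilinear_alternatingI)
  fix xs ys :: "'e list" assume len: "length xs + length ys + 1 = k"
  note lin = multilinear_alternating_linear[OF is_formD(1)[OF \<alpha> \<kappa> chart_inv_mem] len]
  have l: "length (xs @ v # ys) = k" for v using len by simp
  note D = has_derivative_coeff[OF \<alpha> x l]
  show "linear (\<lambda>v. coeff_deriv \<alpha> \<kappa> x (xs @ v # ys) u)"
  proof (rule linearI)
    fix a b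
    have "coeff_deriv \<alpha> \<kappa> x (xs @ (a + b) # ys)
        = (\<lambda>u. coeff_deriv \<alpha> \<kappa> x (xs @ a # ys) u + coeff_deriv \<alpha> \<kappa> x (xs @ b # ys) u)"
      by (rule coeff_derivI[OF x has_derivative_add[OF D D]]) (rule linear_add[OF lin])
    then show "coeff_deriv \<alpha> \<kappa> x (xs @ (a + b) # ys) u
        = coeff_deriv \<alpha> \<kappa> x (xs @ a # ys) u + coeff_deriv \<alpha> \<kappa> x (xs @ b # ys) u" by simp
  next
    fix r and a :: 'e
    have "coeff_deriv \<alpha> \<kappa> x (xs @ (r *\<^sub>R a) # ys)
        = (\<lambda>u. r *\<^sub>R coeff_deriv \<alpha> \<kappa> x (xs @ a # ys) u)"
      by (rule coeff_derivI[OF x has_derivative_scaleR_right[OF D]]) (rule linear_cmul[OF lin])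
    then show "coeff_deriv \<alpha> \<kappa> x (xs @ (r *\<^sub>R a) # ys) u
        = r *\<^sub>R coeff_deriv \<alpha> \<kappa> x (xs @ a # ys) u" by simp
  qed
next
  fix xs ys :: "'e list" and v assume len: "length xs + length ys + 2 = k"
  have "coeff_deriv \<alpha> \<kappa> x (xs @ v # v # ys) = (\<lambda>u. 0)"
    by (rule coeff_derivI[OF x has_derivative_const])
      (rule multilinear_alternating_adjacent[OF is_formD(1)[OF \<alpha> \<kappa> chart_inv_mem] len])
  then show "coeff_deriv \<alpha> \<kappa> x (xs @ v # v # ys) u = 0" by simp
qed

lemma coeff_deriv_fun_times:
  assumes f: "smooth_function M f" and \<alpha>: "is_form M k \<alpha>" and x: "x \<in> fst \<kappa>"
    and len: "length ws = k"
  shows "coeff_deriv (fun_times f \<alpha>) \<kappa> x ws u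
    = of_real (fun_deriv f \<kappa> x u) * \<alpha> \<kappa> x ws + of_real (f x) * coeff_deriv \<alpha> \<kappa> x ws u"
proof -
  note h = has_derivative_mult[OF has_derivative_of_real[OF has_derivative_fun_deriv[OF f x]]
      has_derivative_coeff[OF \<alpha> x len]]
  have "coeff_deriv (fun_times f \<alpha>) \<kappa> x ws = (\<lambda>u. of_real (f (chart_inv \<kappa> (snd \<kappa> x))) *
      coeff_deriv \<alpha> \<kappa> x ws u + of_real (fun_deriv f \<kappa> x u) * \<alpha> \<kappa> (chart_inv \<kappa> (snd \<kappa> x)) ws)"
    by (rule coeff_derivI[OF x h]) (simp add: fun_times_def)
  then show ?thesis by (simp add: chart_inv_chart[OF x])
qed

text \<open>Multiplication by \<open>e\<^sup>f\<close> intertwines \<open>d + df \<and>\<close> with \<open>d\<close>; this form of the product rule turns a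
  twisted closed section into a closed one and back.\<close>

lemma ext_d_exp_times:
  assumes f: "smooth_function M f" and e: "smooth_function M (\<lambda>x. exp (f x))"
    and \<alpha>: "is_form M k \<alpha>" and x: "x \<in> fst \<kappa>" and len: "length vs = Suc k"
  shows "ext_d (fun_times (\<lambda>x. exp (f x)) \<alpha>) \<kappa> x vs
    = of_real (exp (f x)) * (wedge 1 (ext_d (fun_form f)) \<alpha> \<kappa> x vs + ext_d \<alpha> \<kappa> x vs)"
proof -
  have "ext_d (fun_times (\<lambda>x. exp (f x)) \<alpha>) \<kappa> x vs
    = alt_sum (\<lambda>u ws. of_real (exp (f x)) *
        (ext_d (fun_form f) \<kappa> x [u] * \<alpha> \<kappa> x ws + coeff_deriv \<alpha> \<kappa> x ws u)) vs"
    unfolding ext_d_alt_sum[of "fun_times _ _"]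
  proof (rule alt_sum_cong)
    fix u and ws :: "'e list" assume "length ws + 1 = length vs"
    then have "length ws = k" using len by simp
    then show "coeff_deriv (fun_times (\<lambda>x. exp (f x)) \<alpha>) \<kappa> x ws u = of_real (exp (f x)) *
        (ext_d (fun_form f) \<kappa> x [u] * \<alpha> \<kappa> x ws + coeff_deriv \<alpha> \<kappa> x ws u)"
      by (simp add: coeff_deriv_fun_times[OF e \<alpha> x] ext_d_fun_form[OF f x] fun_deriv_exp[OF f x]
          algebra_simps)
  qed
  then show ?thesis
    by (simp only: alt_sum_mult alt_sum_add wedge_one_alt_sum ext_d_alt_sum[of \<alpha>])
qed

end

lemma smooth_function_cong:
  assumes "complex_manifold M" "smooth_function M f" "\<And>x. x \<in> points M \<Longrightarrow> f x = g x"
  shows "smooth_function M g"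
  unfolding smooth_function_def
proof
  fix \<kappa> assume \<kappa>: "\<kappa> \<in> atlas M"
  show "smooth_on (snd \<kappa> ` fst \<kappa>) (\<lambda>y. g (chart_inv \<kappa> y))"
  proof (rule smooth_on_cong[OF complex_manifold_chart(1)[OF assms(1) \<kappa>] smooth_functionD[OF assms(2) \<kappa>]])
    fix y assume "y \<in> snd \<kappa> ` fst \<kappa>"
    then have "chart_inv \<kappa> y \<in> points M"
      using chart_inv_mem[OF assms(1) \<kappa>] complex_manifold_chart(2)[OF assms(1) \<kappa>] by blast
    then show "f (chart_inv \<kappa> y) = g (chart_inv \<kappa> y)" by (rule assms(3))
  qed
qed

lemma smooth_function_minus:
  "complex_manifold M \<Longrightarrow> smooth_function M f \<Longrightarrow> smooth_function M (\<lambda>x. - f x)"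
  unfolding smooth_function_def
  using complex_manifold_chart(1) smooth_on_linear[OF _ bounded_linear_minus[OF bounded_linear_ident]]
  by blast

lemma smooth_function_exp:
  "complex_manifold M \<Longrightarrow> smooth_function M f \<Longrightarrow> smooth_function M (\<lambda>x. exp (f x))"
  unfolding smooth_function_def using complex_manifold_chart(1) smooth_on_exp by blast

lemma is_form_fun_times:
  assumes "complex_manifold M" "smooth_function M f" "is_form M k \<alpha>"
  shows "is_form M k (fun_times f \<alpha>)"
  unfolding is_form_def
proof (intro conjI ballI allI impI)
  fix \<kappa> x assume "\<kappa> \<in> atlas M" "x \<in> fst \<kappa>"
  then have a: "multilinear_alternating k (\<alpha> \<kappa> x)" by (rule is_formD(1)[OF assms(3)])
  show "multilinear_alternating k (fun_times f \<alpha> \<kappa> x)"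
    unfolding fun_times_def
  proof (rule multilinear_alternatingI)
    fix xs ys :: "'b list" assume "length xs + length ys + 1 = k"
    from multilinear_alternating_linear[OF a this]
    show "linear (\<lambda>v. of_real (f x) * \<alpha> \<kappa> x (xs @ v # ys))" by (simp add: linear_iff algebra_simps)
  qed (simp add: multilinear_alternating_adjacent[OF a])
next
  fix \<kappa> and vs :: "'b list" assume "\<kappa> \<in> atlas M" "length vs = k"
  then show "smooth_on (snd \<kappa> ` fst \<kappa>) (\<lambda>y. fun_times f \<alpha> \<kappa> (chart_inv \<kappa> y) vs)"
    unfolding fun_times_def
    by (intro smooth_on_mult smooth_on_linear[OF _ bounded_linear_of_real]
        complex_manifold_chart(1)[OF assms(1)] smooth_functionD[OF assms(2)] is_formD(2)[OF assms(3)])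
next
  fix \<kappa> \<mu> x and vs :: "'b list"
  assume "\<kappa> \<in> atlas M" "\<mu> \<in> atlas M" "x \<in> fst \<kappa> \<inter> fst \<mu>" "length vs = k"
  then have "\<alpha> \<kappa> x vs = \<alpha> \<mu> x (map (tangent_map \<kappa> \<mu> (\<lambda>x. x) x) vs)"
    by (intro is_formD(3)[OF assms(3)]) auto
  then show "fun_times f \<alpha> \<kappa> x vs = fun_times f \<alpha> \<mu> x (map (tangent_map \<kappa> \<mu> (\<lambda>x. x) x) vs)"
    by (simp add: fun_times_def)
qed

lemma is_form_const_times:
  fixes \<alpha> :: "('x, 'e::complex_model_space, complex) form"
  assumes M: "complex_manifold M" and \<alpha>: "is_form M k \<alpha>"
  shows "is_form M k (\<lambda>\<kappa> x vs. a * \<alpha> \<kappa> x vs)"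
  unfolding is_form_def
proof (intro conjI ballI allI impI)
  fix \<kappa> x assume "\<kappa> \<in> atlas M" "x \<in> fst \<kappa>"
  then have f: "multilinear_alternating k (\<alpha> \<kappa> x)" by (rule is_formD(1)[OF \<alpha>])
  show "multilinear_alternating k (\<lambda>vs. a * \<alpha> \<kappa> x vs)"
  proof (rule multilinear_alternatingI)
    fix xs ys :: "'e list" assume "length xs + length ys + 1 = k"
    from multilinear_alternating_linear[OF f this]
    show "linear (\<lambda>v. a * \<alpha> \<kappa> x (xs @ v # ys))" by (simp add: linear_iff algebra_simps)
  qed (simp add: multilinear_alternating_adjacent[OF f])
next
  fix \<kappa> and vs :: "'e list" assume "\<kappa> \<in> atlas M" "length vs = k"
  then show "smooth_on (snd \<kappa> ` fst \<kappa>) (\<lambda>y. a * \<alpha> \<kappa> (chart_inv \<kappa> y) vs)"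
    by (intro smooth_on_mult smooth_on_const complex_manifold_chart(1)[OF M] is_formD(2)[OF \<alpha>])
next
  fix \<kappa> \<mu> x and vs :: "'e list"
  assume "\<kappa> \<in> atlas M" "\<mu> \<in> atlas M" "x \<in> fst \<kappa> \<inter> fst \<mu>" "length vs = k"
  then have "\<alpha> \<kappa> x vs = \<alpha> \<mu> x (map (tangent_map \<kappa> \<mu> (\<lambda>x. x) x) vs)"
    by (intro is_formD(3)[OF \<alpha>]) auto
  then show "a * \<alpha> \<kappa> x vs = a * \<alpha> \<mu> x (map (tangent_map \<kappa> \<mu> (\<lambda>x. x) x) vs)" by simp
qed

lemma is_form_cnj:
  assumes "complex_manifold M" "is_form M k \<alpha>"
  shows "is_form M k (form_cnj \<alpha>)"
  unfolding is_form_def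
proof (intro conjI ballI allI impI)
  fix \<kappa> x assume "\<kappa> \<in> atlas M" "x \<in> fst \<kappa>"
  then have a: "multilinear_alternating k (\<alpha> \<kappa> x)" by (rule is_formD(1)[OF assms(2)])
  show "multilinear_alternating k (form_cnj \<alpha> \<kappa> x)"
    unfolding form_cnj_def
  proof (rule multilinear_alternatingI)
    fix xs ys :: "'b list" assume "length xs + length ys + 1 = k"
    from multilinear_alternating_linear[OF a this]
    show "linear (\<lambda>v. cnj (\<alpha> \<kappa> x (xs @ v # ys)))" by (simp add: linear_iff)
  qed (simp add: multilinear_alternating_adjacent[OF a])
next
  fix \<kappa> and vs :: "'b list" assume "\<kappa> \<in> atlas M" "length vs = k"
  then show "smooth_on (snd \<kappa> ` fst \<kappa>) (\<lambda>y. form_cnj \<alpha> \<kappa> (chart_inv \<kappa> y) vs)"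
    unfolding form_cnj_def
    by (intro smooth_on_linear[OF _ bounded_linear_cnj]
        complex_manifold_chart(1)[OF assms(1)] is_formD(2)[OF assms(2)])
next
  fix \<kappa> \<mu> x and vs :: "'b list"
  assume "\<kappa> \<in> atlas M" "\<mu> \<in> atlas M" "x \<in> fst \<kappa> \<inter> fst \<mu>" "length vs = k"
  then have "\<alpha> \<kappa> x vs = \<alpha> \<mu> x (map (tangent_map \<kappa> \<mu> (\<lambda>x. x) x) vs)"
    by (intro is_formD(3)[OF assms(2)]) auto
  then show "form_cnj \<alpha> \<kappa> x vs = form_cnj \<alpha> \<mu> x (map (tangent_map \<kappa> \<mu> (\<lambda>x. x) x) vs)"
    by (simp add: form_cnj_def)
qed

lemma is_form_wedge:
  assumes M: "complex_manifold M" and \<alpha>: "is_form M p \<alpha>" and \<beta>: "is_form M q \<beta>"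
  shows "is_form M (p + q) (wedge p \<alpha> \<beta>)"
  unfolding is_form_def
proof (intro conjI ballI allI impI)
  fix \<kappa> x assume "\<kappa> \<in> atlas M" "x \<in> fst \<kappa>"
  then have "multilinear_alternating (p + q) (shuffle_product p (\<alpha> \<kappa> x) (\<beta> \<kappa> x))"
    by (intro multilinear_alternating_shuffle_product is_formD(1)[OF \<alpha>] is_formD(1)[OF \<beta>])
  moreover have "wedge p \<alpha> \<beta> \<kappa> x = shuffle_product p (\<alpha> \<kappa> x) (\<beta> \<kappa> x)"
    by (rule ext) (rule wedge_eq_shuffle_product)
  ultimately show "multilinear_alternating (p + q) (wedge p \<alpha> \<beta> \<kappa> x)" by simp
next
  fix \<kappa> and vs :: "'b list" assume \<kappa>: "\<kappa> \<in> atlas M" and len: "length vs = p + q"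
  have "smooth_on (snd \<kappa> ` fst \<kappa>) (\<lambda>y. shuffle_sign I *\<^sub>R
      (\<alpha> \<kappa> (chart_inv \<kappa> y) (nths vs I) * \<beta> \<kappa> (chart_inv \<kappa> y) (nths vs (- I))))"
    if "I \<subseteq> {..<length vs} \<and> card I = p" for I
    using that len
    by (intro smooth_on_linear[OF _ bounded_linear_scaleR_right] smooth_on_mult
        complex_manifold_chart(1)[OF M \<kappa>] is_formD(2)[OF \<alpha> \<kappa>] is_formD(2)[OF \<beta> \<kappa>])
      (auto simp: length_nths_subset)
  then show "smooth_on (snd \<kappa> ` fst \<kappa>) (\<lambda>y. wedge p \<alpha> \<beta> \<kappa> (chart_inv \<kappa> y) vs)"
    unfolding wedge_eq_shuffle_product shuffle_product_def
    by (intro smooth_on_sum complex_manifold_chart(1)[OF M \<kappa>]) blast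
next
  fix \<kappa> \<mu> x and vs :: "'b list"
  assume *: "\<kappa> \<in> atlas M" "\<mu> \<in> atlas M" "x \<in> fst \<kappa> \<inter> fst \<mu>" "length vs = p + q"
  let ?T = "tangent_map \<kappa> \<mu> (\<lambda>x. x) x"
  have "\<alpha> \<kappa> x ws = \<alpha> \<mu> x (map ?T ws)" if "length ws = p" for ws
    using * that by (intro is_formD(3)[OF \<alpha>]) auto
  moreover have "\<beta> \<kappa> x ws = \<beta> \<mu> x (map ?T ws)" if "length ws = q" for ws
    using * that by (intro is_formD(3)[OF \<beta>]) auto
  ultimately show "wedge p \<alpha> \<beta> \<kappa> x vs = wedge p \<alpha> \<beta> \<mu> x (map ?T vs)"
    unfolding wedge_eq_shuffle_product shuffle_product_def
    using *(4) by (intro sum.cong) (auto simp: nths_map length_nths_subset)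
qed

lemma is_form_wedge_power:
  assumes M: "complex_manifold M" and \<omega>: "is_form M 2 \<omega>"
  shows "is_form M (2 * k) (wedge_power \<omega> k)"
proof (induction k)
  case 0
  then show ?case by (auto simp: is_form_def multilinear_alternating_def smooth_on_const)
next
  case (Suc k)
  then show ?case using is_form_wedge[OF M \<omega> Suc] by simp
qed


section \<open>Closed and holomorphic sections of the canonical bundle\<close>

text \<open>Complex homogeneity in a slot, restated for lists split at that slot.\<close>

lemma canonical_section_type_n0:
  fixes \<Psi> :: "('x, complex ^ 'n, complex) form"
  assumes "canonical_section X \<Psi>" "\<kappa> \<in> atlas X" "x \<in> fst \<kappa>"
  shows "type_n0 CARD('n) (\<Psi> \<kappa> x)"
  unfolding type_n0_def
proof (intro conjI allI impI)
  show "multilinear_alternating CARD('n) (\<Psi> \<kappa> x)"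
    using assms unfolding canonical_section_def is_form_def by blast
  fix xs ys :: "(complex ^ 'n) list" and z v assume "length xs + length ys + 1 = CARD('n)"
  then have "length (xs @ v # ys) = CARD('n) \<and> length xs < CARD('n)" by simp
  then have "\<Psi> \<kappa> x ((xs @ v # ys)[length xs := z *\<^sub>\<C> ((xs @ v # ys) ! length xs)])
      = z * \<Psi> \<kappa> x (xs @ v # ys)"
    using assms unfolding canonical_section_def by blast
  then show "\<Psi> \<kappa> x (xs @ (z *\<^sub>\<C> v) # ys) = z * \<Psi> \<kappa> x (xs @ v # ys)" by simp
qed

lemma canonical_section_fun_times:
  assumes "complex_manifold X" "smooth_function X f" "canonical_section X \<Psi>"
  shows "canonical_section X (fun_times f \<Psi>)"
  using assms is_form_fun_times[OF assms(1,2)]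
  unfolding canonical_section_def by (auto simp: fun_times_def)

lemma coeff_deriv_homogeneous:
  fixes \<Psi> :: "('x, complex ^ 'n, complex) form"
  assumes X: "complex_manifold X" and \<Psi>: "canonical_section X \<Psi>"
    and \<kappa>: "\<kappa> \<in> atlas X" and x: "x \<in> fst \<kappa>"
    and len: "length xs + length ys + 1 = CARD('n)"
  shows "coeff_deriv \<Psi> \<kappa> x (xs @ (z *\<^sub>\<C> v) # ys) u = z * coeff_deriv \<Psi> \<kappa> x (xs @ v # ys) u"
proof -
  have form: "is_form X CARD('n) \<Psi>" using \<Psi> by (simp add: canonical_section_def)
  have l: "length (xs @ v # ys) = CARD('n)" using len by simp
  have "coeff_deriv \<Psi> \<kappa> x (xs @ (z *\<^sub>\<C> v) # ys) = (\<lambda>u. z * coeff_deriv \<Psi> \<kappa> x (xs @ v # ys) u)"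
  proof (rule coeff_derivI[OF X \<kappa> x has_derivative_mult_right[OF has_derivative_coeff[OF X \<kappa> form x l]]])
    fix y assume "y \<in> snd \<kappa> ` fst \<kappa>"
    then have "type_n0 CARD('n) (\<Psi> \<kappa> (chart_inv \<kappa> y))"
      by (intro canonical_section_type_n0[OF \<Psi> \<kappa>] chart_inv_mem[OF X \<kappa>])
    then show "\<Psi> \<kappa> (chart_inv \<kappa> y) (xs @ (z *\<^sub>\<C> v) # ys) = z * \<Psi> \<kappa> (chart_inv \<kappa> y) (xs @ v # ys)"
      using len unfolding type_n0_def by blast
  qed
  then show ?thesis by simp
qed

text \<open>For a section \<open>\<Psi>\<close> of the canonical bundle, all but one term of \<open>d\<Psi>(Jv, \<dots>) - i d\<Psi>(v, \<dots>)\<close> cancel, and the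
  remaining one is the failure of the Cauchy--Riemann equation in the direction \<open>v\<close>.\<close>

lemma closed_imp_holomorphic:
  fixes \<Psi> :: "('x, complex ^ 'n, complex) form"
  assumes X: "complex_manifold X" and \<Psi>: "canonical_section X \<Psi>" and \<kappa>: "\<kappa> \<in> atlas X"
    and closed: "\<And>x vs. x \<in> fst \<kappa> \<Longrightarrow> length vs = Suc CARD('n) \<Longrightarrow> ext_d \<Psi> \<kappa> x vs = 0"
    and len: "length ws = CARD('n)"
  shows "holo_on (snd \<kappa> ` fst \<kappa>) (\<lambda>y. \<Psi> \<kappa> (chart_inv \<kappa> y) ws)"
  unfolding holo_on_def
proof
  fix y assume "y \<in> snd \<kappa> ` fst \<kappa>"
  then obtain x where x: "x \<in> fst \<kappa>" "y = snd \<kappa> x" by blast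
  have form: "is_form X CARD('n) \<Psi>" using \<Psi> by (simp add: canonical_section_def)
  let ?D = "coeff_deriv \<Psi> \<kappa> x ws"
  have D: "((\<lambda>y. \<Psi> \<kappa> (chart_inv \<kappa> y) ws) has_derivative ?D) (at y)"
    using has_derivative_coeff[OF X \<kappa> form x(1) len] x(2) by simp
  have lin: "linear ?D" using D by (rule has_derivative_linear)
  have J: "?D (J v) = \<i> * ?D v" for v
  proof -
    have "alt_sum (\<lambda>u us. coeff_deriv \<Psi> \<kappa> x (J v # us) u) ws
        = alt_sum (\<lambda>u us. \<i> * coeff_deriv \<Psi> \<kappa> x (v # us) u) ws"
      using coeff_deriv_homogeneous[OF X \<Psi> \<kappa> x(1), of "[]"] len by (intro alt_sum_cong) auto
    then have "ext_d \<Psi> \<kappa> x (J v # ws) - \<i> * ext_d \<Psi> \<kappa> x (v # ws) = ?D (J v) - \<i> * ?D v"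
      by (simp add: ext_d_alt_sum alt_sum_Cons alt_sum_mult algebra_simps)
    then show ?thesis using closed[OF x(1)] len by simp
  qed
  have "?D (z *\<^sub>\<C> v) = z * ?D v" for z v
  proof -
    have "?D (z *\<^sub>\<C> v) = Re z *\<^sub>R ?D v + Im z *\<^sub>R ?D (J v)"
      unfolding cscale_Complex[of z v] by (simp only: linear_add[OF lin] linear_cmul[OF lin])
    also have "\<dots> = (of_real (Re z) + \<i> * of_real (Im z)) * ?D v"
      by (simp add: J scaleR_conv_of_real algebra_simps)
    finally show ?thesis by (simp flip: complex_eq)
  qed
  then have "complex_linear ?D"
    using linear_add[OF lin] by (simp add: complex_linear_def cscale_complex_def)
  with D show "\<exists>L. ((\<lambda>y. \<Psi> \<kappa> (chart_inv \<kappa> y) ws) has_derivative L) (at y) \<and> complex_linear L"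
    by blast
qed

text \<open>The exterior derivative of a holomorphic \<open>(n,0)\<close>-form is alternating and complex multilinear
  in \<open>n + 1\<close> vectors of an \<open>n\<close>-dimensional space.\<close>

lemma holomorphic_imp_closed:
  fixes \<Omega> :: "('x, complex ^ 'n, complex) form"
  assumes X: "complex_manifold X" and \<Omega>: "holomorphic_volume_form X \<Omega>" and \<kappa>: "\<kappa> \<in> atlas X"
    and x: "x \<in> fst \<kappa>" and len: "length vs = Suc CARD('n)"
  shows "ext_d \<Omega> \<kappa> x vs = 0"
proof -
  have can: "canonical_section X \<Omega>" using \<Omega> by (simp add: holomorphic_volume_form_def)
  then have form: "is_form X CARD('n) \<Omega>" by (simp add: canonical_section_def)
  have cl: "complex_linear (coeff_deriv \<Omega> \<kappa> x ws)" if ws: "length ws = CARD('n)" for ws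
  proof -
    have "holo_on (snd \<kappa> ` fst \<kappa>) (\<lambda>y. \<Omega> \<kappa> (chart_inv \<kappa> y) ws)"
      using \<Omega> \<kappa> ws unfolding holomorphic_volume_form_def by blast
    then obtain L where "((\<lambda>y. \<Omega> \<kappa> (chart_inv \<kappa> y) ws) has_derivative L) (at (snd \<kappa> x))"
      "complex_linear L" using x unfolding holo_on_def by blast
    then show ?thesis using coeff_derivI[OF X \<kappa> x] by metis
  qed
  show ?thesis
    unfolding ext_d_alt_sum
  proof (rule complex_multilinear_eq_0[OF _ _ _ len])
    show "multilinear_alternating (Suc CARD('n)) (alt_sum (\<lambda>u ws. coeff_deriv \<Omega> \<kappa> x ws u))"
    proof (rule multilinear_alternating_alt_sum)
      show "linear (\<lambda>u. coeff_deriv \<Omega> \<kappa> x ws u)" if "length ws = CARD('n)" for ws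
        using has_derivative_coeff[OF X \<kappa> form x that] by (rule has_derivative_linear)
    qed (rule multilinear_alternating_coeff_deriv[OF X \<kappa> form x])
    show "alt_sum (\<lambda>u ws. coeff_deriv \<Omega> \<kappa> x ws u) (xs @ (z *\<^sub>\<C> v) # ys)
        = z * alt_sum (\<lambda>u ws. coeff_deriv \<Omega> \<kappa> x ws u) (xs @ v # ys)"
      if "length xs + length ys + 1 = Suc CARD('n)" for xs ys z v
      using that cl
      by (intro alt_sum_homogeneous[of "CARD('n)"] coeff_deriv_homogeneous[OF X can \<kappa> x])
        (auto simp: complex_linear_def cscale_complex_def)
  qed simp
qed

section \<open>The norm of a section of the canonical bundle\<close>

text \<open>The right-hand side of the equation that defines \<open>\<parallel>\<Psi>\<parallel>\<^sup>2\<close>.\<close>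

definition norm_density ::
  "('x, complex ^ 'n, complex) form \<Rightarrow> ('x, complex ^ 'n, complex) form" where
  "norm_density \<Psi> = (\<lambda>\<kappa> x vs. (- 1) ^ (CARD('n) * (CARD('n) - 1) div 2) * \<i> ^ CARD('n) *
     wedge CARD('n) \<Psi> (form_cnj \<Psi>) \<kappa> x vs)"

lemma hermitian_form_at:
  assumes "hermitian_form X \<omega>" "\<kappa> \<in> atlas X" "x \<in> fst \<kappa>"
  shows "hermitian_at (\<omega> \<kappa> x)"
  using assms unfolding hermitian_form_def hermitian_at_def is_form_def by blast

lemma is_form_norm_density:
  fixes \<Psi> :: "('x, complex ^ 'n, complex) form"
  assumes "complex_manifold X" "is_form X CARD('n) \<Psi>"
  shows "is_form X (2 * CARD('n)) (norm_density \<Psi>)"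
  unfolding norm_density_def mult_2
  by (intro is_form_const_times is_form_wedge is_form_cnj assms)

lemma is_form_vol_form:
  fixes \<omega> :: "('x, complex ^ 'n, complex) form"
  assumes "complex_manifold X" "is_form X 2 \<omega>"
  shows "is_form X (2 * CARD('n)) (vol_form \<omega>)"
  using is_form_const_times[OF assms(1) is_form_wedge_power[OF assms], where a = "inverse (fact CARD('n) :: complex)"]
  by (simp add: vol_form_def divide_inverse mult.commute)

context
  fixes X :: "('x, complex ^ 'n) cmanifold" and \<omega> :: "('x, complex ^ 'n, complex) form"
  assumes X: "complex_manifold X" and \<omega>: "hermitian_form X \<omega>"
begin

lemma vol_form_form: "is_form X (2 * CARD('n)) (vol_form \<omega>)"
  using is_form_vol_form[OF X] \<omega> by (simp add: hermitian_form_def)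

lemma vol_form_unitary:
  assumes "unitary (\<omega> \<kappa> x) es" "length es = CARD('n)"
  shows "vol_form \<omega> \<kappa> x (real_frame es) = 1"
  using form_power_unitary[OF assms(1)] assms(2)
  by (simp add: vol_form_def wedge_power_eq_form_power)

lemma unitary_frame_exists:
  assumes "\<kappa> \<in> atlas X" "x \<in> fst \<kappa>"
  obtains es where "length es = CARD('n)" "unitary (\<omega> \<kappa> x) es"
  using unitary_basis_exists[OF hermitian_form_at[OF \<omega> assms]] by blast

lemma norm_density_real_frame:
  assumes "canonical_section X \<Psi>" "\<kappa> \<in> atlas X" "x \<in> fst \<kappa>" "length vs = CARD('n)"
  shows "norm_density \<Psi> \<kappa> x (real_frame vs) = of_real (2 ^ CARD('n) * (cmod (\<Psi> \<kappa> x vs))\<^sup>2)"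
proof -
  have "form_cnj \<Psi> \<kappa> x = (\<lambda>vs. cnj (\<Psi> \<kappa> x vs))" by (simp add: form_cnj_def)
  then show ?thesis
    using volume_density_real_frame[OF canonical_section_type_n0[OF assms(1-3)] assms(4)]
    by (simp add: norm_density_def wedge_eq_shuffle_product)
qed

text \<open>The norm is well defined: top forms are proportional, the volume form is \<open>1\<close> on a unitary
  frame, and there the density is nonnegative. The transformation law of forms carries the defining
  equation from one chart to all others.\<close>

lemma
  assumes \<Psi>: "canonical_section X \<Psi>" and \<kappa>: "\<kappa> \<in> atlas X" "x \<in> fst \<kappa>"
  shows vol_norm_unitary: "length es = CARD('n) \<Longrightarrow> unitary (\<omega> \<kappa> x) es \<Longrightarrow>
      vol_norm X \<omega> \<Psi> x = sqrt (2 ^ CARD('n)) * cmod (\<Psi> \<kappa> x es)"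
    and vol_norm_density: "length vs = 2 * CARD('n) \<Longrightarrow>
      of_real ((vol_norm X \<omega> \<Psi> x)\<^sup>2) * vol_form \<omega> \<kappa> x vs = norm_density \<Psi> \<kappa> x vs"
proof -
  have form: "is_form X (2 * CARD('n)) (norm_density \<Psi>)"
    using is_form_norm_density[OF X] \<Psi> by (simp add: canonical_section_def)
  define P where "P r \<longleftrightarrow> 0 \<le> r \<and> (\<forall>\<mu>\<in>atlas X. x \<in> fst \<mu> \<longrightarrow>
      (\<forall>vs. length vs = 2 * CARD('n) \<longrightarrow>
        of_real (r\<^sup>2) * vol_form \<omega> \<mu> x vs = norm_density \<Psi> \<mu> x vs))" for r :: real
  have vol: "vol_norm X \<omega> \<Psi> x = (THE r. P r)"
    by (simp add: vol_norm_def P_def norm_density_def vol_form_def)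
  define r where "r es = sqrt (2 ^ CARD('n)) * cmod (\<Psi> \<kappa> x es)" for es
  have density: "norm_density \<Psi> \<kappa> x (real_frame es) = of_real ((r es)\<^sup>2)"
    if "length es = CARD('n)" for es
    using norm_density_real_frame[OF \<Psi> \<kappa> that] by (simp add: r_def power_mult_distrib)
  have P: "P (r es)" if es: "length es = CARD('n)" "unitary (\<omega> \<kappa> x) es" for es
    unfolding P_def
  proof (intro conjI ballI allI impI)
    fix \<mu> and vs :: "(complex ^ 'n) list"
    assume \<mu>: "\<mu> \<in> atlas X" "x \<in> fst \<mu>" and len: "length vs = 2 * CARD('n)"
    define ws where "ws = map (tangent_map \<mu> \<kappa> (\<lambda>x. x) x) vs"
    have ws: "length ws = DIM(complex ^ 'n)" using len by (simp add: ws_def)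
    have "multilinear_alternating DIM(complex ^ 'n) (norm_density \<Psi> \<kappa> x)"
      "multilinear_alternating DIM(complex ^ 'n) (vol_form \<omega> \<kappa> x)"
      using is_formD(1)[OF form \<kappa>] is_formD(1)[OF vol_form_form \<kappa>] by (simp_all add: mult.commute)
    from top_forms_proportional[OF this ws, of "real_frame es"]
    have "norm_density \<Psi> \<kappa> x ws = of_real ((r es)\<^sup>2) * vol_form \<omega> \<kappa> x ws"
      using es by (simp add: vol_form_unitary density mult.commute)
    then show "of_real ((r es)\<^sup>2) * vol_form \<omega> \<mu> x vs = norm_density \<Psi> \<mu> x vs"
      using is_formD(3)[OF form \<mu>(1) \<kappa>(1) \<mu>(2) \<kappa>(2) len]
        is_formD(3)[OF vol_form_form \<mu>(1) \<kappa>(1) \<mu>(2) \<kappa>(2) len]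
      by (simp add: ws_def)
  qed (simp add: r_def)
  have uniq: "s = r es" if "P s" and es: "length es = CARD('n)" "unitary (\<omega> \<kappa> x) es" for s es
  proof -
    have "of_real (s\<^sup>2) * vol_form \<omega> \<kappa> x (real_frame es) = norm_density \<Psi> \<kappa> x (real_frame es)"
      using \<open>P s\<close> \<kappa> es(1) unfolding P_def by simp
    then have "s\<^sup>2 = (r es)\<^sup>2"
      using es by (simp only: vol_form_unitary density mult_1_right of_real_eq_iff)
    then show ?thesis using \<open>P s\<close> by (simp add: P_def r_def power2_eq_iff_nonneg)
  qed
  have norm: "vol_norm X \<omega> \<Psi> x = r es" if "length es = CARD('n)" "unitary (\<omega> \<kappa> x) es" for es
    unfolding vol using P[OF that] uniq[OF _ that] by (rule the_equality)
  then show "length es = CARD('n) \<Longrightarrow> unitary (\<omega> \<kappa> x) es \<Longrightarrow>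
      vol_norm X \<omega> \<Psi> x = sqrt (2 ^ CARD('n)) * cmod (\<Psi> \<kappa> x es)" by (simp add: r_def)
  obtain es where "length es = CARD('n)" "unitary (\<omega> \<kappa> x) es" using unitary_frame_exists[OF \<kappa>] .
  then have "P (vol_norm X \<omega> \<Psi> x)" using P norm by simp
  then show "length vs = 2 * CARD('n) \<Longrightarrow>
      of_real ((vol_norm X \<omega> \<Psi> x)\<^sup>2) * vol_form \<omega> \<kappa> x vs = norm_density \<Psi> \<kappa> x vs"
    using \<kappa> unfolding P_def by blast
qed

lemma vol_norm_nonneg:
  assumes "canonical_section X \<Psi>" "x \<in> points X"
  shows "0 \<le> vol_norm X \<omega> \<Psi> x"
proof -
  obtain \<kappa> where \<kappa>: "\<kappa> \<in> atlas X" "x \<in> fst \<kappa>" using complex_manifold_covered[OF X assms(2)] .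
  obtain es where "length es = CARD('n)" "unitary (\<omega> \<kappa> x) es" using unitary_frame_exists[OF \<kappa>] .
  then show ?thesis using vol_norm_unitary[OF assms(1) \<kappa>] by simp
qed

lemma vol_norm_fun_times:
  assumes \<Psi>: "canonical_section X \<Psi>" and f: "smooth_function X f" and x: "x \<in> points X"
  shows "vol_norm X \<omega> (fun_times f \<Psi>) x = \<bar>f x\<bar> * vol_norm X \<omega> \<Psi> x"
proof -
  obtain \<kappa> where \<kappa>: "\<kappa> \<in> atlas X" "x \<in> fst \<kappa>" using complex_manifold_covered[OF X x] .
  obtain es where "length es = CARD('n)" "unitary (\<omega> \<kappa> x) es" using unitary_frame_exists[OF \<kappa>] .
  then show ?thesis
    using vol_norm_unitary[OF \<Psi> \<kappa>] vol_norm_unitary[OF canonical_section_fun_times[OF X f \<Psi>] \<kappa>]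
    by (simp add: fun_times_def norm_mult)
qed

lemma vol_norm_pos_iff:
  assumes \<Psi>: "canonical_section X \<Psi>" and \<kappa>: "\<kappa> \<in> atlas X" "x \<in> fst \<kappa>"
  shows "0 < vol_norm X \<omega> \<Psi> x \<longleftrightarrow> (\<exists>vs. length vs = CARD('n) \<and> \<Psi> \<kappa> x vs \<noteq> 0)"
proof
  obtain es where "length es = CARD('n)" "unitary (\<omega> \<kappa> x) es" using unitary_frame_exists[OF \<kappa>] .
  moreover assume "0 < vol_norm X \<omega> \<Psi> x"
  ultimately show "\<exists>vs. length vs = CARD('n) \<and> \<Psi> \<kappa> x vs \<noteq> 0"
    using vol_norm_unitary[OF \<Psi> \<kappa>] by (intro exI[of _ es]) auto
next
  assume "\<exists>vs. length vs = CARD('n) \<and> \<Psi> \<kappa> x vs \<noteq> 0"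
  then obtain vs where vs: "length vs = CARD('n)" "\<Psi> \<kappa> x vs \<noteq> 0" by blast
  then have "norm_density \<Psi> \<kappa> x (real_frame vs) \<noteq> 0"
    by (simp add: norm_density_real_frame[OF \<Psi> \<kappa>])
  then have "vol_norm X \<omega> \<Psi> x \<noteq> 0"
    using vol_norm_density[OF \<Psi> \<kappa>, of "real_frame vs"] vs(1) by auto
  moreover have "x \<in> points X" using \<kappa> complex_manifold_chart(2)[OF X \<kappa>(1)] by blast
  ultimately show "0 < vol_norm X \<omega> \<Psi> x" using vol_norm_nonneg[OF \<Psi>] by (simp add: less_le)
qed

text \<open>In a chart, \<open>\<parallel>\<Psi>\<parallel>\<^sup>2\<close> is the quotient of the components of two top forms on a constant basis;
  unlike a unitary frame, this basis depends smoothly on the point.\<close>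

lemma smooth_ln_vol_norm:
  assumes \<Psi>: "canonical_section X \<Psi>" and pos: "\<And>x. x \<in> points X \<Longrightarrow> 0 < vol_norm X \<omega> \<Psi> x"
  shows "smooth_function X (\<lambda>x. ln (vol_norm X \<omega> \<Psi> x))"
  unfolding smooth_function_def
proof
  fix \<kappa> assume \<kappa>: "\<kappa> \<in> atlas X"
  let ?S = "snd \<kappa> ` fst \<kappa>"
  have S: "open ?S" using complex_manifold_chart(1)[OF X \<kappa>] .
  obtain bs :: "(complex ^ 'n) list" where bs: "set bs = Basis" "distinct bs"
    using finite_distinct_list[OF finite_Basis] by blast
  have "length bs = DIM(complex ^ 'n)" using bs by (metis distinct_card)
  then have lbs: "length bs = 2 * CARD('n)" by simp
  define a b where "a y = norm_density \<Psi> \<kappa> (chart_inv \<kappa> y) bs"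
    and "b y = vol_form \<omega> \<kappa> (chart_inv \<kappa> y) bs" for y
  \<comment> \<open>Multiplying by the conjugate of \<open>b\<close> makes both terms of the quotient real.\<close>
  define A B where "A y = Re (a y * cnj (b y))" and "B y = Re (b y * cnj (b y))" for y
  have form: "is_form X (2 * CARD('n)) (norm_density \<Psi>)"
    using is_form_norm_density[OF X] \<Psi> by (simp add: canonical_section_def)
  have sm: "smooth_on ?S A" "smooth_on ?S B"
    unfolding A_def B_def a_def b_def
    by (intro smooth_on_linear[OF S bounded_linear_Re] smooth_on_mult S
        smooth_on_linear[OF S bounded_linear_cnj] is_formD(2)[OF form \<kappa> lbs]
        is_formD(2)[OF vol_form_form \<kappa> lbs])+
  have quotient: "0 < B y \<and> A y = (vol_norm X \<omega> \<Psi> (chart_inv \<kappa> y))\<^sup>2 * B y" if "y \<in> ?S" for y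
  proof -
    let ?x = "chart_inv \<kappa> y"
    have x: "?x \<in> fst \<kappa>" using chart_inv_mem[OF X \<kappa> that] .
    have "b y \<noteq> 0"
    proof
      assume "b y = 0"
      obtain es where es: "length es = CARD('n)" "unitary (\<omega> \<kappa> ?x) es"
        using unitary_frame_exists[OF \<kappa> x] .
      have "vol_form \<omega> \<kappa> ?x (real_frame es) = 0"
        using top_form_eq_0[OF _ bs, of "vol_form \<omega> \<kappa> ?x" "real_frame es"]
          is_formD(1)[OF vol_form_form \<kappa> x] \<open>b y = 0\<close> es(1)
        by (simp add: b_def mult.commute)
      then show False using vol_form_unitary[OF es(2,1)] by simp
    qed
    have B: "of_real (B y) = b y * cnj (b y)"
      unfolding B_def by (simp add: complex_mult_cnj)
    have "a y = of_real ((vol_norm X \<omega> \<Psi> ?x)\<^sup>2) * b y"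
      unfolding a_def b_def using vol_norm_density[OF \<Psi> \<kappa> x lbs] by simp
    then have "a y * cnj (b y) = of_real ((vol_norm X \<omega> \<Psi> ?x)\<^sup>2 * B y)"
      by (simp add: B algebra_simps)
    then have "A y = (vol_norm X \<omega> \<Psi> ?x)\<^sup>2 * B y" unfolding A_def by (simp only: Re_complex_of_real)
    moreover have "0 < B y"
      using \<open>b y \<noteq> 0\<close> by (simp add: B_def complex_mult_cnj complex_neq_0)
    ultimately show ?thesis by blast
  qed
  have vpos: "0 < vol_norm X \<omega> \<Psi> (chart_inv \<kappa> y)" if "y \<in> ?S" for y
    using pos chart_inv_mem[OF X \<kappa> that] complex_manifold_chart(2)[OF X \<kappa>] by blast
  show "smooth_on ?S (\<lambda>y. ln (vol_norm X \<omega> \<Psi> (chart_inv \<kappa> y)))"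
  proof (rule smooth_on_cong[OF S])
    have "B y \<noteq> 0" "0 < A y * inverse (B y)" if "y \<in> ?S" for y
      using quotient[OF that] vpos[OF that] by (auto intro!: mult_pos_pos)
    then show "smooth_on ?S (\<lambda>y. 1 / 2 * ln (A y * inverse (B y)))"
      by (intro smooth_on_mult smooth_on_const smooth_on_ln smooth_on_inverse S sm) auto
    fix y assume y: "y \<in> ?S"
    then have "A y * inverse (B y) = (vol_norm X \<omega> \<Psi> (chart_inv \<kappa> y))\<^sup>2"
      using quotient[OF y] by (simp add: mult.assoc)
    then show "1 / 2 * ln (A y * inverse (B y)) = ln (vol_norm X \<omega> \<Psi> (chart_inv \<kappa> y))"
      using vpos[OF y] by (simp add: ln_realpow)
  qed
qed


section \<open>The Lee form\<close>

text \<open>The frame chosen in the definition of the Hodge star has the right length because orthonormal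
  frames exist.\<close>

lemma orthonormal_frame_SOME:
  assumes "\<kappa> \<in> atlas X" "x \<in> fst \<kappa>"
  shows "length (SOME E. orthonormal_frame \<omega> \<kappa> x E) = 2 * CARD('n)"
proof -
  obtain es where "length es = CARD('n)" "unitary (\<omega> \<kappa> x) es" using unitary_frame_exists[OF assms] .
  then have "orthonormal_frame \<omega> \<kappa> x (real_frame es)"
    using unitary_orthonormal[OF hermitian_form_at[OF \<omega> assms]] by (simp add: orthonormal_frame_def)
  then have "orthonormal_frame \<omega> \<kappa> x (SOME E. orthonormal_frame \<omega> \<kappa> x E)" by (rule someI)
  then show ?thesis by (simp add: orthonormal_frame_def)
qed

text \<open>A co-derivative in degree two is a Hodge star of a form of degree \<open>2n - 1\<close>, and its argument
  fills the last slot of the volume form. Oddness in that argument suffices to invert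
  \<open>\<theta> = Jd\<^sup>*\<omega>\<close> by means of \<open>J\<^sup>2 = -1\<close>.\<close>

lemma codiff_minus:
  assumes "\<kappa> \<in> atlas X" "x \<in> fst \<kappa>"
  shows "codiff \<omega> 2 \<alpha> \<kappa> x [- v] = - codiff \<omega> 2 \<alpha> \<kappa> x [v]"
proof -
  define E where "E = (SOME E. orthonormal_frame \<omega> \<kappa> x E)"
  have E: "length E = 2 * CARD('n)" unfolding E_def by (rule orthonormal_frame_SOME[OF assms])
  have "2 * CARD('n) - 2 + 1 = 2 * CARD('n) - 1" using zero_less_card_finite[where 'a = 'n] by linarith
  moreover have "vol_form \<omega> \<kappa> x (nths E I @ [- v]) = - vol_form \<omega> \<kappa> x (nths E I @ [v])"
    if "I \<subseteq> {..<2 * CARD('n)} \<and> card I = 2 * CARD('n) - 1" for I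
  proof -
    have "length (nths E I) + length [] + 1 = 2 * CARD('n)"
      using that E zero_less_card_finite[where 'a = 'n] by (simp add: length_nths_subset)
    from linear_neg[OF multilinear_alternating_linear[OF is_formD(1)[OF vol_form_form assms] this]]
    show ?thesis by simp
  qed
  ultimately show ?thesis
    unfolding codiff_def hodge_star_def Let_def
    by (simp add: sum_negf flip: E_def)
qed

lemma lee_form_J:
  assumes "\<kappa> \<in> atlas X" "x \<in> fst \<kappa>"
  shows "lee_form \<omega> \<kappa> x [J v] = codiff \<omega> 2 \<omega> \<kappa> x [v]"
  by (simp add: lee_form_def J_form_def codiff_minus[OF assms])

end


section \<open>Comparison of the two systems\<close>

lemma form_eq_oneI:
  "(\<And>\<kappa> x v. \<kappa> \<in> atlas M \<Longrightarrow> x \<in> fst \<kappa> \<Longrightarrow> \<alpha> \<kappa> x [v] = \<beta> \<kappa> x [v]) \<Longrightarrow> form_eq M 1 \<alpha> \<beta>"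
  by (auto simp: form_eq_def length_Suc_conv)


text \<open>The factor \<open>e\<^sup>-\<^sup>\<phi>\<close> turns \<open>d\<Psi> = d\<phi> \<and> \<Psi>\<close> into \<open>d\<Omega> = 0\<close>, which is holomorphy, and \<open>\<parallel>\<Omega>\<parallel> = e\<^sup>-\<^sup>\<phi>\<close>
  because \<open>\<parallel>\<Psi>\<parallel> = 1\<close>. So \<open>d\<^sup>c log \<parallel>\<Omega>\<parallel> = -J\<theta> = d\<^sup>*\<omega>\<close>.\<close>

lemma twisted_imp_hull_strominger:
  fixes X :: "('x, complex ^ 'n) cmanifold"
  assumes X: "complex_manifold X"
    and sol: "twisted_hull_strominger X G K c P \<Psi> \<omega> h"
    and \<phi>: "smooth_function X \<phi>" and exact: "form_eq X 1 (lee_form \<omega>) (ext_d (fun_form \<phi>))"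
  shows "holomorphic_volume_form X (fun_times (\<lambda>x. exp (- \<phi> x)) \<Psi>)"
    and "hull_strominger X (fun_times (\<lambda>x. exp (- \<phi> x)) \<Psi>) G K c P \<omega> h"
proof -
  let ?\<Omega> = "fun_times (\<lambda>x. exp (- \<phi> x)) \<Psi>"
  have \<Psi>: "canonical_section X \<Psi>" and \<omega>: "hermitian_form X \<omega>"
    and norm: "\<And>x. x \<in> points X \<Longrightarrow> vol_norm X \<omega> \<Psi> x = 1"
    using sol unfolding twisted_hull_strominger_def SU_structure_def by blast+
  have form: "is_form X CARD('n) \<Psi>" using \<Psi> by (simp add: canonical_section_def)
  note m = smooth_function_minus[OF X \<phi>]
  note e = smooth_function_exp[OF X m]
  have can: "canonical_section X ?\<Omega>" using canonical_section_fun_times[OF X e \<Psi>] .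
  have lee: "lee_form \<omega> \<kappa> x [v] = of_real (fun_deriv \<phi> \<kappa> x v)"
    if "\<kappa> \<in> atlas X" "x \<in> fst \<kappa>" for \<kappa> x v
    using exact that unfolding form_eq_def by (simp add: ext_d_fun_form[OF X that(1) \<phi> that(2)])
  have closed: "ext_d ?\<Omega> \<kappa> x vs = 0"
    if \<kappa>: "\<kappa> \<in> atlas X" and x: "x \<in> fst \<kappa>" and len: "length vs = Suc CARD('n)" for \<kappa> x vs
  proof -
    have "form_eq X (CARD('n) + 1) (form_minus (ext_d \<Psi>) (wedge 1 (lee_form \<omega>) \<Psi>)) form_zero"
      using sol unfolding twisted_hull_strominger_def by blast
    then have d\<Psi>: "ext_d \<Psi> \<kappa> x vs = wedge 1 (lee_form \<omega>) \<Psi> \<kappa> x vs"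
      using \<kappa> x len unfolding form_eq_def form_minus_def form_zero_def by simp
    have "wedge 1 (ext_d (fun_form (\<lambda>x. - \<phi> x))) \<Psi> \<kappa> x vs
        = alt_sum (\<lambda>u ws. - 1 * (lee_form \<omega> \<kappa> x [u] * \<Psi> \<kappa> x ws)) vs"
      unfolding wedge_one_alt_sum
      by (simp add: ext_d_fun_form[OF X \<kappa> m x] fun_deriv_minus[OF X \<kappa> \<phi> x] lee[OF \<kappa> x])
    also have "\<dots> = - wedge 1 (lee_form \<omega>) \<Psi> \<kappa> x vs"
      unfolding wedge_one_alt_sum alt_sum_mult by simp
    finally show ?thesis
      by (simp add: ext_d_exp_times[OF X \<kappa> m e form x len] d\<Psi>)
  qed
  have nonzero: "\<exists>vs. length vs = CARD('n) \<and> ?\<Omega> \<kappa> x vs \<noteq> 0"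
    if \<kappa>: "\<kappa> \<in> atlas X" "x \<in> fst \<kappa>" for \<kappa> x
  proof -
    have "x \<in> points X" using \<kappa> complex_manifold_chart(2)[OF X] by blast
    then have "0 < vol_norm X \<omega> \<Psi> x" using norm by simp
    then show ?thesis using vol_norm_pos_iff[OF X \<omega> \<Psi> \<kappa>] by (simp add: fun_times_def)
  qed
  show "holomorphic_volume_form X ?\<Omega>"
    unfolding holomorphic_volume_form_def
    using can nonzero closed_imp_holomorphic[OF X can _ closed] by blast
  have ln_norm: "ln (vol_norm X \<omega> ?\<Omega> x) = - \<phi> x" if "x \<in> points X" for x
    using vol_norm_fun_times[OF X \<omega> \<Psi> e that] norm[OF that] by simp
  have "form_eq X 1 (form_minus (codiff \<omega> 2 \<omega>)
      (dc (fun_form (\<lambda>x. ln (vol_norm X \<omega> ?\<Omega> x))))) form_zero"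
  proof (rule form_eq_oneI)
    fix \<kappa> x v assume \<kappa>: "\<kappa> \<in> atlas X" and x: "x \<in> fst \<kappa>"
    let ?L = "\<lambda>x. ln (vol_norm X \<omega> ?\<Omega> x)"
    have L: "?L x = - \<phi> x" if "x \<in> fst \<kappa>" for x
      using ln_norm complex_manifold_chart(2)[OF X \<kappa>] that by blast
    have "smooth_function X ?L" using smooth_function_cong[OF X m] ln_norm by simp
    then have "dc (fun_form ?L) \<kappa> x [v] = - of_real (fun_deriv ?L \<kappa> x (J v))"
      by (rule dc_fun_form[OF X \<kappa> _ x])
    also have "fun_deriv ?L \<kappa> x = fun_deriv (\<lambda>x. - \<phi> x) \<kappa> x"
      by (rule fun_deriv_cong[OF X \<kappa> x L])
    also have "- of_real (fun_deriv (\<lambda>x. - \<phi> x) \<kappa> x (J v)) = lee_form \<omega> \<kappa> x [J v]"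
      by (simp add: fun_deriv_minus[OF X \<kappa> \<phi> x] lee[OF \<kappa> x])
    also have "\<dots> = codiff \<omega> 2 \<omega> \<kappa> x [v]" by (rule lee_form_J[OF X \<omega> \<kappa> x])
    finally show "form_minus (codiff \<omega> 2 \<omega>) (dc (fun_form ?L)) \<kappa> x [v] = form_zero \<kappa> x [v]"
      by (simp add: form_minus_def form_zero_def)
  qed
  then show "hull_strominger X ?\<Omega> G K c P \<omega> h"
    using sol \<omega> unfolding hull_strominger_def twisted_hull_strominger_def by blast
qed

text \<open>Applying \<open>J\<close> to \<open>d\<^sup>*\<omega> = d\<^sup>c log \<parallel>\<Omega>\<parallel>\<close> gives \<open>\<theta> = dL\<close> for \<open>L = - log \<parallel>\<Omega>\<parallel>\<close>, so \<open>\<theta>\<close> is exact, and the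
  twisting identity for \<open>\<parallel>\<Omega>\<parallel>\<^sup>-\<^sup>1 = e\<^sup>L\<close> together with \<open>d\<Omega> = 0\<close> gives \<open>d\<Psi> = \<theta> \<and> \<Psi>\<close>.\<close>

lemma hull_strominger_imp_twisted:
  fixes X :: "('x, complex ^ 'n) cmanifold"
  assumes X: "complex_manifold X" and \<Omega>: "holomorphic_volume_form X \<Omega>"
    and sol: "hull_strominger X \<Omega> G K c P \<omega> h"
  shows "twisted_hull_strominger X G K c P (fun_times (\<lambda>x. inverse (vol_norm X \<omega> \<Omega> x)) \<Omega>) \<omega> h"
    and "derham_zero X (lee_form \<omega>)"
proof -
  let ?N = "\<lambda>x. inverse (vol_norm X \<omega> \<Omega> x)"
  let ?\<Psi> = "fun_times ?N \<Omega>"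
  have \<omega>: "hermitian_form X \<omega>" using sol by (simp add: hull_strominger_def)
  have can: "canonical_section X \<Omega>" using \<Omega> by (simp add: holomorphic_volume_form_def)
  have form: "is_form X CARD('n) \<Omega>" using can by (simp add: canonical_section_def)
  have pos: "0 < vol_norm X \<omega> \<Omega> x" if x: "x \<in> points X" for x
  proof -
    obtain \<kappa> where \<kappa>: "\<kappa> \<in> atlas X" "x \<in> fst \<kappa>" using complex_manifold_covered[OF X x] .
    then show ?thesis
      using \<Omega> vol_norm_pos_iff[OF X \<omega> can \<kappa>] unfolding holomorphic_volume_form_def by blast
  qed
  define L where "L = (\<lambda>x. - ln (vol_norm X \<omega> \<Omega> x))"
  note ln = smooth_ln_vol_norm[OF X \<omega> can pos]
  have L: "smooth_function X L" unfolding L_def by (rule smooth_function_minus[OF X ln])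
  note e = smooth_function_exp[OF X L]
  have exp_L: "exp (L x) = ?N x" if "x \<in> points X" for x
    using pos[OF that] by (simp add: L_def exp_minus)
  have N: "smooth_function X ?N" using smooth_function_cong[OF X e exp_L] .
  have lee: "lee_form \<omega> \<kappa> x [v] = ext_d (fun_form L) \<kappa> x [v]"
    if \<kappa>: "\<kappa> \<in> atlas X" and x: "x \<in> fst \<kappa>" for \<kappa> x v
  proof -
    let ?l = "\<lambda>x. ln (vol_norm X \<omega> \<Omega> x)"
    have "form_eq X 1 (form_minus (codiff \<omega> 2 \<omega>) (dc (fun_form ?l))) form_zero"
      using sol unfolding hull_strominger_def by blast
    then have "codiff \<omega> 2 \<omega> \<kappa> x [J v] = dc (fun_form ?l) \<kappa> x [J v]"
      using \<kappa> x unfolding form_eq_def form_minus_def form_zero_def by simp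
    then have "lee_form \<omega> \<kappa> x [v] = of_real (fun_deriv ?l \<kappa> x (- v))"
      by (simp add: lee_form_def J_form_def dc_fun_form[OF X \<kappa> ln x])
    then show ?thesis
      using linear_neg[OF linear_fun_deriv[OF X \<kappa> ln x]] fun_deriv_minus[OF X \<kappa> ln x]
      by (simp add: ext_d_fun_form[OF X \<kappa> L x]) (simp add: L_def)
  qed
  then have exact: "form_eq X 1 (lee_form \<omega>) (ext_d (fun_form L))" by (rule form_eq_oneI)
  then show "derham_zero X (lee_form \<omega>)" using L unfolding derham_zero_def by blast
  have closed: "form_eq X 2 (ext_d (lee_form \<omega>)) form_zero"
    unfolding form_eq_def
  proof (intro ballI allI impI)
    fix \<kappa> x and vs :: "(complex ^ 'n) list"
    assume \<kappa>: "\<kappa> \<in> atlas X" and x: "x \<in> fst \<kappa>" and len: "length vs = 2"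
    then obtain u v where vs: "vs = [u, v]" by (auto simp: numeral_2_eq_2 length_Suc_conv)
    have "ext_d (lee_form \<omega>) \<kappa> x [u, v] = ext_d (ext_d (fun_form L)) \<kappa> x [u, v]"
      by (rule ext_d_cong[OF X \<kappa> x, of _ 1]) (auto simp: length_Suc_conv lee[OF \<kappa>])
    then show "ext_d (lee_form \<omega>) \<kappa> x vs = form_zero \<kappa> x vs"
      by (simp add: vs form_zero_def ext_d_ext_d_fun_form[OF X \<kappa> L x])
  qed
  have "vol_norm X \<omega> ?\<Psi> x = 1" if "x \<in> points X" for x
    using vol_norm_fun_times[OF X \<omega> can N that] pos[OF that] by simp
  then have SU: "SU_structure X ?\<Psi> \<omega>"
    using canonical_section_fun_times[OF X N can] \<omega> by (simp add: SU_structure_def)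
  have "form_eq X (CARD('n) + 1) (form_minus (ext_d ?\<Psi>) (wedge 1 (lee_form \<omega>) ?\<Psi>)) form_zero"
    unfolding form_eq_def
  proof (intro ballI allI impI)
    fix \<kappa> x and vs :: "(complex ^ 'n) list"
    assume \<kappa>: "\<kappa> \<in> atlas X" and x: "x \<in> fst \<kappa>" and len: "length vs = CARD('n) + 1"
    have eN: "?N x = exp (L x)" if "x \<in> fst \<kappa>" for x
      using exp_L complex_manifold_chart(2)[OF X \<kappa>] that by auto
    have "ext_d ?\<Psi> \<kappa> x vs = ext_d (fun_times (\<lambda>x. exp (L x)) \<Omega>) \<kappa> x vs"
      using len by (intro ext_d_cong[OF X \<kappa> x, of _ "CARD('n)"]) (simp_all add: fun_times_def flip: eN)
    also have "\<dots> = of_real (exp (L x)) * wedge 1 (ext_d (fun_form L)) \<Omega> \<kappa> x vs"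
      using len holomorphic_imp_closed[OF X \<Omega> \<kappa> x, of vs]
      by (simp add: ext_d_exp_times[OF X \<kappa> L e form x])
    also have "\<dots> = wedge 1 (lee_form \<omega>) ?\<Psi> \<kappa> x vs"
      unfolding wedge_one_alt_sum alt_sum_mult[symmetric]
      by (simp add: lee[OF \<kappa> x] fun_times_def mult.left_commute flip: eN[OF x])
    finally show "form_minus (ext_d ?\<Psi>) (wedge 1 (lee_form \<omega>) ?\<Psi>) \<kappa> x vs = form_zero \<kappa> x vs"
      by (simp add: form_minus_def form_zero_def)
  qed
  then show "twisted_hull_strominger X G K c P ?\<Psi> \<omega> h"
    using sol SU closed unfolding hull_strominger_def twisted_hull_strominger_def by blast
qed

theorem proposition2p5:
  fixes X :: "('x, complex ^ 'n) cmanifold"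
    and G :: "('g, 'v::complex_model_space) lie_group"
    and K :: "'g set"
    and c :: "'v \<Rightarrow> 'v \<Rightarrow> complex"
    and P :: "('p, 'w::complex_model_space, 'x, 'g) pbundle"
  assumes "complex_manifold X" and "compact_space (man_top X)"
    and "first_chern_class_zero X"
    and "complex_reductive_group G" and "maximal_compact_subgroup K G"
    and "invariant_pairing G K c"
    and "holomorphic_principal_bundle X G P"
  shows "(\<forall>\<Psi> \<omega> h \<phi>.
            twisted_hull_strominger X G K c P \<Psi> \<omega> h \<and> derham_zero X (lee_form \<omega>) \<and>
            smooth_function X \<phi> \<and> form_eq X 1 (lee_form \<omega>) (ext_d (fun_form \<phi>)) \<longrightarrow>
              holomorphic_volume_form X (fun_times (\<lambda>x. exp (- \<phi> x)) \<Psi>) \<and>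
              hull_strominger X (fun_times (\<lambda>x. exp (- \<phi> x)) \<Psi>) G K c P \<omega> h) \<and>
         (\<forall>\<Omega> \<omega> h.
            holomorphic_volume_form X \<Omega> \<and> hull_strominger X \<Omega> G K c P \<omega> h \<longrightarrow>
              twisted_hull_strominger X G K c P
                (fun_times (\<lambda>x. inverse (vol_norm X \<omega> \<Omega> x)) \<Omega>) \<omega> h \<and>
              derham_zero X (lee_form \<omega>))"
proof (intro conjI allI impI)
  fix \<Psi> \<omega> h \<phi>
  assume "twisted_hull_strominger X G K c P \<Psi> \<omega> h \<and> derham_zero X (lee_form \<omega>) \<and>
    smooth_function X \<phi> \<and> form_eq X 1 (lee_form \<omega>) (ext_d (fun_form \<phi>))"
  then have *: "twisted_hull_strominger X G K c P \<Psi> \<omega> h" "smooth_function X \<phi>"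
    "form_eq X 1 (lee_form \<omega>) (ext_d (fun_form \<phi>))" by blast+
  show "holomorphic_volume_form X (fun_times (\<lambda>x. exp (- \<phi> x)) \<Psi>)"
    by (rule twisted_imp_hull_strominger(1)[OF assms(1) *])
  show "hull_strominger X (fun_times (\<lambda>x. exp (- \<phi> x)) \<Psi>) G K c P \<omega> h"
    by (rule twisted_imp_hull_strominger(2)[OF assms(1) *])
next
  fix \<Omega> \<omega> h
  assume "holomorphic_volume_form X \<Omega> \<and> hull_strominger X \<Omega> G K c P \<omega> h"
  then have *: "holomorphic_volume_form X \<Omega>" "hull_strominger X \<Omega> G K c P \<omega> h" by blast+
  show "twisted_hull_strominger X G K c P (fun_times (\<lambda>x. inverse (vol_norm X \<omega> \<Omega> x)) \<Omega>) \<omega> h"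
    by (rule hull_strominger_imp_twisted(1)[OF assms(1) *])
  show "derham_zero X (lee_form \<omega>)"
    by (rule hull_strominger_imp_twisted(2)[OF assms(1) *])
qed

end
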